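(* Let $d=1$, $\theta>0$, $V(x)=\frac{x^4}4-\frac{x^2}2$, $W(x,y)=\theta(x-y)^2$, and let $0<\sigma^2<\sigma_c^2$. For any $\varepsilon>0$ there exist $\alpha_\varepsilon\in[0,1)$ and $\overline\eta_\varepsilon>0$ such that for any $m\geqslant\varepsilon$, $$|f(m)-m_+|\leqslant\alpha_\varepsilon|m-m_+|,$$ and for any $\rho\in\mathcal P_2(\mathbb R)$ with $|m(\rho)|\geqslant\varepsilon$, $$\mathcal F(\rho)-\inf\mathcal F\leqslant\overline\eta_\varepsilon\,\sigma^4\,\mathcal I(\rho|\Gamma(\rho)).$$ In other words, for any $\varepsilon>0$, the local non-linear log-Sobolev inequality $\mathcal F(\rho)-\inf_{\mathcal A_\varepsilon}\mathcal F\leqslant\overline\eta_\varepsilon\sigma^4\mathcal I(\rho|\Gamma(\rho))$ holds for all $\rho\in\mathcal A_\varepsilon=\{\rho\in\mathcal P_2(\mathbb R):|m(\rho)|\geqslant\varepsilon\}$.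
   Context: $\mathcal P_2(\mathbb R)$: probability measures on $\mathbb R$ with finite second moment; $m(\rho)=\int_{\mathbb R}x\,\rho(\mathrm dx)$. The free energy is $$\mathcal F(\rho)=\sigma^2\int\rho\ln\rho+\int V\rho+\frac12\int_{\mathbb R^2}W\rho^{\otimes2}$$ ($+\infty$ if $\rho$ is not absolutely continuous), and $\inf\mathcal F$ is its infimum over $\mathcal P_2(\mathbb R)$. For $m\in\mathbb R$, $\rho_m$ is the probability density $\rho_m(x)\propto\exp\left(-\frac1{\sigma^2}[V(x)+\theta x^2-2\theta xm]\right)$, $f(m)=\int x\rho_m(x)\mathrm dx$, and $\Gamma(\rho)=\rho_{m(\rho)}$. $\mathcal I(\nu|\mu)=\int|\nabla\ln\frac{\mathrm d\nu}{\mathrm d\mu}|^2\mathrm d\nu$ ($+\infty$ when not defined). Known fact defining $\sigma_c^2$ and $m_+$: there is $\sigma_c^2>0$ (depending on $\theta$) such that for $\sigma^2\geqslant\sigma_c^2$ the unique fixed point of $f$ is $0$, and for $\sigma^2<\sigma_c^2$, $f$ has exactly three fixed points $m_-<0<m_+$ and $0$, with $m_-=-m_+$. *)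

theory Defs
  imports "HOL-Probability.Probability"
begin

definition P2 :: "real measure set" where
  "P2 = {\<rho>. real_distribution \<rho> \<and> integrable \<rho> (\<lambda>x. x\<^sup>2)}"

definition barycenter :: "real measure \<Rightarrow> real" where
  "barycenter \<rho> = (\<integral>x. x \<partial>\<rho>)"

definition A_eps :: "real \<Rightarrow> real measure set" where
  "A_eps \<epsilon> = {\<rho> \<in> P2. \<epsilon> \<le> \<bar>barycenter \<rho>\<bar>}"


text \<open>
  Integral with values in the extended reals, as the integral of the positive part minus that
  of the negative part (\<^const>\<open>ennreal\<close> truncates negative numbers to 0). Unlike the Bochner
  integral, it does not return 0 when the integral diverges. In the free energy below, the negative
  parts all have finite integral for measures in \<^const>\<open>P2\<close>, so that
  \<open>\<infinity> - \<infinity>\<close> never occurs there.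
\<close>

definition ext_integral :: "'a measure \<Rightarrow> ('a \<Rightarrow> real) \<Rightarrow> ereal" where
  "ext_integral M g =
     enn2ereal (\<integral>\<^sup>+x. ennreal (g x) \<partial>M) - enn2ereal (\<integral>\<^sup>+x. ennreal (- g x) \<partial>M)"

definition dens :: "real measure \<Rightarrow> real \<Rightarrow> real" where
  "dens \<rho> x = enn2real (RN_deriv lborel \<rho> x)"

text \<open>In \<open>dens \<rho> x * ln (dens \<rho> x)\<close> the usual convention \<open>0 ln 0 = 0\<close> holds automatically.\<close>

definition free_energy ::
    "real \<Rightarrow> (real \<Rightarrow> real) \<Rightarrow> (real \<Rightarrow> real \<Rightarrow> real) \<Rightarrow> real measure \<Rightarrow> ereal" where
  "free_energy \<sigma> V W \<rho> =
     (if absolutely_continuous lborel \<rho>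
      then ereal (\<sigma>\<^sup>2) * ext_integral lborel (\<lambda>x. dens \<rho> x * ln (dens \<rho> x))
           + ext_integral \<rho> V
           + ereal (1/2) * ext_integral (\<rho> \<Otimes>\<^sub>M \<rho>) (\<lambda>(x, y). W x y)
      else \<infinity>)"


text \<open>
  \<open>has_weak_deriv h g\<close>: the function \<open>h\<close> coincides almost everywhere with a locally absolutely
  continuous function whose derivative is the locally integrable function \<open>g\<close>; on the real line
  this means that \<open>h\<close> is weakly differentiable with weak derivative \<open>g\<close>.
\<close>

definition has_weak_deriv :: "(real \<Rightarrow> real) \<Rightarrow> (real \<Rightarrow> real) \<Rightarrow> bool" where
  "has_weak_deriv h g \<longleftrightarrow>
     (\<forall>a b. set_integrable lborel {a..b} g) \<and>
     (\<exists>v. (AE x in lborel. h x = v x) \<and>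
          (\<forall>a b. a \<le> b \<longrightarrow> v b - v a = (LINT t:{a..b}|lborel. g t)))"

definition weak_deriv :: "(real \<Rightarrow> real) \<Rightarrow> real \<Rightarrow> real" where
  "weak_deriv h = (SOME g. has_weak_deriv h g)"

text \<open>
  Relative Fisher information of \<open>\<nu>\<close> with respect to \<open>\<mu>\<close>. With \<open>h\<close> the density of \<open>\<nu>\<close> with
  respect to \<open>\<mu>\<close>, the gradient of \<open>ln h\<close> is \<open>h' / h\<close>, which is only needed \<open>\<nu>\<close>-almost everywhere,
  hence only where \<open>h > 0\<close>; in particular \<open>h\<close> is allowed to vanish. The weak derivative is taken
  with respect to Lebesgue measure, so this is meant for \<open>\<mu>\<close> equivalent to Lebesgue measure.
\<close>

definition rel_fisher :: "real measure \<Rightarrow> real measure \<Rightarrow> ennreal" where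
  "rel_fisher \<nu> \<mu> =
     (let h = (\<lambda>x. enn2real (RN_deriv \<mu> \<nu> x)) in
      if absolutely_continuous \<mu> \<nu> \<and> (\<exists>g. has_weak_deriv h g)
      then \<integral>\<^sup>+x. ennreal ((weak_deriv h x / h x)\<^sup>2) \<partial>\<nu>
      else \<infinity>)"


definition V_dw :: "real \<Rightarrow> real" where
  "V_dw x = x ^ 4 / 4 - x\<^sup>2 / 2"

definition W_quad :: "real \<Rightarrow> real \<Rightarrow> real \<Rightarrow> real" where
  "W_quad \<theta> x y = \<theta> * (x - y)\<^sup>2"

definition gibbs_weight :: "real \<Rightarrow> real \<Rightarrow> real \<Rightarrow> real \<Rightarrow> real" where
  "gibbs_weight \<theta> \<sigma> m x = exp (- (1 / \<sigma>\<^sup>2) * (V_dw x + \<theta> * x\<^sup>2 - 2 * \<theta> * x * m))"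

definition gibbs_dens :: "real \<Rightarrow> real \<Rightarrow> real \<Rightarrow> real \<Rightarrow> real" where
  "gibbs_dens \<theta> \<sigma> m x = gibbs_weight \<theta> \<sigma> m x / (\<integral>y. gibbs_weight \<theta> \<sigma> m y \<partial>lborel)"

definition gibbs :: "real \<Rightarrow> real \<Rightarrow> real \<Rightarrow> real measure" where
  "gibbs \<theta> \<sigma> m = density lborel (\<lambda>x. ennreal (gibbs_dens \<theta> \<sigma> m x))"

definition mean_map :: "real \<Rightarrow> real \<Rightarrow> real \<Rightarrow> real" where
  "mean_map \<theta> \<sigma> m = (\<integral>x. x * gibbs_dens \<theta> \<sigma> m x \<partial>lborel)"

definition Gamma_map :: "real \<Rightarrow> real \<Rightarrow> real measure \<Rightarrow> real measure" where
  "Gamma_map \<theta> \<sigma> \<rho> = gibbs \<theta> \<sigma> (barycenter \<rho>)"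


definition is_crit_var :: "real \<Rightarrow> real \<Rightarrow> bool" where
  "is_crit_var \<theta> s \<longleftrightarrow>
     0 < s \<and>
     (\<forall>\<sigma>>0. s \<le> \<sigma>\<^sup>2 \<longrightarrow> {m. mean_map \<theta> \<sigma> m = m} = {0}) \<and>
     (\<forall>\<sigma>>0. \<sigma>\<^sup>2 < s \<longrightarrow> (\<exists>p>0. {m. mean_map \<theta> \<sigma> m = m} = {- p, 0, p}))"

text \<open>
  The critical variance (a value of \<open>\<sigma>\<^sup>2\<close>, not of \<open>\<sigma>\<close>). Two different numbers cannot both satisfy
  \<^const>\<open>is_crit_var\<close>, as the numbers of fixed points would conflict for \<open>\<sigma>\<^sup>2\<close> between them.
\<close>

definition crit_var :: "real \<Rightarrow> real" where
  "crit_var \<theta> = (THE s. is_crit_var \<theta> s)"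

definition m_plus :: "real \<Rightarrow> real \<Rightarrow> real" where
  "m_plus \<theta> \<sigma> = (THE m. 0 < m \<and> mean_map \<theta> \<sigma> m = m)"

end

theory Submission
  imports Defs "HOL-Real_Asymp.Real_Asymp"
begin

text \<open>
  Write \<open>\<rho>\<^sub>m\<close> for the Gibbs measure with mean field \<open>m\<close>, \<open>Z\<^sub>m\<close> for its partition function
  \<open>\<integral> exp (- (V + \<theta> x\<^sup>2 - 2 \<theta> x m) / \<sigma>\<^sup>2)\<close> and \<open>p = m\<^sub>+\<close>. Expanding the square in
  \<open>W\<close> gives, for every \<open>\<rho>\<close> with mean \<open>m\<close>, the identity

  \<open>\<F>(\<rho>) = \<sigma>\<^sup>2 H(\<rho> | \<rho>\<^sub>m) + E(m)\<close>, with \<open>E(m) = \<theta> m\<^sup>2 - \<sigma>\<^sup>2 ln Z\<^sub>m\<close> and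
  \<open>E' = 2 \<theta> (id - f)\<close>,

  where \<open>H\<close> is the relative entropy. Hence \<open>inf \<F> \<ge> E(p)\<close>, as soon as \<open>p\<close> is known to
  minimise \<open>E\<close>, and the excess \<open>\<F>(\<rho>) - inf \<F>\<close> is at most
  \<open>\<sigma>\<^sup>2 H(\<rho> | \<rho>\<^sub>m) + (E(m) - E(p))\<close>. Three facts control it by the Fisher information.

  \<^item> \<open>f\<close> is odd, increasing and strictly concave on the half line: its slope is a multiple of the
    variance of \<open>\<rho>\<^sub>m\<close>, and that variance strictly decreases with \<open>|m|\<close>
    (\<open>tilted_variance_strict_decreasing\<close>; an inequality of Griffiths-Hurst-Sherman type). For two
    independent copies \<open>x, y\<close> of \<open>\<rho>\<^sub>m\<close>, the coordinates \<open>s = (x + y)/2\<close> and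
    \<open>t = (x - y)/2\<close> are coupled through the single term \<open>s\<^sup>2 t\<^sup>2\<close>. So a large \<open>|s|\<close>
    makes \<open>t\<^sup>2\<close> small, while a larger tilt makes \<open>|s|\<close> larger; both steps are instances of a
    strict Chebyshev inequality. Concavity yields the fixed points, and the slope of the chord of
    \<open>f\<close> from \<open>\<epsilon>\<close> (or from \<open>p/2\<close>, if that is smaller) to \<open>p\<close> is the contraction factor \<open>\<alpha>\<close>.

  \<^item> \<open>H(\<rho> | \<rho>\<^sub>m) \<ge> (m - f(m))\<^sup>2 / (2 Var \<rho>\<^sub>0)\<close> for all \<open>\<rho>\<close> with mean \<open>m\<close>
    (\<open>tilted_entropy_controls_mean\<close>). This is the Gibbs variational principle, used with tilts of
    \<open>\<rho>\<^sub>m\<close>, whose log-partition function has curvature at most \<open>Var \<rho>\<^sub>0\<close> by the first fact. As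
    \<open>|m - f(m)| \<ge> (1 - \<alpha>) ||m| - p|\<close> if \<open>|m| \<ge> \<epsilon>\<close>, and
    \<open>E(m) - E(p) \<le> \<theta> (|m| - p)\<^sup>2\<close>, the energy gap is controlled by the entropy.

  \<^item> The entropy is controlled by the Fisher information, with a constant that does not depend on
    \<open>m\<close>: the logarithmic Sobolev inequality \<open>log_sobolev_tilted_double_well\<close>. Adding the bounded
    function \<open>- (32/27) / (1 + x\<^sup>2)\<close> to \<open>V\<close> makes \<open>V + \<theta> x\<^sup>2\<close> uniformly convex; for
    uniformly convex potentials the inequality follows from monotone transport on compact intervals,
    and a bounded change of the potential costs a constant factor only. The linear tilt changes
    neither convexity nor the perturbation.

  The critical variance is defined as the unique number with a certain property, so its existence
  belongs to the proof (\<open>is_crit_var_exists\<close>): \<open>f'(0)\<close> is strictly decreasing in \<open>\<sigma>\<close> and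
  crosses the value 1.
\<close>

section \<open>Exponential moments of quartic weights\<close>

definition quartic_weight :: "real \<Rightarrow> real \<Rightarrow> real \<Rightarrow> real" where
  "quartic_weight a b x = exp (- (a * x ^ 4 + b * x\<^sup>2))"

definition quartic_moment :: "nat \<Rightarrow> real \<Rightarrow> real \<Rightarrow> real \<Rightarrow> real" where
  "quartic_moment k a b h = (LBINT x. x ^ k * exp (h * x) * quartic_weight a b x)"

lemma quartic_weight_pos [simp]: "0 < quartic_weight a b x"
  by (simp add: quartic_weight_def)

lemma quartic_weight_nonneg [simp]: "0 \<le> quartic_weight a b x"
  by (simp add: quartic_weight_def)

lemma quartic_weight_minus [simp]: "quartic_weight a b (- x) = quartic_weight a b x"
  by (simp add: quartic_weight_def)

lemma measurable_quartic_weight [measurable]: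
  "(\<lambda>x. quartic_weight (a x) (b x) (f x)) \<in> borel_measurable M"
  if [measurable]: "a \<in> borel_measurable M" "b \<in> borel_measurable M" "f \<in> borel_measurable M"
  unfolding quartic_weight_def by measurable

lemma quartic_weight_shift:
  "quartic_weight a b x = exp (c * x\<^sup>2) * quartic_weight a (b + c) x"
  by (simp add: quartic_weight_def flip: exp_add) (simp add: algebra_simps)

lemma integrable_exp_minus_square: "integrable lborel (\<lambda>x::real. exp (- x\<^sup>2))"
proof -
  have "integrable lborel (\<lambda>x. sqrt pi * normal_density 0 (1 / sqrt 2) x)"
    by (intro integrable_mult_right integrable_normal_density) simp
  moreover have "sqrt pi * normal_density 0 (1 / sqrt 2) x = exp (- x\<^sup>2)" for x
    by (simp add: normal_density_def power_divide)
      (simp add: real_sqrt_divide field_simps)?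
  ultimately show ?thesis by simp
qed

lemma quartic_weight_le:
  assumes "0 < a"
  shows "quartic_weight a b x \<le> exp ((b - 1)\<^sup>2 / (4 * a)) * exp (- x\<^sup>2)"
proof -
  have "0 \<le> (2 * a * x\<^sup>2 + (b - 1))\<^sup>2 / (4 * a)" using assms by simp
  also have "\<dots> = a * x ^ 4 + (b - 1) * x\<^sup>2 + (b - 1)\<^sup>2 / (4 * a)"
  proof -
    have "(2 * a * x\<^sup>2 + (b - 1))\<^sup>2 = 4 * a * (a * x ^ 4 + (b - 1) * x\<^sup>2) + (b - 1)\<^sup>2"
      by algebra
    with assms show ?thesis by (simp add: add_divide_distrib)
  qed
  finally show ?thesis
    by (simp add: quartic_weight_def flip: exp_add) (simp add: algebra_simps)
qed

lemma integrable_quartic_weight: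
  assumes "0 < a" shows "integrable lborel (quartic_weight a b)"
proof (rule Bochner_Integration.integrable_bound)
  show "integrable lborel (\<lambda>x. exp ((b - 1)\<^sup>2 / (4 * a)) * exp (- x\<^sup>2))"
    by (intro integrable_mult_right integrable_exp_minus_square)
  show "AE x in lborel. norm (quartic_weight a b x) \<le> norm (exp ((b - 1)\<^sup>2 / (4 * a)) * exp (- x\<^sup>2))"
    using quartic_weight_le[OF assms] by (intro AE_I2) simp
qed measurable

lemma abs_le_one_plus_square: "\<bar>x\<bar> \<le> 1 + x\<^sup>2" for x :: real
  using zero_le_power2[of "\<bar>x\<bar> - 1"] abs_ge_zero[of x] unfolding power2_diff by simp

lemma power_le_fact_exp: "x ^ k \<le> fact k * exp x" if "0 \<le> x" for x :: real
proof -
  have "x ^ k / fact k \<le> (\<Sum>n. x ^ n / fact n)"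
    using sum_le_suminf[of "\<lambda>n. x ^ n / fact n" "{k}"] summable_exp_generic[of x] that
    by (simp add: divide_inverse mult.commute)
  also have "\<dots> = exp x" by (simp add: exp_def divide_inverse mult.commute)
  finally show ?thesis by (simp add: pos_divide_le_eq mult.commute)
qed

text \<open>
  The quartic term absorbs any quadratic exponential, hence every polynomial and every linear
  exponential, at the price of changing \<open>b\<close>. The existence of all moments below reduces to this.
\<close>
lemma integrable_dominated_quartic_weight:
  assumes a: "0 < a" and [measurable]: "g \<in> borel_measurable borel"
    and bound: "\<And>x. \<bar>g x\<bar> \<le> C * (\<bar>x\<bar> ^ k * exp (h * \<bar>x\<bar>))"
  shows "integrable lborel (\<lambda>x. g x * quartic_weight a b x)"
proof (rule Bochner_Integration.integrable_bound)
  show "integrable lborel (\<lambda>x. \<bar>C\<bar> * fact k * exp (\<bar>h\<bar> + 1) * quartic_weight a (b - (\<bar>h\<bar> + 1)) x)"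
    by (intro integrable_mult_right integrable_quartic_weight a)
  have "\<bar>g x\<bar> * quartic_weight a b x
    \<le> \<bar>C\<bar> * fact k * exp (\<bar>h\<bar> + 1) * quartic_weight a (b - (\<bar>h\<bar> + 1)) x" for x
  proof -
    note x = abs_le_one_plus_square[of x]
    have "\<bar>g x\<bar> \<le> \<bar>C\<bar> * (\<bar>x\<bar> ^ k * exp (h * \<bar>x\<bar>))"
      by (rule order_trans[OF bound]) (intro mult_right_mono, auto)
    also have "\<dots> \<le> \<bar>C\<bar> * ((fact k * exp \<bar>x\<bar>) * exp (\<bar>h\<bar> * \<bar>x\<bar>))"
      by (intro mult_left_mono mult_mono power_le_fact_exp) (auto intro: mult_right_mono)
    also have "\<dots> = \<bar>C\<bar> * fact k * exp ((\<bar>h\<bar> + 1) * \<bar>x\<bar>)"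
      by (simp add: algebra_simps exp_add)
    also have "\<dots> \<le> \<bar>C\<bar> * fact k * exp ((\<bar>h\<bar> + 1) * (1 + x\<^sup>2))"
      using x by (intro mult_left_mono) (auto intro!: mult_left_mono)
    finally have "\<bar>g x\<bar> * quartic_weight a b x
      \<le> \<bar>C\<bar> * fact k * exp ((\<bar>h\<bar> + 1) * (1 + x\<^sup>2)) * quartic_weight a b x"
      by (rule mult_right_mono) simp
    also have "\<dots> = \<bar>C\<bar> * fact k * exp (\<bar>h\<bar> + 1) * quartic_weight a (b - (\<bar>h\<bar> + 1)) x"
      using quartic_weight_shift[of a "b - (\<bar>h\<bar> + 1)" x "\<bar>h\<bar> + 1"]
      by (simp add: algebra_simps exp_add)
    finally show ?thesis .
  qed
  then show "AE x in lborel. norm (g x * quartic_weight a b x)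
    \<le> norm (\<bar>C\<bar> * fact k * exp (\<bar>h\<bar> + 1) * quartic_weight a (b - (\<bar>h\<bar> + 1)) x)"
    by (auto simp: abs_mult)
qed measurable

lemma mult_le_abs_mult_abs: "h * x \<le> \<bar>h\<bar> * \<bar>x\<bar>" for h x :: real
  by (simp flip: abs_mult)

lemma integrable_quartic_moment:
  assumes "0 < a"
  shows "integrable lborel (\<lambda>x. x ^ k * exp (h * x) * quartic_weight a b x)"
proof (rule integrable_dominated_quartic_weight[OF assms])
  fix x show "\<bar>x ^ k * exp (h * x)\<bar> \<le> 1 * (\<bar>x\<bar> ^ k * exp (\<bar>h\<bar> * \<bar>x\<bar>))"
    using mult_le_abs_mult_abs[of h x] by (simp add: abs_mult power_abs mult_left_mono)
qed measurable

lemma integral_pos_of_pos: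
  fixes f :: "real \<Rightarrow> real"
  assumes "integrable lborel f" "AE x in lborel. 0 < f x"
  shows "0 < (LBINT x. f x)"
proof -
  have ae: "AE x in lborel. 0 \<le> f x" using assms(2) by eventually_elim simp
  have "(LBINT x. f x) \<noteq> 0"
  proof
    assume "(LBINT x. f x) = 0"
    then have "AE x in lborel. f x = 0"
      using integral_nonneg_eq_0_iff_AE[OF assms(1) ae] by simp
    with assms(2) have "AE x in (lborel::real measure). False" by eventually_elim simp
    then show False by (simp add: AE_iff_null null_sets_def)
  qed
  with integral_nonneg_AE[OF ae] show ?thesis by simp
qed

lemma AE_lborel_neq: "AE x in lborel. x \<noteq> (c::real)"
  by (rule AE_I[of _ _ "{c}"]) auto

lemma quartic_moment_even_pos:
  assumes "0 < a" "even k" shows "0 < quartic_moment k a b h"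
  unfolding quartic_moment_def
proof (intro integral_pos_of_pos integrable_quartic_moment assms(1))
  show "AE x in lborel. 0 < x ^ k * exp (h * x) * quartic_weight a b x"
    using AE_lborel_neq[of 0] by eventually_elim (use assms(2) in \<open>simp add: zero_less_power_eq\<close>)
qed

lemma quartic_moment_minus: "quartic_moment k a b (- h) = (- 1) ^ k * quartic_moment k a b h"
proof -
  have "quartic_moment k a b (- h)
    = (LBINT x. (- x) ^ k * exp ((- h) * (- x)) * quartic_weight a b (- x))"
    using lborel_integral_real_affine[of "-1" "\<lambda>x. x ^ k * exp ((- h) * x) * quartic_weight a b x" 0]
    by (simp add: quartic_moment_def)
  also have "\<dots> = (LBINT x. (- 1) ^ k * (x ^ k * exp (h * x) * quartic_weight a b x))"
  proof (rule Bochner_Integration.integral_cong)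
    show "(- x) ^ k * exp (- h * - x) * quartic_weight a b (- x)
      = (- 1) ^ k * (x ^ k * exp (h * x) * quartic_weight a b x)" for x
      using power_mult_distrib[of "- 1" x k] by simp
  qed simp
  finally show ?thesis by (simp add: quartic_moment_def)
qed

lemma exp_taylor2_bound: "\<bar>exp y - 1 - y\<bar> \<le> y\<^sup>2 * exp \<bar>y\<bar>" for y :: real
proof -
  obtain t where t: "\<bar>t\<bar> \<le> \<bar>y\<bar>" "exp y = (\<Sum>m<2. y ^ m / fact m) + exp t / fact 2 * y ^ 2"
    using Maclaurin_exp_le[of y 2] by blast
  then have "exp y - 1 - y = exp t / 2 * y\<^sup>2" by (simp add: numeral_2_eq_2)
  then have "\<bar>exp y - 1 - y\<bar> = exp t / 2 * y\<^sup>2"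
    by (simp only: abs_mult) simp
  also have "\<dots> \<le> exp \<bar>y\<bar> * y\<^sup>2"
  proof (rule mult_right_mono)
    have "exp t \<le> exp \<bar>y\<bar>" using t(1) by simp
    then show "exp t / 2 \<le> exp \<bar>y\<bar>" using exp_gt_zero[of t] by linarith
  qed simp
  finally show ?thesis by (simp add: mult.commute)
qed

text \<open>
  Differentiation under the integral sign in an exponential family: the second-order Taylor bound
  of the exponential makes the error of the difference quotient at most a constant times the
  increment. It is used with \<open>\<phi> x = x\<close>, for the tilt, and with \<open>\<phi> x = - x\<^sup>2\<close>, for the quadratic
  coefficient.
\<close>
lemma has_real_derivative_integral_exp:
  fixes \<phi> g :: "'a \<Rightarrow> real"
  assumes i0: "\<And>s. integrable M (\<lambda>x. g x * exp (s * \<phi> x))"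
    and i1: "integrable M (\<lambda>x. \<phi> x * g x * exp (s * \<phi> x))"
    and i2: "integrable M (\<lambda>x. (\<phi> x)\<^sup>2 * exp \<bar>\<phi> x\<bar> * (g x * exp (s * \<phi> x)))"
  shows "((\<lambda>s. \<integral>x. g x * exp (s * \<phi> x) \<partial>M) has_real_derivative
      (\<integral>x. \<phi> x * g x * exp (s * \<phi> x) \<partial>M)) (at s)"
proof -
  let ?D = "\<integral>x. \<phi> x * g x * exp (s * \<phi> x) \<partial>M"
  let ?I = "\<lambda>s. \<integral>x. g x * exp (s * \<phi> x) \<partial>M"
  let ?C = "\<integral>x. \<bar>(\<phi> x)\<^sup>2 * exp \<bar>\<phi> x\<bar> * (g x * exp (s * \<phi> x))\<bar> \<partial>M"
  have bound: "\<bar>(?I (s + d) - ?I s) / d - ?D\<bar> \<le> \<bar>d\<bar> * ?C" if d: "d \<noteq> 0" "\<bar>d\<bar> \<le> 1" for d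
  proof -
    let ?r = "\<lambda>x. g x * exp ((s + d) * \<phi> x) - g x * exp (s * \<phi> x) - d * (\<phi> x * g x * exp (s * \<phi> x))"
    have remainder: "?I (s + d) - ?I s - d * ?D = (\<integral>x. ?r x \<partial>M)"
      using i0 i1 by simp
    have "norm (\<integral>x. ?r x \<partial>M) \<le> (\<integral>x. d\<^sup>2 * \<bar>(\<phi> x)\<^sup>2 * exp \<bar>\<phi> x\<bar> * (g x * exp (s * \<phi> x))\<bar> \<partial>M)"
    proof (rule order_trans[OF integral_norm_bound integral_mono])
      fix x
      have "?r x = g x * exp (s * \<phi> x) * (exp (d * \<phi> x) - 1 - d * \<phi> x)"
        by (simp add: algebra_simps exp_add)
      also have "\<bar>\<dots>\<bar> = \<bar>g x * exp (s * \<phi> x)\<bar> * \<bar>exp (d * \<phi> x) - 1 - d * \<phi> x\<bar>"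
        by (simp add: abs_mult)
      also have "\<dots> \<le> \<bar>g x * exp (s * \<phi> x)\<bar> * ((d * \<phi> x)\<^sup>2 * exp \<bar>\<phi> x\<bar>)"
      proof (intro mult_left_mono order_trans[OF exp_taylor2_bound])
        have "\<bar>d * \<phi> x\<bar> \<le> \<bar>\<phi> x\<bar>" using d by (simp add: abs_mult mult_left_le_one_le)
        then show "exp \<bar>d * \<phi> x\<bar> \<le> exp \<bar>\<phi> x\<bar>" by simp
      qed auto
      also have "\<dots> = d\<^sup>2 * \<bar>(\<phi> x)\<^sup>2 * exp \<bar>\<phi> x\<bar> * (g x * exp (s * \<phi> x))\<bar>"
        by (simp add: abs_mult power_mult_distrib)
      finally show "norm (?r x)
        \<le> d\<^sup>2 * \<bar>(\<phi> x)\<^sup>2 * exp \<bar>\<phi> x\<bar> * (g x * exp (s * \<phi> x))\<bar>" by simp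
    qed (use i0 i1 i2 in auto)
    then have *: "\<bar>?I (s + d) - ?I s - d * ?D\<bar> \<le> d\<^sup>2 * ?C"
      unfolding remainder by simp
    have "\<bar>?I (s + d) - ?I s - d * ?D\<bar> / \<bar>d\<bar> \<le> \<bar>d\<bar> * ?C"
    proof -
      have "\<bar>d\<bar> * ?C * \<bar>d\<bar> = \<bar>d\<bar>\<^sup>2 * ?C" by (simp only: power2_eq_square mult_ac)
      then have eq: "\<bar>d\<bar> * ?C * \<bar>d\<bar> = d\<^sup>2 * ?C" by (simp only: power2_abs)
      show ?thesis by (subst pos_divide_le_eq) (use d in simp, simp only: eq, rule *)
    qed
    moreover have "(?I (s + d) - ?I s) / d - ?D = (?I (s + d) - ?I s - d * ?D) / d"
      using d by (simp add: field_simps)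
    ultimately show ?thesis by (simp only: abs_divide)
  qed
  have "((\<lambda>d. (?I (s + d) - ?I s) / d - ?D) \<longlongrightarrow> 0) (at 0)"
  proof (rule tendsto_0_le)
    show "((\<lambda>d. d) \<longlongrightarrow> (0::real)) (at 0)" by (rule tendsto_ident_at)
    have "eventually (\<lambda>d::real. d \<noteq> 0 \<and> \<bar>d\<bar> < 1) (at 0)"
      by (auto simp: eventually_at dist_real_def intro!: exI[of _ 1])
    then show "eventually (\<lambda>d. norm ((?I (s + d) - ?I s) / d - ?D) \<le> norm d * ?C) (at 0)"
      by eventually_elim (use bound in auto)
  qed
  then show ?thesis by (simp add: DERIV_def LIM_zero_iff)
qed

lemma quartic_moment_deriv:
  assumes a: "0 < a"
  shows "(quartic_moment k a b has_real_derivative quartic_moment (Suc k) a b h) (at h)"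
proof -
  have "((\<lambda>h. LBINT x. (x ^ k * quartic_weight a b x) * exp (h * x)) has_real_derivative
      (LBINT x. x * (x ^ k * quartic_weight a b x) * exp (h * x))) (at h)"
  proof (rule has_real_derivative_integral_exp)
    show "integrable lborel (\<lambda>x. x ^ k * quartic_weight a b x * exp (s * x))" for s
      using integrable_quartic_moment[OF a, of k s b] by (simp add: mult_ac)
    show "integrable lborel (\<lambda>x. x * (x ^ k * quartic_weight a b x) * exp (h * x))"
      using integrable_quartic_moment[OF a, of "Suc k" h b] by (simp add: mult_ac)
    have "integrable lborel (\<lambda>x. (x\<^sup>2 * exp \<bar>x\<bar> * (x ^ k * exp (h * x))) * quartic_weight a b x)"
    proof (rule integrable_dominated_quartic_weight[OF a])
      fix x :: real
      have "\<bar>x\<^sup>2 * exp \<bar>x\<bar> * (x ^ k * exp (h * x))\<bar> = \<bar>x\<bar> ^ (k + 2) * exp (\<bar>x\<bar> + h * x)"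
        by (simp add: abs_mult power_abs power_add exp_add flip: power2_eq_square)
      also have "\<dots> \<le> \<bar>x\<bar> ^ (k + 2) * exp ((\<bar>h\<bar> + 1) * \<bar>x\<bar>)"
        using mult_le_abs_mult_abs[of h x] by (intro mult_left_mono) (auto simp: algebra_simps)
      finally show "\<bar>x\<^sup>2 * exp \<bar>x\<bar> * (x ^ k * exp (h * x))\<bar> \<le> 1 * (\<bar>x\<bar> ^ (k + 2) * exp ((\<bar>h\<bar> + 1) * \<bar>x\<bar>))"
        by simp
    qed measurable
    then show "integrable lborel (\<lambda>x. x\<^sup>2 * exp \<bar>x\<bar> * (x ^ k * quartic_weight a b x * exp (h * x)))"
      by (simp add: mult_ac)
  qed
  moreover have "(\<lambda>h. LBINT x. (x ^ k * quartic_weight a b x) * exp (h * x)) = quartic_moment k a b"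
    by (simp add: quartic_moment_def mult_ac fun_eq_iff)
  moreover have "(LBINT x. x * (x ^ k * quartic_weight a b x) * exp (h * x)) = quartic_moment (Suc k) a b h"
    by (simp add: quartic_moment_def mult_ac)
  ultimately show ?thesis by simp
qed

section \<open>The strict Chebyshev inequality and rotation of two copies\<close>
text \<open>
  Integrating \<open>(F x - F y) (G x - G y) p x p y\<close> over both variables gives twice the difference of
  the two sides. Strictness is asked only where \<open>|x| \<noteq> |y|\<close>, since all functions of interest are even.
\<close>
lemma strict_chebyshev_integral:
  fixes F G p :: "real \<Rightarrow> real"
  assumes ip: "integrable lborel p" and iF: "integrable lborel (\<lambda>x. F x * p x)"
    and iG: "integrable lborel (\<lambda>x. G x * p x)" and iFG: "integrable lborel (\<lambda>x. F x * G x * p x)"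
    and pos: "\<And>x. 0 < p x"
    and opp: "\<And>x y. \<bar>x\<bar> \<noteq> \<bar>y\<bar> \<Longrightarrow> (F x - F y) * (G x - G y) < 0"
  shows "(LBINT x. F x * G x * p x) * (LBINT x. p x)
    < (LBINT x. F x * p x) * (LBINT x. G x * p x)"
proof -
  define P where "P = (LBINT x. p x)"
  define PF where "PF = (LBINT x. F x * p x)"
  define PG where "PG = (LBINT x. G x * p x)"
  define PFG where "PFG = (LBINT x. F x * G x * p x)"
  define inner where "inner = (\<lambda>x. PG * (F x * p x) + PF * (G x * p x) - P * (F x * G x * p x) - PFG * p x)"
  \<comment> \<open>\<open>inner x\<close> is the integral of \<open>- (F x - F y) (G x - G y) p x p y\<close> over \<open>y\<close>\<close>
  have inner_pos: "0 < inner x" for x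
  proof -
    let ?E = "\<lambda>y. (F x * p x) * (G y * p y) + (G x * p x) * (F y * p y)
      - (F x * G x * p x) * p y - p x * (F y * G y * p y)"
    have "0 < (LBINT y. ?E y)"
    proof (rule integral_pos_of_pos)
      show "integrable lborel ?E"
        using ip iF iG iFG by simp
      show "AE y in lborel. 0 < ?E y"
        using AE_lborel_neq[of x] AE_lborel_neq[of "- x"]
      proof eventually_elim
        case (elim y)
        then have "\<bar>x\<bar> \<noteq> \<bar>y\<bar>" by (auto simp: abs_eq_iff)
        then have "0 < (- ((F x - F y) * (G x - G y))) * (p x * p y)"
          using opp[of x y] pos[of x] pos[of y] by (intro mult_pos_pos) auto
        then show ?case by (simp add: algebra_simps)
      qed
    qed
    also have "(LBINT y. ?E y) = (F x * p x) * PG + (G x * p x) * PF - (F x * G x * p x) * P - p x * PFG"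
      using ip iF iG iFG by (simp add: P_def PF_def PG_def PFG_def)
    also have "\<dots> = inner x" by (simp add: inner_def)
    finally show ?thesis .
  qed
  have "0 < (LBINT x. inner x)"
  proof (rule integral_pos_of_pos)
    show "integrable lborel inner"
      unfolding inner_def using ip iF iG iFG by simp
  qed (simp add: inner_pos)
  also have "(LBINT x. inner x) = PG * PF + PF * PG - P * PFG - PFG * P"
    unfolding inner_def using ip iF iG iFG by (simp flip: P_def PF_def PG_def PFG_def)
  finally show ?thesis
    by (simp add: P_def PF_def PG_def PFG_def mult_ac)
qed

lemma even_power_less_iff_abs: "x ^ k < y ^ k \<longleftrightarrow> \<bar>x\<bar> < \<bar>y\<bar>" if "even k" "0 < k" for x y :: real
proof -
  have "y ^ k \<le> x ^ k \<longleftrightarrow> \<bar>y\<bar> \<le> \<bar>x\<bar>"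
    using power_mono_iff[of "\<bar>y\<bar>" "\<bar>x\<bar>" k] that by (simp add: power_even_abs)
  then show ?thesis by (metis not_le)
qed

text \<open>
  Raising \<open>b\<close> multiplies the weight by a decreasing function of \<open>|x|\<close>, so it lowers the mean of
  every even power.
\<close>
lemma quartic_moment_ratio_decreasing:
  assumes a: "0 < a" and b: "b < b'" and k: "even k" "0 < k"
  shows "quartic_moment k a b' 0 * quartic_moment 0 a b 0
    < quartic_moment k a b 0 * quartic_moment 0 a b' 0"
proof -
  let ?F = "\<lambda>x::real. x ^ k" and ?G = "\<lambda>x. exp (- (b' - b) * x\<^sup>2)" and ?p = "quartic_weight a b"
  have Gp: "?G x * ?p x = quartic_weight a b' x" for x
    using quartic_weight_shift[of a b' x "- (b' - b)"] by simp
  have FGp: "?F x * ?G x * ?p x = ?F x * quartic_weight a b' x" for x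
    using Gp[of x] by (simp add: mult.assoc)
  have "(LBINT x. ?F x * ?G x * ?p x) * (LBINT x. ?p x)
    < (LBINT x. ?F x * ?p x) * (LBINT x. ?G x * ?p x)"
  proof (rule strict_chebyshev_integral)
    fix x y :: real assume "\<bar>x\<bar> \<noteq> \<bar>y\<bar>"
    then consider "\<bar>x\<bar> < \<bar>y\<bar>" | "\<bar>y\<bar> < \<bar>x\<bar>" by linarith
    then show "(?F x - ?F y) * (?G x - ?G y) < 0"
    proof cases
      case 1
      then have "x\<^sup>2 < y\<^sup>2" "x ^ k < y ^ k" by (simp_all add: even_power_less_iff_abs k)
      then show ?thesis using b by (intro mult_neg_pos) auto
    next
      case 2
      then have "y\<^sup>2 < x\<^sup>2" "y ^ k < x ^ k" by (simp_all add: even_power_less_iff_abs k)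
      then show ?thesis using b by (intro mult_pos_neg) auto
    qed
  qed (use integrable_quartic_moment[OF a, of _ 0] in
      \<open>simp_all only: Gp FGp, simp_all add: integrable_quartic_weight a\<close>)
  then show ?thesis unfolding Gp FGp by (simp add: quartic_moment_def)
qed

lemma quartic_moment_antimono:
  assumes a: "0 < a" and "b \<le> b'" and k: "even k"
  shows "quartic_moment k a b' 0 \<le> quartic_moment k a b 0"
  unfolding quartic_moment_def
proof (intro integral_mono integrable_quartic_moment a mult_left_mono)
  show "quartic_weight a b' x \<le> quartic_weight a b x" for x
    using assms by (simp add: quartic_weight_def mult_right_mono)
qed (use k in \<open>simp add: zero_le_even_power\<close>)

text \<open>
  The substitution \<open>x = s + t\<close>, \<open>y = s - t\<close>, done one variable at a time; 2 is its Jacobian.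
\<close>
lemma nn_integral_rotate:
  fixes F :: "real \<Rightarrow> real \<Rightarrow> ennreal"
  assumes [measurable]: "case_prod F \<in> borel_measurable (borel \<Otimes>\<^sub>M borel)"
  shows "(\<integral>\<^sup>+x. \<integral>\<^sup>+y. F x y \<partial>lborel \<partial>lborel) = 2 * (\<integral>\<^sup>+s. \<integral>\<^sup>+t. F (s + t) (s - t) \<partial>lborel \<partial>lborel)"
proof -
  have [measurable]: "(\<lambda>z. F (f z) (g z)) \<in> borel_measurable M"
    if [measurable]: "f \<in> borel_measurable M" "g \<in> borel_measurable M" for f g :: "real \<times> real \<Rightarrow> real" and M
    using measurable_compose[OF _ assms, of "\<lambda>z. (f z, g z)" M] by simp
  have [measurable]: "(\<lambda>z. F (f z) (g z)) \<in> borel_measurable M"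
    if [measurable]: "f \<in> borel_measurable M" "g \<in> borel_measurable M" for f g :: "real \<Rightarrow> real" and M
    using measurable_compose[OF _ assms, of "\<lambda>z. (f z, g z)" M] by simp
  have "(\<integral>\<^sup>+x. \<integral>\<^sup>+y. F x y \<partial>lborel \<partial>lborel) = (\<integral>\<^sup>+x. 2 * (\<integral>\<^sup>+t. F x (x - 2 * t) \<partial>lborel) \<partial>lborel)"
  proof (rule nn_integral_cong)
    show "(\<integral>\<^sup>+y. F x y \<partial>lborel) = 2 * (\<integral>\<^sup>+t. F x (x - 2 * t) \<partial>lborel)" for x
      using nn_integral_real_affine[of "F x" "-2" x] by simp
  qed
  also have "\<dots> = 2 * (\<integral>\<^sup>+x. \<integral>\<^sup>+t. F x (x - 2 * t) \<partial>lborel \<partial>lborel)"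
    by (rule nn_integral_cmult) measurable
  also have "(\<integral>\<^sup>+x. \<integral>\<^sup>+t. F x (x - 2 * t) \<partial>lborel \<partial>lborel) = (\<integral>\<^sup>+t. \<integral>\<^sup>+x. F x (x - 2 * t) \<partial>lborel \<partial>lborel)"
    by (rule lborel_pair.Fubini'[symmetric]) measurable
  also have "\<dots> = (\<integral>\<^sup>+t. \<integral>\<^sup>+s. F (s + t) (s - t) \<partial>lborel \<partial>lborel)"
  proof (rule nn_integral_cong)
    show "(\<integral>\<^sup>+x. F x (x - 2 * t) \<partial>lborel) = (\<integral>\<^sup>+s. F (s + t) (s - t) \<partial>lborel)" for t
      using nn_integral_real_affine[of "\<lambda>x. F x (x - 2 * t)" 1 t] by (simp add: add.commute)
  qed
  also have "\<dots> = (\<integral>\<^sup>+s. \<integral>\<^sup>+t. F (s + t) (s - t) \<partial>lborel \<partial>lborel)"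
    by (rule lborel_pair.Fubini') measurable
  finally show ?thesis .
qed

text \<open>
  For two copies of the weight in the coordinates \<open>s\<close>, \<open>t\<close>, this is the \<open>k\<close>-th moment of \<open>t\<close> for
  given \<open>s\<close>, not normalised and without the factor that depends on \<open>s\<close> only. The coupling
  enters through the quadratic coefficient.
\<close>
definition slice_moment :: "nat \<Rightarrow> real \<Rightarrow> real \<Rightarrow> real \<Rightarrow> real" where
  "slice_moment k a b s = quartic_moment k (2 * a) (2 * b + 12 * a * s\<^sup>2) 0"

lemma quartic_weight_rotate:
  "quartic_weight a b (s + t) * quartic_weight a b (s - t)
    = quartic_weight (2 * a) (2 * b) s * quartic_weight (2 * a) (2 * b + 12 * a * s\<^sup>2) t"
proof -
  have "a * (s + t) ^ 4 + b * (s + t)\<^sup>2 + (a * (s - t) ^ 4 + b * (s - t)\<^sup>2)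
    = 2 * a * s ^ 4 + 2 * b * s\<^sup>2 + (2 * a * t ^ 4 + (2 * b + 12 * a * s\<^sup>2) * t\<^sup>2)"
    by algebra
  then show ?thesis
    by (simp add: quartic_weight_def flip: exp_add)
qed

lemma slice_moment_pos: "0 < slice_moment k a b s" if "0 < a" "even k"
  unfolding slice_moment_def using that by (intro quartic_moment_even_pos) auto

lemma measurable_slice_moment [measurable]: "slice_moment k a b \<in> borel_measurable borel"
  unfolding slice_moment_def[abs_def] quartic_moment_def by measurable

lemma integrable_slice_moment:
  assumes a: "0 < a" and k: "even k"
  shows "integrable lborel (\<lambda>s. exp (h * s) * slice_moment k a b s * quartic_weight (2 * a) (2 * b) s)"
proof (rule integrable_dominated_quartic_weight)
  fix s :: real
  have "\<bar>slice_moment k a b s\<bar> = slice_moment k a b s" using slice_moment_pos[of a k b s] a k by simp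
  also have "\<dots> \<le> slice_moment k a b 0"
    unfolding slice_moment_def using a k by (intro quartic_moment_antimono) auto
  finally have "\<bar>exp (h * s) * slice_moment k a b s\<bar> \<le> exp (\<bar>h\<bar> * \<bar>s\<bar>) * slice_moment k a b 0"
    using mult_le_abs_mult_abs[of h s] by (auto simp: abs_mult intro!: mult_mono)
  then show "\<bar>exp (h * s) * slice_moment k a b s\<bar> \<le> slice_moment k a b 0 * (\<bar>s\<bar> ^ 0 * exp (\<bar>h\<bar> * \<bar>s\<bar>))"
    by (simp add: mult_ac)
qed (use a in auto)

text \<open>
  Up to a constant factor, the integral of \<open>(x - y)\<^sup>k\<close> over two tilted copies; the tilt acts on \<open>s\<close>
  alone. The moments for \<open>k = 0\<close> and \<open>k = 2\<close> give the square of the partition function and the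
  numerator of the variance.
\<close>
definition rotated_moment :: "nat \<Rightarrow> real \<Rightarrow> real \<Rightarrow> real \<Rightarrow> real" where
  "rotated_moment k a b h
    = (LBINT s. exp (2 * h * s) * slice_moment k a b s * quartic_weight (2 * a) (2 * b) s)"

lemma nn_integral_two_copies:
  assumes a: "0 < a" and k: "even k"
  shows "(\<integral>\<^sup>+x. \<integral>\<^sup>+y. ennreal ((x - y) ^ k * (exp (h * x) * quartic_weight a b x)
      * (exp (h * y) * quartic_weight a b y)) \<partial>lborel \<partial>lborel) = ennreal (2 * 2 ^ k * rotated_moment k a b h)"
proof -
  let ?F = "\<lambda>x y. ennreal ((x - y) ^ k * (exp (h * x) * quartic_weight a b x) * (exp (h * y) * quartic_weight a b y))"
  have F: "?F (s + t) (s - t) = ennreal (2 ^ k * exp (2 * h * s) * quartic_weight (2 * a) (2 * b) s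
    * (t ^ k * quartic_weight (2 * a) (2 * b + 12 * a * s\<^sup>2) t))" for s t
  proof -
    have "((s + t) - (s - t)) ^ k * (exp (h * (s + t)) * quartic_weight a b (s + t))
        * (exp (h * (s - t)) * quartic_weight a b (s - t))
      = (2 * t) ^ k * (exp (h * (s + t)) * exp (h * (s - t)))
        * (quartic_weight a b (s + t) * quartic_weight a b (s - t))"
      by simp
    also have "\<dots> = 2 ^ k * exp (2 * h * s) * quartic_weight (2 * a) (2 * b) s
      * (t ^ k * quartic_weight (2 * a) (2 * b + 12 * a * s\<^sup>2) t)"
      unfolding quartic_weight_rotate power_mult_distrib by (simp add: algebra_simps flip: exp_add)
    finally show ?thesis by (simp only:)
  qed
  have inner: "(\<integral>\<^sup>+t. ?F (s + t) (s - t) \<partial>lborel)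
    = ennreal (2 ^ k * (exp (2 * h * s) * slice_moment k a b s * quartic_weight (2 * a) (2 * b) s))" for s
  proof -
    have "(\<integral>\<^sup>+t. ?F (s + t) (s - t) \<partial>lborel)
      = ennreal (LBINT t. 2 ^ k * exp (2 * h * s) * quartic_weight (2 * a) (2 * b) s
        * (t ^ k * quartic_weight (2 * a) (2 * b + 12 * a * s\<^sup>2) t))"
      unfolding F
    proof (rule nn_integral_eq_integral)
      show "integrable lborel (\<lambda>t. 2 ^ k * exp (2 * h * s) * quartic_weight (2 * a) (2 * b) s
        * (t ^ k * quartic_weight (2 * a) (2 * b + 12 * a * s\<^sup>2) t))"
        using integrable_quartic_moment[of "2 * a" k 0] a by simp
    qed (use k in \<open>simp add: zero_le_even_power\<close>)
    also have "(LBINT t. 2 ^ k * exp (2 * h * s) * quartic_weight (2 * a) (2 * b) s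
        * (t ^ k * quartic_weight (2 * a) (2 * b + 12 * a * s\<^sup>2) t))
      = 2 ^ k * exp (2 * h * s) * quartic_weight (2 * a) (2 * b) s * slice_moment k a b s"
      by (simp add: slice_moment_def quartic_moment_def)
    finally show ?thesis by (simp only: mult_ac)
  qed
  have "(\<integral>\<^sup>+x. \<integral>\<^sup>+y. ?F x y \<partial>lborel \<partial>lborel) = 2 * (\<integral>\<^sup>+s. \<integral>\<^sup>+t. ?F (s + t) (s - t) \<partial>lborel \<partial>lborel)"
    by (rule nn_integral_rotate) measurable
  also have "(\<integral>\<^sup>+s. \<integral>\<^sup>+t. ?F (s + t) (s - t) \<partial>lborel \<partial>lborel) = ennreal (2 ^ k * rotated_moment k a b h)"
    unfolding inner rotated_moment_def
    using integrable_slice_moment[OF a k, of "2 * h" b] slice_moment_pos[OF a k, of b]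
    by (subst nn_integral_eq_integral) (auto simp: less_imp_le)
  finally show ?thesis
    by (simp add: ennreal_mult' mult.assoc flip: ennreal_numeral)
qed

lemma square_partition_rotated:
  assumes a: "0 < a"
  shows "(quartic_moment 0 a b h)\<^sup>2 = 2 * rotated_moment 0 a b h"
proof -
  let ?w = "\<lambda>x. exp (h * x) * quartic_weight a b x"
  have i: "integrable lborel ?w" using integrable_quartic_moment[OF a, of 0 h b] by simp
  have "(\<integral>\<^sup>+x. \<integral>\<^sup>+y. ennreal ((x - y) ^ 0 * ?w x * ?w y) \<partial>lborel \<partial>lborel)
    = (\<integral>\<^sup>+x. ennreal (?w x * quartic_moment 0 a b h) \<partial>lborel)"
  proof (rule nn_integral_cong)
    show "(\<integral>\<^sup>+y. ennreal ((x - y) ^ 0 * ?w x * ?w y) \<partial>lborel) = ennreal (?w x * quartic_moment 0 a b h)" for x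
      using i by (subst nn_integral_eq_integral) (auto simp: quartic_moment_def)
  qed
  also have "\<dots> = ennreal ((quartic_moment 0 a b h)\<^sup>2)"
    using i quartic_moment_even_pos[OF a, of 0 b h]
    by (subst nn_integral_eq_integral) (auto simp: quartic_moment_def power2_eq_square)
  finally have "ennreal ((quartic_moment 0 a b h)\<^sup>2) = ennreal (2 * rotated_moment 0 a b h)"
    using nn_integral_two_copies[OF a, of 0 h b] by simp
  moreover have "0 \<le> rotated_moment 0 a b h"
    unfolding rotated_moment_def using slice_moment_pos[OF a, of 0 b]
    by (intro integral_nonneg_AE) (auto simp: less_imp_le)
  ultimately show ?thesis by (subst (asm) ennreal_inj) auto
qed

lemma variance_numerator_rotated:
  assumes a: "0 < a"
  shows "quartic_moment 0 a b h * quartic_moment 2 a b h - (quartic_moment 1 a b h)\<^sup>2 = 4 * rotated_moment 2 a b h"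
proof -
  let ?w = "\<lambda>x. exp (h * x) * quartic_weight a b x"
  let ?M = "\<lambda>k. quartic_moment k a b h"
  have i: "integrable lborel (\<lambda>x. x ^ k * ?w x)" for k
    using integrable_quartic_moment[OF a, of k h b] by (simp add: mult.assoc)
  have M: "(LBINT x. x ^ k * ?w x) = ?M k" for k by (simp add: quartic_moment_def mult.assoc)
  have i1: "integrable lborel ?w" "integrable lborel (\<lambda>x. x * ?w x)" "integrable lborel (\<lambda>x. x\<^sup>2 * ?w x)"
    and M1: "(LBINT x. ?w x) = ?M 0" "(LBINT x. x * ?w x) = ?M 1" "(LBINT x. x\<^sup>2 * ?w x) = ?M 2"
    using i[of 0] i[of 1] i[of 2] M[of 0] M[of 1] M[of 2] by simp_all
  have eq: "(x - y)\<^sup>2 * ?w x * ?w y = x\<^sup>2 * ?w x * ?w y + ?w x * (y\<^sup>2 * ?w y) - 2 * (x * ?w x) * (y * ?w y)" for x y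
    by algebra
  have int_sq: "integrable lborel (\<lambda>y. (x - y)\<^sup>2 * ?w x * ?w y)" for x
    unfolding eq using i1 by simp
  have val: "(LBINT y. (x - y)\<^sup>2 * ?w x * ?w y) = ?M 0 * (x\<^sup>2 * ?w x) + ?M 2 * ?w x - 2 * ?M 1 * (x * ?w x)" for x
    unfolding eq using i1 by (simp add: M1)
  have inner: "(\<integral>\<^sup>+y. ennreal ((x - y)\<^sup>2 * ?w x * ?w y) \<partial>lborel)
      = ennreal (?M 0 * (x\<^sup>2 * ?w x) + ?M 2 * ?w x - 2 * ?M 1 * (x * ?w x))" for x
    unfolding val[symmetric] by (rule nn_integral_eq_integral[OF int_sq]) simp
  have nonneg: "0 \<le> ?M 0 * (x\<^sup>2 * ?w x) + ?M 2 * ?w x - 2 * ?M 1 * (x * ?w x)" for x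
    unfolding val[symmetric] by simp
  have "ennreal (8 * rotated_moment 2 a b h) = (\<integral>\<^sup>+x. \<integral>\<^sup>+y. ennreal ((x - y)\<^sup>2 * ?w x * ?w y) \<partial>lborel \<partial>lborel)"
    using nn_integral_two_copies[OF a, of 2 h b] by simp
  also have "\<dots> = ennreal (LBINT x. ?M 0 * (x\<^sup>2 * ?w x) + ?M 2 * ?w x - 2 * ?M 1 * (x * ?w x))"
    unfolding inner using i1 nonneg by (intro nn_integral_eq_integral) auto
  also have "(LBINT x. ?M 0 * (x\<^sup>2 * ?w x) + ?M 2 * ?w x - 2 * ?M 1 * (x * ?w x)) = ?M 0 * ?M 2 + ?M 2 * ?M 0 - 2 * ?M 1 * ?M 1"
    using i1 by (simp add: M1)
  also have "\<dots> = 2 * (?M 0 * ?M 2 - (?M 1)\<^sup>2)"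
    by (simp add: power2_eq_square)
  finally have eq': "ennreal (8 * rotated_moment 2 a b h) = ennreal (2 * (?M 0 * ?M 2 - (?M 1)\<^sup>2))" .
  have "0 < rotated_moment 2 a b h"
    unfolding rotated_moment_def using slice_moment_pos[OF a, of 2 b] integrable_slice_moment[OF a, of 2 "2 * h" b]
    by (intro integral_pos_of_pos) auto
  then have "0 < 2 * (?M 0 * ?M 2 - (?M 1)\<^sup>2)"
    using eq' by (metis ennreal_eq_0_iff ennreal_less_zero_iff linorder_not_le mult_pos_pos zero_less_numeral)
  with eq' show ?thesis using \<open>0 < rotated_moment 2 a b h\<close> by (subst (asm) ennreal_inj) auto
qed

section \<open>Concavity of the tilted mean\<close>
definition tilted_mean :: "real \<Rightarrow> real \<Rightarrow> real \<Rightarrow> real" where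
  "tilted_mean a b h = quartic_moment 1 a b h / quartic_moment 0 a b h"

definition tilted_variance :: "real \<Rightarrow> real \<Rightarrow> real \<Rightarrow> real" where
  "tilted_variance a b h = quartic_moment 2 a b h / quartic_moment 0 a b h - (tilted_mean a b h)\<^sup>2"

definition log_partition :: "real \<Rightarrow> real \<Rightarrow> real \<Rightarrow> real" where
  "log_partition a b h = ln (quartic_moment 0 a b h)"

lemma log_partition_deriv:
  "0 < a \<Longrightarrow> (log_partition a b has_real_derivative tilted_mean a b h) (at h)"
  unfolding log_partition_def[abs_def] tilted_mean_def
  by (auto intro!: derivative_eq_intros quartic_moment_deriv quartic_moment_even_pos)

lemma tilted_mean_deriv:
  assumes a: "0 < a"
  shows "(tilted_mean a b has_real_derivative tilted_variance a b h) (at h)"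
proof -
  have *: "quartic_moment 0 a b h \<noteq> 0" using quartic_moment_even_pos[OF a, of 0 b h] by simp
  have "((\<lambda>h. quartic_moment 1 a b h / quartic_moment 0 a b h) has_real_derivative
    (quartic_moment 2 a b h * quartic_moment 0 a b h - quartic_moment 1 a b h * quartic_moment 1 a b h)
      / (quartic_moment 0 a b h * quartic_moment 0 a b h)) (at h)"
    using quartic_moment_deriv[OF a, of 1 b h] quartic_moment_deriv[OF a, of 0 b h] *
    by (intro DERIV_divide) (simp_all add: numeral_2_eq_2)
  moreover have "(quartic_moment 2 a b h * quartic_moment 0 a b h - quartic_moment 1 a b h * quartic_moment 1 a b h)
      / (quartic_moment 0 a b h * quartic_moment 0 a b h) = tilted_variance a b h"
    using * by (simp add: tilted_variance_def tilted_mean_def diff_divide_distrib power2_eq_square)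
  ultimately show ?thesis unfolding tilted_mean_def[abs_def] by simp
qed

lemma tilted_mean_minus: "tilted_mean a b (- h) = - tilted_mean a b h"
  by (simp add: tilted_mean_def quartic_moment_minus)

lemma tilted_mean_zero [simp]: "tilted_mean a b 0 = 0"
  using tilted_mean_minus[of a b 0] by simp

lemma tilted_variance_minus: "tilted_variance a b (- h) = tilted_variance a b h"
  by (simp add: tilted_variance_def tilted_mean_minus quartic_moment_minus)

lemma log_partition_minus: "log_partition a b (- h) = log_partition a b h"
  by (simp add: log_partition_def quartic_moment_minus)

lemma rotated_moment_pos: "0 < rotated_moment k a b h" if "0 < a" "even k"
  unfolding rotated_moment_def
  using slice_moment_pos[OF that, of b] integrable_slice_moment[OF that, of "2 * h" b]
  by (intro integral_pos_of_pos) auto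

lemma tilted_variance_rotated:
  assumes a: "0 < a"
  shows "tilted_variance a b h = 2 * rotated_moment 2 a b h / rotated_moment 0 a b h"
proof -
  have pos: "0 < quartic_moment 0 a b h" by (intro quartic_moment_even_pos a) simp
  have "tilted_variance a b h
    = (quartic_moment 0 a b h * quartic_moment 2 a b h - (quartic_moment 1 a b h)\<^sup>2) / (quartic_moment 0 a b h)\<^sup>2"
    using pos by (simp add: tilted_variance_def tilted_mean_def power_divide diff_divide_distrib power2_eq_square)
  then show ?thesis
    unfolding variance_numerator_rotated[OF a] square_partition_rotated[OF a] by simp
qed

lemma tilted_variance_pos: "0 < a \<Longrightarrow> 0 < tilted_variance a b h"
  using rotated_moment_pos[of a 0 b h] rotated_moment_pos[of a 2 b h] by (simp add: tilted_variance_rotated)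

lemma integral_even_symmetrize:
  fixes g :: "real \<Rightarrow> real"
  assumes int: "\<And>c. integrable lborel (\<lambda>s. exp (c * s) * g s)" and even: "\<And>s. g (- s) = g s"
  shows "integrable lborel (\<lambda>s. cosh (c * s) * g s)"
    and "(LBINT s. exp (c * s) * g s) = (LBINT s. cosh (c * s) * g s)"
proof -
  have cosh: "cosh (c * s) * g s = (exp (c * s) * g s + exp ((- c) * s) * g s) / 2" for s
    by (simp add: cosh_def field_simps)
  show "integrable lborel (\<lambda>s. cosh (c * s) * g s)"
    unfolding cosh using int[of c] int[of "- c"] by simp
  have "(LBINT s. exp ((- c) * s) * g s) = (LBINT s. exp (c * s) * g s)"
    using lborel_integral_real_affine[of "-1" "\<lambda>s. exp ((- c) * s) * g s" 0] by (simp add: even)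
  then show "(LBINT s. exp (c * s) * g s) = (LBINT s. cosh (c * s) * g s)"
    unfolding cosh using int[of c] int[of "- c"] by simp
qed

text \<open>
  The ratio \<open>cosh (v x) / cosh (u x)\<close> increases with \<open>|x|\<close>, in a form without division.
  Products of hyperbolic cosines are sums of hyperbolic cosines, which are compared termwise.
\<close>
lemma cosh_ratio_less:
  fixes u v x y :: real
  assumes "0 \<le> u" "u < v" "\<bar>x\<bar> < \<bar>y\<bar>"
  shows "cosh (v * x) * cosh (u * y) < cosh (v * y) * cosh (u * x)"
proof -
  have prod: "cosh p * cosh q = (cosh (p + q) + cosh (p - q)) / 2" for p q :: real
    by (simp add: cosh_add cosh_diff)
  let ?x = "\<bar>x\<bar>" and ?y = "\<bar>y\<bar>"
  have "0 < (v - u) * (?y - ?x)" "0 < (v + u) * (?y - ?x)" "0 < (v - u) * (?x + ?y)"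
    using assms by (auto intro!: mult_pos_pos)
  then have "v * ?x - u * ?y < v * ?y - u * ?x" "- (v * ?x - u * ?y) < v * ?y - u * ?x"
    "v * ?x + u * ?y < v * ?y + u * ?x"
    by (simp_all add: algebra_simps)
  then have 1: "v * ?x + u * ?y < v * ?y + u * ?x" "\<bar>v * ?x - u * ?y\<bar> < v * ?y - u * ?x"
    by (simp_all only: abs_less_iff)
  have "cosh (v * ?x + u * ?y) < cosh (v * ?y + u * ?x)"
    using 1(1) assms by (intro cosh_real_nonneg_less_iff[THEN iffD2]) auto
  moreover have "cosh (v * ?x - u * ?y) < cosh (v * ?y - u * ?x)"
    using cosh_real_nonneg_less_iff[of "\<bar>v * ?x - u * ?y\<bar>" "v * ?y - u * ?x"] 1(2) by simp
  ultimately have "cosh (v * ?x) * cosh (u * ?y) < cosh (v * ?y) * cosh (u * ?x)"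
    unfolding prod by simp
  moreover have "cosh (c * \<bar>z\<bar>) = cosh (c * z)" for c z :: real
    by (cases "0 \<le> z") auto
  ultimately show ?thesis by simp
qed

text \<open>
  The coupling term \<open>s\<^sup>2 t\<^sup>2\<close> confines \<open>t\<close> the more, the larger \<open>|s|\<close> is.
\<close>
lemma slice_variance_less:
  assumes a: "0 < a" and "\<bar>x\<bar> < \<bar>y\<bar>"
  shows "slice_moment 2 a b y / slice_moment 0 a b y < slice_moment 2 a b x / slice_moment 0 a b x"
proof -
  have "x\<^sup>2 < y\<^sup>2" using assms(2) by (simp add: even_power_less_iff_abs)
  then have "slice_moment 2 a b y * slice_moment 0 a b x < slice_moment 2 a b x * slice_moment 0 a b y"
    unfolding slice_moment_def using a by (intro quartic_moment_ratio_decreasing) auto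
  then show ?thesis using slice_moment_pos[OF a, of 0 b x] slice_moment_pos[OF a, of 0 b y]
    by (simp add: divide_less_eq less_divide_eq mult.commute)
qed

text \<open>
  After symmetrisation in \<open>s\<close>, passing from the tilt \<open>h\<close> to \<open>h'\<close> reweights \<open>s\<close> by a ratio of
  hyperbolic cosines, which increases with \<open>|s|\<close>, while the conditional variance of \<open>t\<close> decreases
  with \<open>|s|\<close>.
\<close>
lemma tilted_variance_strict_decreasing:
  assumes a: "0 < a" and h: "0 \<le> h" "h < h'"
  shows "tilted_variance a b h' < tilted_variance a b h"
proof -
  let ?S = "\<lambda>k s. slice_moment k a b s * quartic_weight (2 * a) (2 * b) s"
  define p where "p = (\<lambda>s. cosh (2 * h * s) * ?S 0 s)"
  define F where "F = (\<lambda>s. slice_moment 2 a b s / slice_moment 0 a b s)"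
  define G where "G = (\<lambda>s. cosh (2 * h' * s) / cosh (2 * h * s))"
  have S0: "slice_moment 0 a b s \<noteq> 0" for s using slice_moment_pos[OF a, of 0 b s] by simp
  have ch: "cosh (c::real) \<noteq> 0" for c using cosh_real_pos[of c] by simp
  have Fp: "F s * p s = cosh (2 * h * s) * ?S 2 s" for s using S0 by (simp add: F_def p_def)
  have Gp: "G s * p s = cosh (2 * h' * s) * ?S 0 s" for s using ch by (simp add: G_def p_def)
  have FGp: "F s * G s * p s = cosh (2 * h' * s) * ?S 2 s" for s
    using S0 ch by (simp add: F_def G_def p_def)
  have int: "integrable lborel (\<lambda>s. exp (c * s) * ?S k s)" if "even k" for k c
    using integrable_slice_moment[OF a that, of c b] by (simp add: mult.assoc)
  have even: "?S k (- s) = ?S k s" for k s by (simp add: slice_moment_def)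
  note sym = integral_even_symmetrize[of "?S k" for k, OF int even]
  have R: "rotated_moment k a b c = (LBINT s. cosh (2 * c * s) * ?S k s)" if "even k" for k c
    unfolding sym(2)[OF that, of "2 * c", symmetric] rotated_moment_def by (simp add: mult.assoc)
  have "(LBINT s. F s * G s * p s) * (LBINT s. p s)
    < (LBINT s. F s * p s) * (LBINT s. G s * p s)"
  proof (rule strict_chebyshev_integral)
    show "0 < p s" for s using slice_moment_pos[OF a, of 0 b s] by (simp add: p_def)
    show "integrable lborel p" unfolding p_def by (rule sym) simp
    show "integrable lborel (\<lambda>s. F s * p s)" unfolding Fp by (rule sym) simp
    show "integrable lborel (\<lambda>s. G s * p s)" unfolding Gp by (rule sym) simp
    show "integrable lborel (\<lambda>s. F s * G s * p s)" unfolding FGp by (rule sym) simp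
    have less: "F y < F x" "G x < G y" if "\<bar>x\<bar> < \<bar>y\<bar>" for x y
    proof -
      show "F y < F x" unfolding F_def by (rule slice_variance_less[OF a that])
      show "G x < G y" unfolding G_def using cosh_ratio_less[of "2 * h" "2 * h'" x y] h that
        by (simp add: divide_less_eq less_divide_eq mult.commute mult.left_commute)
    qed
    fix x y :: real assume "\<bar>x\<bar> \<noteq> \<bar>y\<bar>"
    then consider "\<bar>x\<bar> < \<bar>y\<bar>" | "\<bar>y\<bar> < \<bar>x\<bar>" by linarith
    then show "(F x - F y) * (G x - G y) < 0"
      by cases (use less in \<open>auto intro: mult_pos_neg mult_neg_pos\<close>)
  qed
  then have "rotated_moment 2 a b h' * rotated_moment 0 a b h < rotated_moment 2 a b h * rotated_moment 0 a b h'"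
    unfolding FGp Fp Gp by (simp add: R p_def)
  then show ?thesis
    using rotated_moment_pos[OF a, of 0 b h] rotated_moment_pos[OF a, of 0 b h']
    by (simp add: tilted_variance_rotated a divide_less_eq less_divide_eq mult.commute mult.left_commute)
qed

lemma tilted_variance_le_untilted: "0 < a \<Longrightarrow> tilted_variance a b h \<le> tilted_variance a b 0"
  using tilted_variance_strict_decreasing[of a 0 h b] tilted_variance_strict_decreasing[of a 0 "- h" b]
    tilted_variance_minus[of a b h]
  by (cases h "0::real" rule: linorder_cases) auto

lemma log_partition_above_tangent:
  assumes "0 < a"
  shows "log_partition a b h + tilted_mean a b h * (h' - h) \<le> log_partition a b h'"
proof -
  have "convex_on UNIV (log_partition a b)"
    by (rule f''_ge0_imp_convex[OF _ log_partition_deriv tilted_mean_deriv])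
      (use assms tilted_variance_pos in \<open>auto simp: less_imp_le\<close>)
  then have "tilted_mean a b h * (h' - h) \<le> log_partition a b h' - log_partition a b h"
    by (rule convex_on_imp_above_tangent) (use log_partition_deriv[OF assms] in auto)
  then show ?thesis by simp
qed

text \<open>
  The variance is the second derivative of the log-partition function and is largest, equal to some
  \<open>v\<close>, without tilt; so \<open>v x\<^sup>2 / 2\<close> minus the log-partition function is convex.
\<close>
lemma log_partition_quadratic_upper:
  assumes a: "0 < a"
  shows "log_partition a b h' \<le> log_partition a b h + tilted_mean a b h * (h' - h)
    + tilted_variance a b 0 / 2 * (h' - h)\<^sup>2"
proof -
  let ?v = "tilted_variance a b 0"
  let ?g = "\<lambda>x. ?v / 2 * x\<^sup>2 - log_partition a b x"
  have d: "(?g has_real_derivative ?v * x - tilted_mean a b x) (at x)" for x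
    by (auto intro!: derivative_eq_intros log_partition_deriv a)
  have "convex_on UNIV ?g"
  proof (rule f''_ge0_imp_convex[OF _ d])
    show "((\<lambda>x. ?v * x - tilted_mean a b x) has_real_derivative ?v - tilted_variance a b x) (at x)" for x
      by (auto intro!: derivative_eq_intros tilted_mean_deriv a)
  qed (use tilted_variance_le_untilted[OF a] in auto)
  then have "(?v * h - tilted_mean a b h) * (h' - h) \<le> ?g h' - ?g h"
    by (rule convex_on_imp_above_tangent) (use d in auto)
  moreover have "?v / 2 * (h' - h)\<^sup>2 = ?v / 2 * h'\<^sup>2 - ?v / 2 * h\<^sup>2 - ?v * h * (h' - h)"
    by (simp add: power2_eq_square field_simps)
  ultimately show ?thesis by (simp add: algebra_simps)
qed

text \<open>
  Follows from \<open>h x \<le> h\<^sup>2 / (4 \<kappa>) + \<kappa> x\<^sup>2\<close>. As \<open>\<kappa>\<close> is arbitrary, the growth in \<open>h\<close> is slower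
  than any prescribed quadratic function.
\<close>
lemma log_partition_le_quadratic:
  assumes a: "0 < a" and \<kappa>: "0 < \<kappa>"
  shows "log_partition a b h \<le> h\<^sup>2 / (4 * \<kappa>) + log_partition a (b - \<kappa>) 0"
proof -
  have "quartic_moment 0 a b h \<le> (LBINT x. exp (h\<^sup>2 / (4 * \<kappa>)) * quartic_weight a (b - \<kappa>) x)"
    unfolding quartic_moment_def
  proof (rule integral_mono)
    show "x ^ 0 * exp (h * x) * quartic_weight a b x \<le> exp (h\<^sup>2 / (4 * \<kappa>)) * quartic_weight a (b - \<kappa>) x" for x
    proof -
      have "0 \<le> (2 * \<kappa> * x - h)\<^sup>2 / (4 * \<kappa>)" using \<kappa> by simp
      also have "(2 * \<kappa> * x - h)\<^sup>2 = 4 * \<kappa> * (\<kappa> * x\<^sup>2 - h * x) + h\<^sup>2" by algebra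
      finally have "h * x \<le> h\<^sup>2 / (4 * \<kappa>) + \<kappa> * x\<^sup>2" using \<kappa> by (simp add: add_divide_distrib)
      then show ?thesis
        by (simp add: quartic_weight_def flip: exp_add) (simp add: algebra_simps)
    qed
  qed (use integrable_quartic_moment[OF a, of 0 h b] integrable_quartic_weight[OF a, of "b - \<kappa>"] in auto)
  also have "\<dots> = exp (h\<^sup>2 / (4 * \<kappa>)) * quartic_moment 0 a (b - \<kappa>) 0"
    by (simp add: quartic_moment_def)
  finally have "quartic_moment 0 a b h \<le> exp (h\<^sup>2 / (4 * \<kappa>)) * quartic_moment 0 a (b - \<kappa>) 0" .
  then have "ln (quartic_moment 0 a b h) \<le> ln (exp (h\<^sup>2 / (4 * \<kappa>)) * quartic_moment 0 a (b - \<kappa>) 0)"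
    using quartic_moment_even_pos[OF a, of 0] by (intro ln_mono) auto
  also have "\<dots> = h\<^sup>2 / (4 * \<kappa>) + ln (quartic_moment 0 a (b - \<kappa>) 0)"
    using quartic_moment_even_pos[OF a, of 0 "b - \<kappa>" 0] by (subst ln_mult) auto
  finally show ?thesis by (simp add: log_partition_def)
qed

section \<open>Odd maps with decreasing slope\<close>
lemma mean_value_real:
  fixes f :: "real \<Rightarrow> real"
  assumes "\<And>x. (f has_real_derivative d x) (at x)" "a < b"
  obtains z where "a < z" "z < b" "f b - f a = (b - a) * d z"
  using MVT2[OF assms(2), of f d] assms(1) by blast

context
  fixes f d :: "real \<Rightarrow> real"
  assumes deriv: "\<And>x. (f has_real_derivative d x) (at x)"
    and slope_pos: "\<And>x. 0 < d x"
    and slope_decr: "\<And>x y. 0 \<le> x \<Longrightarrow> x < y \<Longrightarrow> d y < d x"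
    and odd: "\<And>x. f (- x) = - f x"
begin

lemma odd_concave_zero: "f 0 = 0"
  using odd[of 0] by simp

lemma odd_concave_subcritical:
  assumes "d 0 \<le> 1" shows "{m. f m = m} = {0}"
proof -
  have less: "f m < m" if "0 < m" for m
  proof -
    obtain z where z: "0 < z" "f m - f 0 = (m - 0) * d z"
      using mean_value_real[OF deriv \<open>0 < m\<close>] by blast
    have "d z < 1" using slope_decr[of 0 z] z assms by simp
    then show ?thesis using z that by (simp add: odd_concave_zero)
  qed
  have "m = 0" if "f m = m" for m
    using less[of m] less[of "- m"] that odd[of m] by (cases "m = 0") (auto simp: linorder_neq_iff)
  then show ?thesis by (auto simp: odd_concave_zero)
qed

text \<open>
  The chord over \<open>[e, p]\<close> has slope less than 1: otherwise, by concavity, the chord over \<open>[0, e]\<close>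
  would have slope greater than 1, and \<open>f p > p\<close>.
\<close>
lemma odd_concave_chord:
  assumes p: "0 < p" "f p = p" and e: "0 < e" "e < p"
  obtains z where "e < z" "z < p" "0 < d z" "d z < 1" "p - f e = d z * (p - e)"
proof -
  obtain y where y: "0 < y" "y < e" "f e - f 0 = (e - 0) * d y"
    using mean_value_real[OF deriv e(1)] by blast
  obtain z where z: "e < z" "z < p" "f p - f e = (p - e) * d z"
    using mean_value_real[OF deriv e(2)] by blast
  have "d z < d y" using y z e by (intro slope_decr) auto
  have "d z < 1"
  proof (rule ccontr)
    assume "\<not> d z < 1"
    then have "1 * (p - e) \<le> d z * (p - e)" using e by (intro mult_right_mono) auto
    moreover have "1 * e < d y * e" using \<open>d z < d y\<close> \<open>\<not> d z < 1\<close> e by (intro mult_strict_right_mono) auto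
    moreover have "p = d y * e + d z * (p - e)" using y z p odd_concave_zero by (simp add: mult.commute)
    ultimately show False by simp
  qed
  then show ?thesis using z p slope_pos[of z] by (intro that[of z]) (simp_all add: mult.commute)
qed

lemma odd_concave_above_diagonal:
  assumes p: "0 < p" "f p = p" and m: "0 < m" "m < p"
  shows "m < f m"
proof -
  obtain z where "d z < 1" "p - f m = d z * (p - m)" using odd_concave_chord[OF p m] by metis
  moreover from this m have "d z * (p - m) < 1 * (p - m)" by (intro mult_strict_right_mono) auto
  ultimately show ?thesis by simp
qed

text \<open>
  Chords of a concave function from a fixed end point \<open>p\<close> have decreasing slope, so the chord with
  other end \<open>e\<close> bounds all others to its right, also those beyond \<open>p\<close>.
\<close>
lemma odd_concave_contraction:
  assumes p: "0 < p" "f p = p" and e: "0 < e" "e < p"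
  shows "\<exists>\<alpha>. 0 < \<alpha> \<and> \<alpha> < 1 \<and> (\<forall>m\<ge>e. \<bar>f m - p\<bar> \<le> \<alpha> * \<bar>m - p\<bar>)"
proof -
  obtain z where z: "e < z" "z < p" "0 < d z" "d z < 1" "p - f e = d z * (p - e)"
    using odd_concave_chord[OF p e] by metis
  have "\<bar>f m - p\<bar> \<le> d z * \<bar>m - p\<bar>" if em: "e \<le> m" for m
  proof -
    consider "m = e" | "m = p" | "e < m" "m < p" | "p < m" using em by linarith
    then show ?thesis
    proof cases
      case 1
      have "0 \<le> d z * (p - e)" using z e by simp
      then have "\<bar>f e - p\<bar> = p - f e" "\<bar>e - p\<bar> = p - e" using z e by linarith+
      then show ?thesis using z 1 by simp
    next
      case 3
      obtain x where x: "e < x" "x < m" "f m - f e = (m - e) * d x"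
        using mean_value_real[OF deriv 3(1)] by blast
      obtain y where y: "m < y" "y < p" "f p - f m = (p - m) * d y"
        using mean_value_real[OF deriv 3(2)] by blast
      have "d y < d x" using x y e by (intro slope_decr) auto
      then have "d y * (m - e) \<le> d x * (m - e)" using 3 by (intro mult_right_mono) auto
      moreover have "d z * (p - e) = d x * (m - e) + d y * (p - m)"
        using x y z p by (simp add: algebra_simps)
      ultimately have "d y * (p - e) \<le> d z * (p - e)" by (simp add: algebra_simps)
      then have "d y \<le> d z" using e by simp
      then have "d y * (p - m) \<le> d z * (p - m)" using 3 by (intro mult_right_mono) auto
      moreover have "0 \<le> d y * (p - m)" using slope_pos[of y] 3 by simp
      ultimately show ?thesis using y p 3 by (simp add: mult.commute)
    next
      case 4
      obtain y where y: "p < y" "y < m" "f m - f p = (m - p) * d y"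
        using mean_value_real[OF deriv 4] by blast
      have "d y < d z" using y z e by (intro slope_decr) auto
      then have "d y * (m - p) \<le> d z * (m - p)" using 4 by (intro mult_right_mono) auto
      moreover have "0 \<le> d y * (m - p)" using slope_pos[of y] 4 by simp
      ultimately show ?thesis using y p 4 by (simp add: mult.commute)
    qed (use p in simp)
  qed
  with z show ?thesis by blast
qed

lemma odd_concave_below_diagonal:
  assumes p: "0 < p" "f p = p" and m: "p < m"
  shows "f m < m"
proof -
  obtain \<alpha> where \<alpha>: "0 < \<alpha>" "\<alpha> < 1" "\<forall>m\<ge>p / 2. \<bar>f m - p\<bar> \<le> \<alpha> * \<bar>m - p\<bar>"
    using odd_concave_contraction[OF p, of "p / 2"] p by auto
  have "f m - p \<le> \<bar>f m - p\<bar>" by simp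
  also have "\<dots> \<le> \<alpha> * \<bar>m - p\<bar>" by (rule \<alpha>(3)[rule_format]) (use m p in simp)
  also have "\<dots> < 1 * \<bar>m - p\<bar>" using \<alpha>(2) m by (intro mult_strict_right_mono) auto
  finally show ?thesis using m by simp
qed

lemma odd_concave_positive_fixed_point_unique:
  assumes "0 < p" "f p = p" "0 < q" "f q = q" shows "p = q"
  using odd_concave_below_diagonal[of p q] odd_concave_below_diagonal[of q p] assms
  by (cases p q rule: linorder_cases) auto

lemma odd_concave_supercritical:
  assumes "1 < d 0" and m: "0 < m" "f m < m"
  shows "\<exists>p>0. {m. f m = m} = {- p, 0, p}"
proof -
  have "((\<lambda>x. f x - x) has_real_derivative d 0 - 1) (at 0)"
    by (auto intro!: derivative_eq_intros deriv)
  from DERIV_pos_inc_right[OF this] assms(1)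
  obtain r where r: "0 < r" "\<And>h. 0 < h \<Longrightarrow> h < r \<Longrightarrow> 0 < f h - h"
    by (auto simp: odd_concave_zero)
  define h where "h = min (r / 2) (m / 2)"
  have h: "0 < h" "h < r" "h < m" using r(1) m by (auto simp: h_def min_def)
  have cont: "continuous_on {h..m} (\<lambda>x. f x - x)"
    by (intro continuous_intros continuous_at_imp_continuous_on ballI DERIV_isCont[OF deriv])
  obtain p where p: "h \<le> p" "p \<le> m" "f p - p = 0"
    using IVT2'[of "\<lambda>x. f x - x" m 0 h] cont r(2)[of h] h m by auto
  then have p': "0 < p" "f p = p" using h by auto
  have "x \<in> {- p, 0, p}" if "f x = x" for x
  proof (cases x "0::real" rule: linorder_cases)
    case less
    then show ?thesis using odd_concave_positive_fixed_point_unique[OF p', of "- x"] that odd[of x] by auto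
  next
    case greater
    then show ?thesis using odd_concave_positive_fixed_point_unique[OF p', of x] that by auto
  qed simp
  moreover have "f (- p) = - p" using odd[of p] p' by simp
  ultimately show ?thesis using p' odd_concave_zero by blast
qed

end

section \<open>The critical variance\<close>
lemma quartic_moment_by_parts:
  assumes a: "0 < a"
  shows "real (Suc k) * quartic_moment k a b 0
    = 4 * a * quartic_moment (k + 4) a b 0 + 2 * b * quartic_moment (k + 2) a b 0"
proof -
  let ?F = "\<lambda>x. x ^ Suc k * quartic_weight a b x"
  let ?f = "\<lambda>x. real (Suc k) * (x ^ k * quartic_weight a b x)
    - 4 * a * (x ^ (k + 4) * quartic_weight a b x) - 2 * b * (x ^ (k + 2) * quartic_weight a b x)"
  have int: "integrable lborel (\<lambda>x. x ^ j * quartic_weight a b x)" for j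
    using integrable_quartic_moment[OF a, of j 0 b] by simp
  have intf: "integrable lborel ?f" by (intro Bochner_Integration.integrable_diff integrable_mult_right int)
  have lim: "(?F \<longlongrightarrow> 0) at_infinity"
  proof (rule tendsto_0_le)
    let ?C = "fact (k + 2) * exp 1 * exp ((b - 1)\<^sup>2 / (4 * a))"
    show "(inverse \<longlongrightarrow> (0::real)) at_infinity" by (rule tendsto_inverse_0)
    show "eventually (\<lambda>x. norm (?F x) \<le> norm (inverse x) * ?C) at_infinity"
    proof (intro always_eventually allI)
      fix x :: real
      note x = abs_le_one_plus_square[of x]
      have "\<bar>x\<bar> ^ (k + 2) * quartic_weight a b x
        \<le> (fact (k + 2) * exp \<bar>x\<bar>) * (exp ((b - 1)\<^sup>2 / (4 * a)) * exp (- x\<^sup>2))"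
        by (intro mult_mono power_le_fact_exp quartic_weight_le a) auto
      also have "\<dots> = (fact (k + 2) * exp ((b - 1)\<^sup>2 / (4 * a))) * exp (\<bar>x\<bar> - x\<^sup>2)"
        by (simp add: exp_diff exp_minus field_simps)
      also have "\<dots> \<le> (fact (k + 2) * exp ((b - 1)\<^sup>2 / (4 * a))) * exp 1"
        using x by (intro mult_left_mono) auto
      finally have "\<bar>x\<bar> ^ (k + 2) * quartic_weight a b x \<le> ?C" by (simp only: mult_ac)
      then have "norm (inverse x) * (\<bar>x\<bar> ^ (k + 2) * quartic_weight a b x) \<le> norm (inverse x) * ?C"
        by (rule mult_left_mono) simp
      moreover have "norm (?F x) = norm (inverse x) * (\<bar>x\<bar> ^ (k + 2) * quartic_weight a b x)"
        by (cases "x = 0") (simp_all add: abs_mult power_abs)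
      ultimately show "norm (?F x) \<le> norm (inverse x) * ?C" by simp
    qed
  qed
  have "(LBINT x=-\<infinity>..\<infinity>. ?f x) = 0 - 0"
  proof (rule interval_integral_FTC_integrable)
    show "(?F has_vector_derivative ?f x) (at x)" for x
    proof -
      have "(?F has_real_derivative ?f x) (at x)"
        unfolding quartic_weight_def
        by (rule derivative_eq_intros refl | simp add: algebra_simps power_add eval_nat_numeral)+
      then show ?thesis by (simp add: has_real_derivative_iff_has_vector_derivative)
    qed
    show "isCont ?f x" for x unfolding quartic_weight_def by (intro continuous_intros)
    show "set_integrable lborel (einterval (-\<infinity>) \<infinity>) ?f"
      using intf by (simp add: set_integrable_def)
    have "(?F \<longlongrightarrow> 0) at_top" "(?F \<longlongrightarrow> 0) at_bot"
      using lim by (auto intro: tendsto_mono[OF at_top_le_at_infinity] tendsto_mono[OF at_bot_le_at_infinity])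
    then show "((?F \<circ> real_of_ereal) \<longlongrightarrow> 0) (at_right (-\<infinity>))" "((?F \<circ> real_of_ereal) \<longlongrightarrow> 0) (at_left \<infinity>)"
      by (simp_all add: ereal_tendsto_simps)
  qed simp
  then have "(LBINT x. ?f x) = 0"
    by (simp add: interval_lebesgue_integral_def set_lebesgue_integral_def)
  also have "(LBINT x. ?f x) = real (Suc k) * (LBINT x. x ^ k * quartic_weight a b x)
    - 4 * a * (LBINT x. x ^ (k + 4) * quartic_weight a b x) - 2 * b * (LBINT x. x ^ (k + 2) * quartic_weight a b x)"
    using int[of k] int[of "k + 2"] int[of "k + 4"] by simp
  finally show ?thesis by (simp add: quartic_moment_def)
qed

text \<open>
  With these coefficients and this tilt, the Gibbs weight is an exponentially tilted quartic weight.
\<close>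
abbreviation quartic_coeff :: "real \<Rightarrow> real" where "quartic_coeff \<sigma> \<equiv> 1 / (4 * \<sigma>\<^sup>2)"
abbreviation quadratic_coeff :: "real \<Rightarrow> real \<Rightarrow> real" where "quadratic_coeff \<theta> \<sigma> \<equiv> (\<theta> - 1 / 2) / \<sigma>\<^sup>2"
abbreviation tilt :: "real \<Rightarrow> real \<Rightarrow> real \<Rightarrow> real" where "tilt \<theta> \<sigma> m \<equiv> 2 * \<theta> / \<sigma>\<^sup>2 * m"

lemma gibbs_weight_eq:
  "gibbs_weight \<theta> \<sigma> m x = exp (tilt \<theta> \<sigma> m * x) * quartic_weight (quartic_coeff \<sigma>) (quadratic_coeff \<theta> \<sigma>) x"
proof -
  define s where "s = 1 / \<sigma>\<^sup>2"
  have s: "1 / (4 * \<sigma>\<^sup>2) = s / 4" "(\<theta> - 1 / 2) / \<sigma>\<^sup>2 = (\<theta> - 1 / 2) * s" "2 * \<theta> / \<sigma>\<^sup>2 = 2 * \<theta> * s"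
    by (simp_all add: s_def)
  have "- s * (x ^ 4 / 4 - x\<^sup>2 / 2 + \<theta> * x\<^sup>2 - 2 * \<theta> * x * m)
    = 2 * \<theta> * s * m * x + - (s / 4 * x ^ 4 + (\<theta> - 1 / 2) * s * x\<^sup>2)"
    by (simp add: algebra_simps)
  then show ?thesis
    unfolding gibbs_weight_def quartic_weight_def V_dw_def exp_add[symmetric] s s_def[symmetric]
    by (rule arg_cong)
qed

lemma gibbs_dens_eq:
  "gibbs_dens \<theta> \<sigma> m x = exp (tilt \<theta> \<sigma> m * x) * quartic_weight (quartic_coeff \<sigma>) (quadratic_coeff \<theta> \<sigma>) x
    / quartic_moment 0 (quartic_coeff \<sigma>) (quadratic_coeff \<theta> \<sigma>) (tilt \<theta> \<sigma> m)"
  by (simp add: gibbs_dens_def gibbs_weight_eq quartic_moment_def)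

lemma mean_map_eq:
  "mean_map \<theta> \<sigma> m = tilted_mean (quartic_coeff \<sigma>) (quadratic_coeff \<theta> \<sigma>) (tilt \<theta> \<sigma> m)"
  by (simp add: mean_map_def gibbs_dens_eq tilted_mean_def quartic_moment_def mult.assoc)

definition mean_slope :: "real \<Rightarrow> real \<Rightarrow> real \<Rightarrow> real" where
  "mean_slope \<theta> \<sigma> m
    = 2 * \<theta> / \<sigma>\<^sup>2 * tilted_variance (quartic_coeff \<sigma>) (quadratic_coeff \<theta> \<sigma>) (tilt \<theta> \<sigma> m)"

lemma mean_map_odd_concave:
  assumes "0 < \<theta>" "0 < \<sigma>"
  shows "(mean_map \<theta> \<sigma> has_real_derivative mean_slope \<theta> \<sigma> m) (at m)"
    and "0 < mean_slope \<theta> \<sigma> m"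
    and "0 \<le> m \<Longrightarrow> m < m' \<Longrightarrow> mean_slope \<theta> \<sigma> m' < mean_slope \<theta> \<sigma> m"
    and "mean_map \<theta> \<sigma> (- m) = - mean_map \<theta> \<sigma> m"
proof -
  have a: "0 < quartic_coeff \<sigma>" and \<tau>: "0 < 2 * \<theta> / \<sigma>\<^sup>2" using assms by simp_all
  show "(mean_map \<theta> \<sigma> has_real_derivative mean_slope \<theta> \<sigma> m) (at m)"
    unfolding mean_map_eq[abs_def] mean_slope_def
    by (rule DERIV_cong[OF DERIV_chain2[OF tilted_mean_deriv[OF a] DERIV_cmult_Id]]) (rule mult.commute)
  show "0 < mean_slope \<theta> \<sigma> m" unfolding mean_slope_def
    by (intro mult_pos_pos \<tau> tilted_variance_pos a)
  show "mean_slope \<theta> \<sigma> m' < mean_slope \<theta> \<sigma> m" if "0 \<le> m" "m < m'"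
    unfolding mean_slope_def using that \<tau>
    by (intro mult_strict_left_mono tilted_variance_strict_decreasing a mult_nonneg_nonneg) auto
  show "mean_map \<theta> \<sigma> (- m) = - mean_map \<theta> \<sigma> m"
    by (simp add: mean_map_eq tilted_mean_minus)
qed

text \<open>
  The part of the free energy that depends on the mean only: the infimum of the free energy over
  all measures with mean \<open>m\<close> is bounded below by it, and its critical points are the fixed points of
  the mean map.
\<close>
definition mean_field_energy :: "real \<Rightarrow> real \<Rightarrow> real \<Rightarrow> real" where
  "mean_field_energy \<theta> \<sigma> m
    = \<theta> * m\<^sup>2 - \<sigma>\<^sup>2 * log_partition (quartic_coeff \<sigma>) (quadratic_coeff \<theta> \<sigma>) (tilt \<theta> \<sigma> m)"

lemma mean_field_energy_deriv:
  assumes "0 < \<sigma>"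
  shows "(mean_field_energy \<theta> \<sigma> has_real_derivative 2 * \<theta> * (m - mean_map \<theta> \<sigma> m)) (at m)"
proof -
  have a: "0 < quartic_coeff \<sigma>" using assms by simp
  have "((\<lambda>m. log_partition (quartic_coeff \<sigma>) (quadratic_coeff \<theta> \<sigma>) (tilt \<theta> \<sigma> m)) has_real_derivative
      mean_map \<theta> \<sigma> m * (2 * \<theta> / \<sigma>\<^sup>2)) (at m)"
    unfolding mean_map_eq
    by (rule DERIV_chain2[OF log_partition_deriv[OF a] DERIV_cmult_Id])
  then have "(mean_field_energy \<theta> \<sigma> has_real_derivative
      \<theta> * (2 * m) - \<sigma>\<^sup>2 * (mean_map \<theta> \<sigma> m * (2 * \<theta> / \<sigma>\<^sup>2))) (at m)"
    unfolding mean_field_energy_def[abs_def]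
    by (intro DERIV_diff DERIV_cmult) (auto intro!: derivative_eq_intros)
  moreover have "\<theta> * (2 * m) - \<sigma>\<^sup>2 * (mean_map \<theta> \<sigma> m * (2 * \<theta> / \<sigma>\<^sup>2)) = 2 * \<theta> * (m - mean_map \<theta> \<sigma> m)"
    using assms by (simp add: algebra_simps)
  ultimately show ?thesis by simp
qed

lemma mean_field_energy_coercive:
  assumes "0 < \<theta>" "0 < \<sigma>"
  obtains C where "\<And>m. \<theta> / 2 * m\<^sup>2 - C \<le> mean_field_energy \<theta> \<sigma> m"
proof -
  have a: "0 < quartic_coeff \<sigma>" using assms by simp
  let ?C = "\<sigma>\<^sup>2 * log_partition (quartic_coeff \<sigma>) (quadratic_coeff \<theta> \<sigma> - 2 * \<theta> / \<sigma>\<^sup>2) 0"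
  have "\<theta> / 2 * m\<^sup>2 - ?C \<le> mean_field_energy \<theta> \<sigma> m" for m
  proof -
    have "\<sigma>\<^sup>2 * log_partition (quartic_coeff \<sigma>) (quadratic_coeff \<theta> \<sigma>) (tilt \<theta> \<sigma> m)
      \<le> \<sigma>\<^sup>2 * ((tilt \<theta> \<sigma> m)\<^sup>2 / (4 * (2 * \<theta> / \<sigma>\<^sup>2))
        + log_partition (quartic_coeff \<sigma>) (quadratic_coeff \<theta> \<sigma> - 2 * \<theta> / \<sigma>\<^sup>2) 0)"
      using assms by (intro mult_left_mono log_partition_le_quadratic a) auto
    also have "\<dots> = \<theta> / 2 * m\<^sup>2 + ?C"
      using assms by (simp add: field_simps power2_eq_square)
    finally show ?thesis unfolding mean_field_energy_def by simp
  qed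
  then show ?thesis by (rule that)
qed

text \<open>
  If \<open>f\<close> stayed above the diagonal, the mean-field energy would be nonincreasing on the half line;
  but it is coercive.
\<close>
lemma mean_map_below_diagonal_somewhere:
  assumes "0 < \<theta>" "0 < \<sigma>"
  shows "\<exists>m>0. mean_map \<theta> \<sigma> m < m"
proof (rule ccontr)
  assume "\<not> ?thesis"
  then have ge: "m \<le> mean_map \<theta> \<sigma> m" if "0 < m" for m using that by force
  obtain C where C: "\<And>m. \<theta> / 2 * m\<^sup>2 - C \<le> mean_field_energy \<theta> \<sigma> m"
    using mean_field_energy_coercive[OF assms] by blast
  define E where "E = \<bar>mean_field_energy \<theta> \<sigma> 0\<bar> + \<bar>C\<bar>"
  define m where "m = 1 + 2 * E / \<theta>"
  have "0 \<le> E" by (simp add: E_def)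
  have m: "1 \<le> m" using assms \<open>0 \<le> E\<close> by (simp add: m_def)
  obtain z where z: "0 < z" "mean_field_energy \<theta> \<sigma> m - mean_field_energy \<theta> \<sigma> 0 = (m - 0) * (2 * \<theta> * (z - mean_map \<theta> \<sigma> z))"
    using MVT2[of 0 m "mean_field_energy \<theta> \<sigma>" "\<lambda>z. 2 * \<theta> * (z - mean_map \<theta> \<sigma> z)"]
      mean_field_energy_deriv[OF assms(2)] m by auto
  have "(m - 0) * (2 * \<theta> * (z - mean_map \<theta> \<sigma> z)) \<le> 0"
    using m assms ge[OF z(1)] by (intro mult_nonneg_nonpos) auto
  then have "mean_field_energy \<theta> \<sigma> m \<le> E - \<bar>C\<bar>" using z(2) unfolding E_def by linarith
  then have "\<theta> / 2 * m\<^sup>2 \<le> E" using C[of m] by linarith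
  moreover have "\<theta> / 2 * m \<le> \<theta> / 2 * m\<^sup>2" using m assms by (simp add: power2_eq_square)
  moreover have "E < \<theta> / 2 * m" using assms by (simp add: m_def field_simps)
  ultimately show False by simp
qed

lemma mean_map_supercritical:
  assumes "0 < \<theta>" "0 < \<sigma>" "1 < mean_slope \<theta> \<sigma> 0"
  shows "\<exists>p>0. {m. mean_map \<theta> \<sigma> m = m} = {- p, 0, p}"
proof -
  obtain m where m: "0 < m" "mean_map \<theta> \<sigma> m < m"
    using mean_map_below_diagonal_somewhere[OF assms(1,2)] by blast
  show ?thesis
    by (rule odd_concave_supercritical[of "mean_map \<theta> \<sigma>" "mean_slope \<theta> \<sigma>" m])
      (rule mean_map_odd_concave assms m | assumption)+
qed

lemma mean_map_subcritical:
  assumes "0 < \<theta>" "0 < \<sigma>" "mean_slope \<theta> \<sigma> 0 \<le> 1"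
  shows "{m. mean_map \<theta> \<sigma> m = m} = {0}"
  by (rule odd_concave_subcritical[of "mean_map \<theta> \<sigma>" "mean_slope \<theta> \<sigma>"])
    (rule mean_map_odd_concave assms | assumption)+

text \<open>
  After the substitution \<open>x = sqrt \<sigma> y\<close>, the slope of the mean map at 0 depends on \<open>\<sigma>\<close> only through
  \<open>t = 1 / \<sigma>\<close>: see \<open>scaled_slope\<close> below.
\<close>
definition moment_ratio :: "nat \<Rightarrow> real \<Rightarrow> real" where
  "moment_ratio k \<beta> = quartic_moment k (1 / 4) \<beta> 0 / quartic_moment 0 (1 / 4) \<beta> 0"

lemma quartic_moment_scale:
  assumes "0 < \<sigma>"
  shows "quartic_moment k (quartic_coeff \<sigma>) (\<beta> / \<sigma>\<^sup>2) 0 = sqrt \<sigma> ^ Suc k * quartic_moment k (1 / 4) (\<beta> / \<sigma>) 0"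
proof -
  have s4: "sqrt \<sigma> ^ 4 = \<sigma>\<^sup>2" and s2: "sqrt \<sigma> ^ 2 = \<sigma>"
    using assms by (simp_all add: power4_eq_xxxx power2_eq_square)
  have "quartic_weight (quartic_coeff \<sigma>) (\<beta> / \<sigma>\<^sup>2) (sqrt \<sigma> * y) = quartic_weight (1 / 4) (\<beta> / \<sigma>) y" for y
    using assms by (simp add: quartic_weight_def power_mult_distrib s4) (simp add: power2_eq_square)
  then show ?thesis
    using lborel_integral_real_affine[of "sqrt \<sigma>" "\<lambda>x. x ^ k * quartic_weight (quartic_coeff \<sigma>) (\<beta> / \<sigma>\<^sup>2) x" 0] assms
    by (simp add: quartic_moment_def power_mult_distrib mult.assoc)
qed

lemma mean_slope_zero_scale:
  assumes "0 < \<sigma>"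
  shows "mean_slope \<theta> \<sigma> 0 = 2 * \<theta> * (1 / \<sigma>) * moment_ratio 2 ((\<theta> - 1 / 2) * (1 / \<sigma>))"
proof -
  let ?m = "\<lambda>k. quartic_moment k (1 / 4) ((\<theta> - 1 / 2) / \<sigma>) 0"
  have "mean_slope \<theta> \<sigma> 0 = 2 * \<theta> / \<sigma>\<^sup>2 * (sqrt \<sigma> ^ Suc 2 * ?m 2 / (sqrt \<sigma> ^ Suc 0 * ?m 0))"
    unfolding mean_slope_def tilted_variance_def quartic_moment_scale[OF assms, symmetric] by simp
  also have "sqrt \<sigma> ^ Suc 2 * ?m 2 / (sqrt \<sigma> ^ Suc 0 * ?m 0) = \<sigma> * (?m 2 / ?m 0)"
    using assms by (simp add: power3_eq_cube)
  finally show ?thesis using assms by (simp add: moment_ratio_def power2_eq_square)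
qed

lemma moment_ratio_decreasing:
  assumes "\<beta> < \<beta>'" "even k" "0 < k" shows "moment_ratio k \<beta>' < moment_ratio k \<beta>"
  using quartic_moment_ratio_decreasing[OF _ assms(1), of "1/4" k] assms(2,3)
    quartic_moment_even_pos[of "1/4" 0 \<beta> 0] quartic_moment_even_pos[of "1/4" 0 \<beta>' 0]
  unfolding moment_ratio_def by (simp add: divide_less_eq less_divide_eq mult.commute)

lemma moment_ratio_pos: "even k \<Longrightarrow> 0 < moment_ratio k \<beta>"
  unfolding moment_ratio_def by (intro divide_pos_pos quartic_moment_even_pos) auto

lemma moment_ratio_by_parts:
  shows "moment_ratio 4 \<beta> + 2 * \<beta> * moment_ratio 2 \<beta> = 1"
    and "moment_ratio 6 \<beta> + 2 * \<beta> * moment_ratio 4 \<beta> = 3 * moment_ratio 2 \<beta>"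
proof -
  have "quartic_moment 0 (1 / 4) \<beta> 0 > 0" by (rule quartic_moment_even_pos) auto
  moreover have "moment_ratio j \<beta> + 2 * \<beta> * moment_ratio k \<beta>
    = (quartic_moment j (1 / 4) \<beta> 0 + 2 * \<beta> * quartic_moment k (1 / 4) \<beta> 0) / quartic_moment 0 (1 / 4) \<beta> 0" for j k
    by (simp add: moment_ratio_def add_divide_distrib)
  moreover have "quartic_moment 4 (1 / 4) \<beta> 0 + 2 * \<beta> * quartic_moment 2 (1 / 4) \<beta> 0 = quartic_moment 0 (1 / 4) \<beta> 0"
    "quartic_moment 6 (1 / 4) \<beta> 0 + 2 * \<beta> * quartic_moment 4 (1 / 4) \<beta> 0 = 3 * quartic_moment 2 (1 / 4) \<beta> 0"
  proof -
    have n: "2 + 4 = (6::nat)" "2 + 2 = (4::nat)" "real (Suc 0) = 1" "real (Suc 2) = 3" by simp_all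
    show "quartic_moment 4 (1 / 4) \<beta> 0 + 2 * \<beta> * quartic_moment 2 (1 / 4) \<beta> 0 = quartic_moment 0 (1 / 4) \<beta> 0"
      using quartic_moment_by_parts[of "1/4" 0 \<beta>, unfolded add_0 n] by linarith
    show "quartic_moment 6 (1 / 4) \<beta> 0 + 2 * \<beta> * quartic_moment 4 (1 / 4) \<beta> 0 = 3 * quartic_moment 2 (1 / 4) \<beta> 0"
      using quartic_moment_by_parts[of "1/4" 2 \<beta>, unfolded n] by linarith
  qed
  ultimately show "moment_ratio 4 \<beta> + 2 * \<beta> * moment_ratio 2 \<beta> = 1"
    "moment_ratio 6 \<beta> + 2 * \<beta> * moment_ratio 4 \<beta> = 3 * moment_ratio 2 \<beta>"
    by simp_all (simp add: moment_ratio_def)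
qed

lemma quartic_moment_continuous:
  assumes a: "0 < a" shows "isCont (\<lambda>\<beta>. quartic_moment k a \<beta> 0) \<beta>"
proof -
  have int: "integrable lborel (\<lambda>x. x ^ j * quartic_weight a \<beta> x)" for j \<beta>
    using integrable_quartic_moment[OF a, of j 0 \<beta>] by simp
  have w: "quartic_weight a 0 x * exp (s * (- x\<^sup>2)) = quartic_weight a s x" for s x
    using quartic_weight_shift[of a s x "- s"] by simp
  have "((\<lambda>s. LBINT x. (x ^ k * quartic_weight a 0 x) * exp (s * (- x\<^sup>2))) has_real_derivative
      (LBINT x. (- x\<^sup>2) * (x ^ k * quartic_weight a 0 x) * exp (\<beta> * (- x\<^sup>2)))) (at \<beta>)"
  proof (rule has_real_derivative_integral_exp)
    show "integrable lborel (\<lambda>x. x ^ k * quartic_weight a 0 x * exp (s * (- x\<^sup>2)))" for s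
      unfolding mult.assoc w by (rule int)
    have "integrable lborel (\<lambda>x. - (x ^ (2 + k) * quartic_weight a \<beta> x))" by (rule Bochner_Integration.integrable_minus[OF int])
    then show "integrable lborel (\<lambda>x. (- x\<^sup>2) * (x ^ k * quartic_weight a 0 x) * exp (\<beta> * (- x\<^sup>2)))"
      unfolding mult.assoc w by (simp add: power_add mult.assoc power2_eq_square)
    have "quartic_weight a 0 x * exp (\<beta> * (- x\<^sup>2)) * exp \<bar>- x\<^sup>2\<bar> = quartic_weight a (\<beta> - 1) x" for x
      unfolding w using quartic_weight_shift[of a "\<beta> - 1" x 1] by simp
    then have "(- x\<^sup>2)\<^sup>2 * exp \<bar>- x\<^sup>2\<bar> * (x ^ k * quartic_weight a 0 x * exp (\<beta> * (- x\<^sup>2)))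
      = x ^ (4 + k) * quartic_weight a (\<beta> - 1) x" for x
      by (simp add: power_add mult_ac flip: power_mult)
    then show "integrable lborel (\<lambda>x. (- x\<^sup>2)\<^sup>2 * exp \<bar>- x\<^sup>2\<bar> * (x ^ k * quartic_weight a 0 x * exp (\<beta> * (- x\<^sup>2))))"
      using int[of "4 + k" "\<beta> - 1"] by simp
  qed
  then have "isCont (\<lambda>s. LBINT x. (x ^ k * quartic_weight a 0 x) * exp (s * (- x\<^sup>2))) \<beta>"
    by (rule DERIV_isCont)
  then show ?thesis unfolding mult.assoc w by (simp add: quartic_moment_def)
qed

lemma moment_ratio_continuous: "isCont (moment_ratio k) \<beta>"
  unfolding moment_ratio_def[abs_def]
  using quartic_moment_even_pos[of "1/4" 0 \<beta> 0]
  by (intro isCont_divide quartic_moment_continuous) auto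

definition scaled_slope :: "real \<Rightarrow> real \<Rightarrow> real" where
  "scaled_slope \<theta> t = 2 * \<theta> * t * moment_ratio 2 ((\<theta> - 1 / 2) * t)"

text \<open>
  For \<open>\<theta> > 1/2\<close> the two factors \<open>t\<close> and \<open>moment_ratio 2\<close> compete. Integration by parts replaces
  their product by a single fourth moment, whose monotonicity is clear.
\<close>
lemma scaled_slope_by_parts:
  assumes "1 / 2 < \<theta>"
  shows "scaled_slope \<theta> t = \<theta> / (\<theta> - 1 / 2) * (1 - moment_ratio 4 ((\<theta> - 1 / 2) * t))"
proof -
  have "1 - moment_ratio 4 ((\<theta> - 1 / 2) * t) = 2 * ((\<theta> - 1 / 2) * t) * moment_ratio 2 ((\<theta> - 1 / 2) * t)"
    using moment_ratio_by_parts(1)[of "(\<theta> - 1 / 2) * t"] by linarith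
  with assms show ?thesis by (simp add: scaled_slope_def)
qed

lemma scaled_slope_increasing:
  assumes \<theta>: "0 < \<theta>" and t: "0 < t" "t < t'"
  shows "scaled_slope \<theta> t < scaled_slope \<theta> t'"
proof (cases "\<theta> \<le> 1 / 2")
  case True
  let ?c = "\<theta> - 1 / 2"
  have "moment_ratio 2 (?c * t) \<le> moment_ratio 2 (?c * t')"
  proof (cases "\<theta> = 1 / 2")
    case False
    then have "?c * t' < ?c * t" using True t by (intro mult_strict_left_mono_neg) auto
    then show ?thesis using moment_ratio_decreasing[of "?c * t'" "?c * t" 2] by simp
  next
    case True
    then have c: "?c = 0" by simp
    show ?thesis unfolding c by simp
  qed
  moreover have "2 * \<theta> * t < 2 * \<theta> * t'" using \<theta> t by simp
  ultimately have "2 * \<theta> * t * moment_ratio 2 (?c * t) < 2 * \<theta> * t' * moment_ratio 2 (?c * t')"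
    using \<theta> t moment_ratio_pos[of 2 "?c * t"] by (meson even_numeral less_imp_le mult_less_le_imp_less mult_pos_pos zero_less_numeral)
  then show ?thesis unfolding scaled_slope_def .
next
  case False
  then have "(\<theta> - 1 / 2) * t < (\<theta> - 1 / 2) * t'" using t by simp
  then have "moment_ratio 4 ((\<theta> - 1 / 2) * t') < moment_ratio 4 ((\<theta> - 1 / 2) * t)"
    by (intro moment_ratio_decreasing) auto
  moreover have "0 < \<theta> / (\<theta> - 1 / 2)" using False \<theta> by simp
  ultimately have "\<theta> / (\<theta> - 1 / 2) * (1 - moment_ratio 4 ((\<theta> - 1 / 2) * t))
    < \<theta> / (\<theta> - 1 / 2) * (1 - moment_ratio 4 ((\<theta> - 1 / 2) * t'))"
    by (intro mult_strict_left_mono) auto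
  then show ?thesis using False by (simp only: scaled_slope_by_parts not_le)
qed

text \<open>
  For \<open>\<theta> \<le> 1/2\<close> the second moment is bounded below, so the slope grows at least linearly in \<open>t\<close>.
  For \<open>\<theta> > 1/2\<close> it tends to \<open>\<theta> / (\<theta> - 1/2) > 1\<close>, because two integrations by parts bound the fourth
  moment by \<open>3 / (4 \<beta>\<^sup>2)\<close>.
\<close>
lemma scaled_slope_exceeds_one:
  assumes \<theta>: "0 < \<theta>" shows "\<exists>t>0. 1 < scaled_slope \<theta> t"
proof (cases "\<theta> \<le> 1 / 2")
  case True
  let ?P = "moment_ratio 2 0"
  let ?t = "1 / (\<theta> * ?P)"
  have P: "0 < ?P" by (rule moment_ratio_pos) simp
  have t: "0 < ?t" using P \<theta> by simp
  have "?P \<le> moment_ratio 2 ((\<theta> - 1 / 2) * ?t)"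
  proof (cases "\<theta> = 1 / 2")
    case False
    then have "(\<theta> - 1 / 2) * ?t < 0" using True t by (intro mult_neg_pos) auto
    then show ?thesis using moment_ratio_decreasing[of "(\<theta> - 1 / 2) * ?t" 0 2] by simp
  next
    case True
    then have c: "\<theta> - 1 / 2 = 0" by simp
    show ?thesis unfolding c by simp
  qed
  then have "2 * \<theta> * ?t * ?P \<le> scaled_slope \<theta> ?t"
    unfolding scaled_slope_def using \<theta> t P by (intro mult_left_mono) (auto simp: less_imp_le)
  moreover have "2 * \<theta> * ?t * ?P = 2" using P \<theta> by simp
  ultimately show ?thesis using t by (intro exI[of _ ?t]) auto
next
  case False
  \<comment> \<open>any \<open>B\<close> with \<open>B\<^sup>2 > 3 \<theta> / 2\<close> works\<close>
  define B where "B = 1 + 2 * \<theta>"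
  define c where "c = \<theta> - 1 / 2"
  have B: "1 < B" using \<theta> by (simp add: B_def)
  have c: "0 < c" using False by (simp add: c_def)
  define P Q where "P = moment_ratio 2 B" and "Q = moment_ratio 4 B"
  have pos: "0 < P" "0 < Q" "0 < moment_ratio 6 B" by (simp_all add: P_def Q_def moment_ratio_pos)
  have "2 * B * P \<le> 1" "2 * B * Q \<le> 3 * P"
    using moment_ratio_by_parts[of B] pos by (simp_all add: P_def Q_def)
  moreover from this(2) have "2 * B * (2 * B * Q) \<le> 2 * B * (3 * P)"
    using B by (intro mult_left_mono) auto
  ultimately have "2 * B * (2 * B * Q) \<le> 3" by simp
  moreover have "3 / 2 * \<theta> * Q < B * B * Q"
    using pos \<theta> by (intro mult_strict_right_mono) (simp_all add: B_def algebra_simps add_pos_pos)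
  ultimately have "2 * \<theta> * Q < 1" by simp
  then have "c < \<theta> * (1 - Q)" by (simp add: c_def algebra_simps)
  then have "1 < \<theta> / c * (1 - Q)" using c by (simp add: field_simps)
  moreover have "scaled_slope \<theta> (B / c) = \<theta> / c * (1 - Q)"
    using False c by (subst scaled_slope_by_parts) (simp_all add: c_def Q_def)
  ultimately show ?thesis using B c by (intro exI[of _ "B / c"]) auto
qed

lemma scaled_slope_crossing:
  assumes \<theta>: "0 < \<theta>" shows "\<exists>t>0. scaled_slope \<theta> t = 1"
proof -
  obtain u where u: "0 < u" "1 < scaled_slope \<theta> u" using scaled_slope_exceeds_one[OF \<theta>] by blast
  have "isCont (scaled_slope \<theta>) t" for t
    unfolding scaled_slope_def[abs_def]
    by (intro continuous_intros isCont_o2[OF _ moment_ratio_continuous])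
  then have "continuous_on {0..u} (scaled_slope \<theta>)"
    by (simp add: continuous_at_imp_continuous_on)
  then obtain t where t: "0 \<le> t" "scaled_slope \<theta> t = 1"
    using IVT'[of "scaled_slope \<theta>" 0 1 u] u by (auto simp: scaled_slope_def)
  have "scaled_slope \<theta> 0 \<noteq> 1" by (simp add: scaled_slope_def)
  then have "t \<noteq> 0" using t(2) by metis
  then show ?thesis using t by (intro exI[of _ t]) simp
qed

text \<open>
  At the critical variance itself the slope at 0 equals 1, and strict concavity still excludes
  nonzero fixed points; so the crossing point belongs to the subcritical side.
\<close>
lemma is_crit_var_exists:
  assumes \<theta>: "0 < \<theta>" shows "\<exists>s. is_crit_var \<theta> s"
proof -
  obtain u where u: "0 < u" "scaled_slope \<theta> u = 1" using scaled_slope_crossing[OF \<theta>] by blast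
  have slope: "mean_slope \<theta> \<sigma> 0 = scaled_slope \<theta> (1 / \<sigma>)" if "0 < \<sigma>" for \<sigma>
    using mean_slope_zero_scale[OF that] by (simp add: scaled_slope_def)
  have "is_crit_var \<theta> ((1 / u)\<^sup>2)"
    unfolding is_crit_var_def
  proof (intro conjI allI impI)
    fix \<sigma> :: real assume \<sigma>: "0 < \<sigma>" "(1 / u)\<^sup>2 \<le> \<sigma>\<^sup>2"
    then have "1 / u \<le> \<sigma>" using power2_le_imp_le by fastforce
    then have "1 / \<sigma> \<le> u" using \<sigma> u by (simp add: field_simps)
    then have "mean_slope \<theta> \<sigma> 0 \<le> 1"
      using scaled_slope_increasing[OF \<theta>, of "1 / \<sigma>" u] u \<sigma> slope[OF \<sigma>(1)] by (cases "1 / \<sigma> = u") auto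
    then show "{m. mean_map \<theta> \<sigma> m = m} = {0}"
      by (rule mean_map_subcritical[OF \<theta> \<sigma>(1)])
  next
    fix \<sigma> :: real assume \<sigma>: "0 < \<sigma>" "\<sigma>\<^sup>2 < (1 / u)\<^sup>2"
    then have "\<sigma> < 1 / u" using u by (intro power2_less_imp_less[of \<sigma> "1 / u"]) auto
    then have "u < 1 / \<sigma>" using \<sigma> u by (simp add: field_simps)
    then have "1 < mean_slope \<theta> \<sigma> 0"
      using scaled_slope_increasing[OF \<theta>, of u "1 / \<sigma>"] u slope[OF \<sigma>(1)] by simp
    then show "\<exists>p>0. {m. mean_map \<theta> \<sigma> m = m} = {- p, 0, p}"
      by (rule mean_map_supercritical[OF \<theta> \<sigma>(1)])
  qed (use u in simp)
  then show ?thesis ..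
qed

lemma is_crit_var_unique:
  assumes "is_crit_var \<theta> s" "is_crit_var \<theta> s'" shows "s = s'"
proof -
  have False if s: "is_crit_var \<theta> s" "is_crit_var \<theta> s'" "s < s'" for s s'
  proof -
    define \<sigma> where "\<sigma> = sqrt s"
    have \<sigma>: "0 < \<sigma>" "\<sigma>\<^sup>2 = s" using s(1) by (auto simp: \<sigma>_def is_crit_var_def)
    have "{m. mean_map \<theta> \<sigma> m = m} = {0}" using s(1) \<sigma> by (simp add: is_crit_var_def)
    moreover obtain p where "0 < p" "{m. mean_map \<theta> \<sigma> m = m} = {- p, 0, p}"
      using s(2,3) \<sigma> unfolding is_crit_var_def by blast
    ultimately show False by auto
  qed
  then show ?thesis using assms by (metis linorder_neqE)
qed

lemma m_plus_fixed_point: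
  assumes \<theta>: "0 < \<theta>" and \<sigma>: "0 < \<sigma>" "\<sigma>\<^sup>2 < crit_var \<theta>"
  shows "0 < m_plus \<theta> \<sigma>" "mean_map \<theta> \<sigma> (m_plus \<theta> \<sigma>) = m_plus \<theta> \<sigma>"
proof -
  obtain s where s: "is_crit_var \<theta> s" using is_crit_var_exists[OF \<theta>] by blast
  then have "crit_var \<theta> = s" unfolding crit_var_def
    using is_crit_var_unique by (intro the_equality) auto
  then obtain p where p: "0 < p" "{m. mean_map \<theta> \<sigma> m = m} = {- p, 0, p}"
    using s \<sigma> unfolding is_crit_var_def by blast
  have iff: "mean_map \<theta> \<sigma> m = m \<longleftrightarrow> m \<in> {- p, 0, p}" for m using p(2) by blast
  have "m_plus \<theta> \<sigma> = p" unfolding m_plus_def iff using p(1) by (intro the_equality) auto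
  with p(1) iff[of p] show "0 < m_plus \<theta> \<sigma>" "mean_map \<theta> \<sigma> (m_plus \<theta> \<sigma>) = m_plus \<theta> \<sigma>" by simp_all
qed

section \<open>Minimum of the mean-field energy\<close>
lemma mean_map_above_diagonal:
  assumes "0 < \<theta>" "0 < \<sigma>" "0 < p" "mean_map \<theta> \<sigma> p = p" "0 < m" "m < p"
  shows "m < mean_map \<theta> \<sigma> m"
  by (rule odd_concave_above_diagonal[of "mean_map \<theta> \<sigma>" "mean_slope \<theta> \<sigma>" p])
    (rule mean_map_odd_concave assms | assumption)+

lemma mean_map_below_diagonal:
  assumes "0 < \<theta>" "0 < \<sigma>" "0 < p" "mean_map \<theta> \<sigma> p = p" "p < m"
  shows "mean_map \<theta> \<sigma> m < m"
  by (rule odd_concave_below_diagonal[of "mean_map \<theta> \<sigma>" "mean_slope \<theta> \<sigma>" p])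
    (rule mean_map_odd_concave assms | assumption)+

lemma mean_map_contraction:
  assumes "0 < \<theta>" "0 < \<sigma>" "0 < p" "mean_map \<theta> \<sigma> p = p" "0 < e" "e < p"
  shows "\<exists>\<alpha>. 0 < \<alpha> \<and> \<alpha> < 1 \<and> (\<forall>m\<ge>e. \<bar>mean_map \<theta> \<sigma> m - p\<bar> \<le> \<alpha> * \<bar>m - p\<bar>)"
  by (rule odd_concave_contraction[of "mean_map \<theta> \<sigma>" "mean_slope \<theta> \<sigma>" p])
    (rule mean_map_odd_concave assms | assumption)+

lemma mean_field_energy_minus: "mean_field_energy \<theta> \<sigma> (- m) = mean_field_energy \<theta> \<sigma> m"
  by (simp add: mean_field_energy_def log_partition_minus)

lemma mean_field_energy_abs: "mean_field_energy \<theta> \<sigma> \<bar>m\<bar> = mean_field_energy \<theta> \<sigma> m"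
  by (simp add: abs_if mean_field_energy_minus)

lemma mean_field_energy_minimum:
  assumes \<theta>: "0 < \<theta>" and \<sigma>: "0 < \<sigma>" and p: "0 < p" "mean_map \<theta> \<sigma> p = p"
  shows "mean_field_energy \<theta> \<sigma> p \<le> mean_field_energy \<theta> \<sigma> m"
proof -
  note deriv = mean_field_energy_deriv[OF \<sigma>, of \<theta>]
  have nonneg: "mean_field_energy \<theta> \<sigma> p \<le> mean_field_energy \<theta> \<sigma> m" if m: "0 \<le> m" for m
  proof (cases m p rule: linorder_cases)
    case less
    show ?thesis
    proof (rule DERIV_nonpos_imp_decreasing_open[of m p "mean_field_energy \<theta> \<sigma>"])
      show "\<exists>y. (mean_field_energy \<theta> \<sigma> has_real_derivative y) (at x) \<and> y \<le> 0" if x: "m < x" "x < p" for x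
      proof -
        have "x < mean_map \<theta> \<sigma> x"
          using m x by (intro mean_map_above_diagonal[OF \<theta> \<sigma> p]) auto
        then show ?thesis using deriv[of x] \<theta> by (intro exI conjI) (auto simp: mult_nonneg_nonpos)
      qed
      show "continuous_on {m..p} (mean_field_energy \<theta> \<sigma>)"
        by (intro continuous_at_imp_continuous_on ballI DERIV_isCont[OF deriv])
    qed (use less in simp)
  next
    case greater
    show ?thesis
    proof (rule DERIV_nonneg_imp_increasing_open[of p m "mean_field_energy \<theta> \<sigma>"])
      show "\<exists>y. (mean_field_energy \<theta> \<sigma> has_real_derivative y) (at x) \<and> 0 \<le> y" if x: "p < x" "x < m" for x
      proof -
        have "mean_map \<theta> \<sigma> x < x"
          using x by (intro mean_map_below_diagonal[OF \<theta> \<sigma> p]) auto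
        then show ?thesis using deriv[of x] \<theta> by (intro exI conjI) auto
      qed
      show "continuous_on {p..m} (mean_field_energy \<theta> \<sigma>)"
        by (intro continuous_at_imp_continuous_on ballI DERIV_isCont[OF deriv])
    qed (use greater in simp)
  qed simp
  show ?thesis using nonneg[of "\<bar>m\<bar>"] by (simp add: mean_field_energy_abs)
qed

text \<open>
  The log-partition function lies above its tangent at the tilt that belongs to \<open>p\<close>; the slope of
  that tangent is \<open>f p = p\<close>.
\<close>
lemma mean_field_energy_quadratic_upper:
  assumes \<theta>: "0 < \<theta>" and \<sigma>: "0 < \<sigma>" and p: "mean_map \<theta> \<sigma> p = p"
  shows "mean_field_energy \<theta> \<sigma> m \<le> mean_field_energy \<theta> \<sigma> p + \<theta> * (\<bar>m\<bar> - p)\<^sup>2"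
proof -
  have a: "0 < quartic_coeff \<sigma>" using \<sigma> by simp
  let ?L = "\<lambda>m. log_partition (quartic_coeff \<sigma>) (quadratic_coeff \<theta> \<sigma>) (tilt \<theta> \<sigma> m)"
  have "mean_field_energy \<theta> \<sigma> m \<le> mean_field_energy \<theta> \<sigma> p + \<theta> * (m - p)\<^sup>2" for m
  proof -
    have "?L p + p * (tilt \<theta> \<sigma> m - tilt \<theta> \<sigma> p) \<le> ?L m"
      using log_partition_above_tangent[OF a, of "quadratic_coeff \<theta> \<sigma>" "tilt \<theta> \<sigma> p" "tilt \<theta> \<sigma> m"] p
      by (simp add: mean_map_eq)
    then have "\<sigma>\<^sup>2 * (?L p + p * (tilt \<theta> \<sigma> m - tilt \<theta> \<sigma> p)) \<le> \<sigma>\<^sup>2 * ?L m"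
      by (rule mult_left_mono) simp
    moreover have "\<sigma>\<^sup>2 * (?L p + p * (tilt \<theta> \<sigma> m - tilt \<theta> \<sigma> p)) = \<sigma>\<^sup>2 * ?L p + 2 * \<theta> * p * (m - p)"
      using \<sigma> by (simp add: distrib_left right_diff_distrib)
    moreover have "\<theta> * (m - p)\<^sup>2 = \<theta> * m\<^sup>2 - \<theta> * p\<^sup>2 - 2 * \<theta> * p * (m - p)"
      by (simp add: power2_eq_square algebra_simps)
    ultimately show ?thesis unfolding mean_field_energy_def by linarith
  qed
  from this[of "\<bar>m\<bar>"] show ?thesis by (simp add: mean_field_energy_abs)
qed

section \<open>Absolutely continuous functions\<close>
text \<open>
  Absolute continuity on a compact interval, given by its defining integral: no derivative of \<open>f\<close> at
  points is involved, and \<open>f'\<close> matters up to null sets only.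
\<close>
definition abs_cont_on :: "real \<Rightarrow> real \<Rightarrow> (real \<Rightarrow> real) \<Rightarrow> (real \<Rightarrow> real) \<Rightarrow> bool" where
  "abs_cont_on a b f f' \<longleftrightarrow> set_integrable lborel {a..b} f' \<and>
    (\<forall>x\<in>{a..b}. f x = f a + (LBINT t:{a..x}. f' t))"

lemma abs_cont_on_integrable: "abs_cont_on a b f f' \<Longrightarrow> set_integrable lborel {a..b} f'"
  by (simp add: abs_cont_on_def)

lemma abs_cont_on_eq:
  "abs_cont_on a b f f' \<Longrightarrow> a \<le> x \<Longrightarrow> x \<le> b \<Longrightarrow> f x = f a + (LBINT t:{a..x}. f' t)"
  unfolding abs_cont_on_def by (meson atLeastAtMost_iff)

lemma abs_cont_onI:
  assumes "set_integrable lborel {a..b} f'"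
    and "\<And>x. a \<le> x \<Longrightarrow> x \<le> b \<Longrightarrow> f x = f a + (LBINT t:{a..x}. f' t)"
  shows "abs_cont_on a b f f'"
  unfolding abs_cont_on_def using assms by (meson atLeastAtMost_iff)

lemma abs_cont_on_restrict:
  assumes "abs_cont_on a b f f'" "x \<le> b"
  shows "abs_cont_on a x f f'"
proof (rule abs_cont_onI)
  show "set_integrable lborel {a..x} f'"
    by (rule set_integrable_subset[OF abs_cont_on_integrable[OF assms(1)]]) (use assms(2) in auto)
qed (rule abs_cont_on_eq[OF assms(1)], use assms(2) in auto)

lemma abs_cont_on_cong:
  assumes "abs_cont_on a b f f'" "\<And>x. f x = g x" "\<And>x. f' x = g' x"
  shows "abs_cont_on a b g g'"
proof -
  have "f = g" "f' = g'" using assms(2,3) by auto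
  with assms(1) show ?thesis by simp
qed

lemma abs_cont_on_continuous:
  assumes "abs_cont_on a b f f'" shows "continuous_on {a..b} f"
proof -
  note int = abs_cont_on_integrable[OF assms]
  have "continuous_on {a..b} (\<lambda>x. f a + integral {a..x} f')"
    using set_borel_integral_eq_integral(1)[OF int]
    by (intro continuous_intros indefinite_integral_continuous_1)
  moreover have "f x = f a + integral {a..x} f'" if "x \<in> {a..b}" for x
  proof -
    have "set_integrable lborel {a..x} f'" by (rule set_integrable_subset[OF int]) (use that in auto)
    then show ?thesis
      using abs_cont_on_eq[OF assms, of x] that set_borel_integral_eq_integral(2)[of "{a..x}" f'] by simp
  qed
  ultimately show ?thesis by (rule continuous_on_eq[OF _ sym])
qed

lemma abs_cont_on_of_C1:
  assumes cont: "continuous_on {a..b} f" "continuous_on {a..b} f'"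
    and deriv: "\<And>x. a < x \<Longrightarrow> x < b \<Longrightarrow> (f has_real_derivative f' x) (at x)"
  shows "abs_cont_on a b f f'"
proof (rule abs_cont_onI)
  show "set_integrable lborel {a..b} f'" by (rule borel_integrable_atLeastAtMost'[OF cont(2)])
  fix x assume x: "a \<le> x" "x \<le> b"
  have "(f' has_integral (f x - f a)) {a..x}"
    using x by (intro fundamental_theorem_of_calculus_interior continuous_on_subset[OF cont(1)])
      (auto simp: deriv has_real_derivative_iff_has_vector_derivative[symmetric])
  moreover have "set_integrable lborel {a..x} f'"
    using x by (intro borel_integrable_atLeastAtMost' continuous_on_subset[OF cont(2)]) auto
  ultimately show "f x = f a + (LBINT t:{a..x}. f' t)"
    by (simp add: set_borel_integral_eq_integral(2) integral_unique)
qed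

lemma set_integrable_continuous_mult:
  fixes f g :: "real \<Rightarrow> real"
  assumes g: "continuous_on {a..b} g" and f: "set_integrable lborel {a..b} f"
  shows "set_integrable lborel {a..b} (\<lambda>x. g x * f x)"
proof -
  have "bounded (g ` {a..b})"
    by (intro compact_imp_bounded compact_continuous_image[OF g compact_Icc])
  then obtain B where "\<forall>x\<in>{a..b}. \<bar>g x\<bar> \<le> B" by (auto simp: bounded_iff)
  then have B: "\<bar>g x\<bar> \<le> B" if "x \<in> {a..b}" for x using that by blast
  have m: "(\<lambda>x. indicator {a..b} x * g x) \<in> borel_measurable lborel"
    using borel_integrable_atLeastAtMost'[OF g] by (auto simp: set_integrable_def)
  have "integrable lborel (\<lambda>x. (indicator {a..b} x * g x) * (indicator {a..b} x *\<^sub>R f x))"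
  proof (rule Bochner_Integration.integrable_bound)
    show "integrable lborel (\<lambda>x. B * \<bar>indicator {a..b} x *\<^sub>R f x\<bar>)"
      using f by (simp add: set_integrable_def)
    show "(\<lambda>x. indicator {a..b} x * g x * indicator {a..b} x *\<^sub>R f x) \<in> borel_measurable lborel"
      using m f by (auto simp: set_integrable_def intro!: borel_measurable_times)
    have "0 \<le> B" if "x \<in> {a..b}" for x using B[OF that] by (meson abs_ge_zero order_trans)
    then show "AE x in lborel. norm (indicator {a..b} x * g x * indicator {a..b} x *\<^sub>R f x)
        \<le> norm (B * \<bar>indicator {a..b} x *\<^sub>R f x\<bar>)"
      using B by (intro AE_I2) (auto simp: indicator_def abs_mult intro!: mult_right_mono order_trans[OF B])
  qed
  then show ?thesis unfolding set_integrable_def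
    by (rule Bochner_Integration.integrable_cong[THEN iffD1, rotated 2]) (auto simp: indicator_def)
qed

text \<open>
  Fubini for the square cut along its diagonal. Taken with two derivatives, it is integration by
  parts.
\<close>
lemma integral_triangle_split:
  fixes U V :: "real \<Rightarrow> real"
  assumes U: "integrable lborel U" and V: "integrable lborel V"
  shows "(LBINT s. U s) * (LBINT t. V t)
    = (LBINT s. U s * (LBINT t. indicator {..s} t * V t))
      + (LBINT t. V t * (LBINT s. indicator {..t} s * U s))"
proof -
  have [measurable]: "U \<in> borel_measurable lborel" "V \<in> borel_measurable lborel"
    "U \<in> borel_measurable borel" "V \<in> borel_measurable borel" using U V by auto
  have iU: "integrable lborel (\<lambda>s. indicator A s * U s)" and iV: "integrable lborel (\<lambda>s. indicator A s * V s)"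
    if "A \<in> sets borel" for A
    using integrable_mult_indicator[OF _ U, of A] integrable_mult_indicator[OF _ V, of A] that by simp_all
  have le: "integrable (lborel \<Otimes>\<^sub>M lborel) (\<lambda>(s, t). U s * (indicator {s<..} t * V t))"
  proof (rule lborel_pair.Fubini_integrable)
    show "(\<lambda>(s, t). U s * (indicator {s<..} t * V t)) \<in> borel_measurable (lborel \<Otimes>\<^sub>M lborel)"
      unfolding indicator_def greaterThan_iff by measurable
    show "AE s in lborel. integrable lborel (\<lambda>t. case (s, t) of (s, t) \<Rightarrow> U s * (indicator {s<..} t * V t))"
      using iV by simp
    have "integrable lborel (\<lambda>s. \<bar>U s\<bar> * (LBINT t. \<bar>indicator {s<..} t * V t\<bar>))"
    proof (rule Bochner_Integration.integrable_bound)
      show "integrable lborel (\<lambda>s. (LBINT t. \<bar>V t\<bar>) * \<bar>U s\<bar>)" using U by simp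
      show "(\<lambda>s. \<bar>U s\<bar> * (LBINT t. \<bar>indicator {s<..} t * V t\<bar>)) \<in> borel_measurable lborel"
        unfolding indicator_def greaterThan_iff by measurable
      show "AE s in lborel. norm (\<bar>U s\<bar> * (LBINT t. \<bar>indicator {s<..} t * V t\<bar>))
        \<le> norm ((LBINT t. \<bar>V t\<bar>) * \<bar>U s\<bar>)"
      proof (rule AE_I2)
        fix s
        have "(LBINT t. \<bar>indicator {s<..} t * V t\<bar>) \<le> (LBINT t. \<bar>V t\<bar>)"
          using iV[of "{s<..}"] V by (intro integral_mono) (auto simp: indicator_def)
        then show "norm (\<bar>U s\<bar> * (LBINT t. \<bar>indicator {s<..} t * V t\<bar>))
          \<le> norm ((LBINT t. \<bar>V t\<bar>) * \<bar>U s\<bar>)"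
          by (simp add: abs_mult mult.commute mult_left_mono)
      qed
    qed
    then show "integrable lborel (\<lambda>s. LBINT t. norm (case (s, t) of (s, t) \<Rightarrow> U s * (indicator {s<..} t * V t)))"
      by (simp add: abs_mult)
  qed
  have split: "(LBINT t. V t)
    = (LBINT t. indicator {..s} t * V t) + (LBINT t. indicator {s<..} t * V t)" for s
  proof -
    have "(LBINT t. V t) = (LBINT t. indicator {..s} t * V t + indicator {s<..} t * V t)"
      by (intro Bochner_Integration.integral_cong) (auto simp: indicator_def)
    then show ?thesis using iV by simp
  qed
  have iinner: "integrable lborel (\<lambda>s. U s * (LBINT t. indicator {s<..} t * V t))"
    using lborel_pair.integrable_fst[OF le] by simp
  have iinner': "integrable lborel (\<lambda>s. U s * (LBINT t. indicator {..s} t * V t))"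
  proof -
    have eq: "U s * (LBINT t. indicator {..s} t * V t)
      = U s * (LBINT t. V t) - U s * (LBINT t. indicator {s<..} t * V t)" for s
      unfolding split[of s] by (simp add: algebra_simps)
    show ?thesis unfolding eq by (intro Bochner_Integration.integrable_diff iinner) (use U in simp)
  qed
  have "(LBINT s. U s) * (LBINT t. V t) = (LBINT s. U s * (LBINT t. V t))" by simp
  also have "\<dots> = (LBINT s. U s * (LBINT t. indicator {..s} t * V t)
      + U s * (LBINT t. indicator {s<..} t * V t))"
  proof (intro Bochner_Integration.integral_cong refl)
    show "U s * (LBINT t. V t) = U s * (LBINT t. indicator {..s} t * V t)
      + U s * (LBINT t. indicator {s<..} t * V t)" for s
      unfolding split[of s] by (rule distrib_left)
  qed
  also have "\<dots> = (LBINT s. U s * (LBINT t. indicator {..s} t * V t))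
      + (LBINT s. U s * (LBINT t. indicator {s<..} t * V t))"
    by (rule Bochner_Integration.integral_add[OF iinner' iinner])
  also have "(LBINT s. U s * (LBINT t. indicator {s<..} t * V t))
    = (LBINT s. (LBINT t. U s * (indicator {s<..} t * V t)))" by simp
  also have "\<dots> = (LBINT t. (LBINT s. U s * (indicator {s<..} t * V t)))"
    by (rule lborel_pair.Fubini_integral[symmetric, OF le])
  also have "\<dots> = (LBINT t. V t * (LBINT s. indicator {..t} s * U s))"
  proof (intro Bochner_Integration.integral_cong refl)
    fix t
    have "(LBINT s. U s * (indicator {s<..} t * V t)) = (LBINT s. V t * (indicator {..t} s * U s))"
    proof (rule integral_cong_AE)
      show "AE s in lborel. U s * (indicator {s<..} t * V t) = V t * (indicator {..t} s * U s)"
        using AE_lborel_singleton[of t] by eventually_elim (auto simp: indicator_def)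
      show "(\<lambda>s. U s * (indicator {s<..} t * V t)) \<in> borel_measurable lborel"
        unfolding indicator_def greaterThan_iff by measurable
    qed measurable
    then show "(LBINT s. U s * (indicator {s<..} t * V t)) = V t * (LBINT s. indicator {..t} s * U s)"
      by simp
  qed
  finally show ?thesis .
qed

lemma abs_cont_on_integral_indicator:
  assumes "abs_cont_on a b f f'" "x \<in> {a..b}"
  shows "(LBINT t. indicator {..x} t * (indicator {a..b} t *\<^sub>R f' t)) = f x - f a"
proof -
  have "(LBINT t. indicator {..x} t * (indicator {a..b} t *\<^sub>R f' t)) = (LBINT t:{a..x}. f' t)"
    unfolding set_lebesgue_integral_def using assms(2)
    by (intro Bochner_Integration.integral_cong) (auto simp: indicator_def)
  then show ?thesis using abs_cont_on_eq[OF assms(1), of x] assms(2) by simp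
qed

lemma abs_cont_on_mult:
  assumes u: "abs_cont_on a b u u'" and v: "abs_cont_on a b v v'"
  shows "abs_cont_on a b (\<lambda>x. u x * v x) (\<lambda>x. v x * u' x + u x * v' x)"
proof -
  have parts: "u x * v x = u a * v a + (LBINT t:{a..x}. v t * u' t + u t * v' t)" if x: "a \<le> x" "x \<le> b" for x
  proof -
    have u: "abs_cont_on a x u u'" and v: "abs_cont_on a x v v'"
      using u v x by (auto intro: abs_cont_on_restrict)
    define U where "U = (\<lambda>t. indicator {a..x} t *\<^sub>R u' t)"
    define V where "V = (\<lambda>t. indicator {a..x} t *\<^sub>R v' t)"
    have iU: "integrable lborel U" and iV: "integrable lborel V"
      using abs_cont_on_integrable[OF u] abs_cont_on_integrable[OF v] by (simp_all add: U_def V_def set_integrable_def)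
    have ivu: "integrable lborel (\<lambda>t. indicator {a..x} t *\<^sub>R (v t * u' t))"
      and iuv: "integrable lborel (\<lambda>t. indicator {a..x} t *\<^sub>R (u t * v' t))"
      using set_integrable_continuous_mult[OF abs_cont_on_continuous[OF v] abs_cont_on_integrable[OF u]]
        set_integrable_continuous_mult[OF abs_cont_on_continuous[OF u] abs_cont_on_integrable[OF v]]
      by (simp_all add: set_integrable_def)
    have tot: "(LBINT t. U t) = u x - u a" "(LBINT t. V t) = v x - v a"
      using abs_cont_on_eq[OF u, of x] abs_cont_on_eq[OF v, of x] x by (simp_all add: U_def V_def set_lebesgue_integral_def)
    have uU: "(LBINT s. indicator {..t} s * U s) = u t - u a"
      and vV: "(LBINT s. indicator {..t} s * V s) = v t - v a" if "t \<in> {a..x}" for t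
      using abs_cont_on_integral_indicator[OF u that] abs_cont_on_integral_indicator[OF v that]
      by (simp_all add: U_def V_def)
    have "(u x - u a) * (v x - v a) = (LBINT s. U s * (LBINT t. indicator {..s} t * V t))
      + (LBINT t. V t * (LBINT s. indicator {..t} s * U s))"
      using integral_triangle_split[OF iU iV] by (simp add: tot)
    also have "(LBINT s. U s * (LBINT t. indicator {..s} t * V t))
      = (LBINT s. indicator {a..x} s *\<^sub>R (v s * u' s) - v a * U s)"
    proof (intro Bochner_Integration.integral_cong refl)
      show "U s * (LBINT t. indicator {..s} t * V t) = indicator {a..x} s *\<^sub>R (v s * u' s) - v a * U s" for s
        by (cases "s \<in> {a..x}") (simp_all only: vV, simp_all add: U_def algebra_simps)
    qed
    also have "\<dots> = (LBINT s. indicator {a..x} s *\<^sub>R (v s * u' s)) - v a * (u x - u a)"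
      using ivu iU by (simp add: tot)
    also have "(LBINT t. V t * (LBINT s. indicator {..t} s * U s))
      = (LBINT t. indicator {a..x} t *\<^sub>R (u t * v' t) - u a * V t)"
    proof (intro Bochner_Integration.integral_cong refl)
      show "V t * (LBINT s. indicator {..t} s * U s) = indicator {a..x} t *\<^sub>R (u t * v' t) - u a * V t" for t
        by (cases "t \<in> {a..x}") (simp_all only: uU, simp_all add: V_def algebra_simps)
    qed
    also have "\<dots> = (LBINT t. indicator {a..x} t *\<^sub>R (u t * v' t)) - u a * (v x - v a)"
      using iuv iV by (simp add: tot)
    finally have "u x * v x - u a * v a = (LBINT s. indicator {a..x} s *\<^sub>R (v s * u' s))
      + (LBINT t. indicator {a..x} t *\<^sub>R (u t * v' t))"
      by (simp add: algebra_simps)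
    also have "\<dots> = (LBINT t:{a..x}. v t * u' t + u t * v' t)"
      unfolding set_lebesgue_integral_def Bochner_Integration.integral_add[OF ivu iuv, symmetric]
      by (simp add: algebra_simps)
    finally show ?thesis by simp
  qed
  have "set_integrable lborel {a..b} (\<lambda>x. v x * u' x + u x * v' x)"
    by (intro set_integral_add set_integrable_continuous_mult abs_cont_on_continuous[OF u] abs_cont_on_continuous[OF v]
        abs_cont_on_integrable[OF u] abs_cont_on_integrable[OF v])
  then show ?thesis by (rule abs_cont_onI) (rule parts)
qed

lemma abs_cont_on_const: "abs_cont_on a b (\<lambda>_. c) (\<lambda>_. 0)"
  by (rule abs_cont_onI) (simp_all add: set_integrable_def set_lebesgue_integral_def)

lemma abs_cont_on_add:
  assumes "abs_cont_on a b f f'" "abs_cont_on a b g g'"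
  shows "abs_cont_on a b (\<lambda>x. f x + g x) (\<lambda>x. f' x + g' x)"
proof (rule abs_cont_onI)
  show "set_integrable lborel {a..b} (\<lambda>x. f' x + g' x)"
    by (intro set_integral_add assms[THEN abs_cont_on_integrable])
  fix x assume x: "a \<le> x" "x \<le> b"
  have "(LBINT t:{a..x}. f' t + g' t) = (LBINT t:{a..x}. f' t) + (LBINT t:{a..x}. g' t)"
    by (intro set_integral_add abs_cont_on_integrable[OF abs_cont_on_restrict[OF assms(1) x(2)]]
        abs_cont_on_integrable[OF abs_cont_on_restrict[OF assms(2) x(2)]])
  then show "f x + g x = f a + g a + (LBINT t:{a..x}. f' t + g' t)"
    using abs_cont_on_eq[OF assms(1) x] abs_cont_on_eq[OF assms(2) x] by simp
qed

lemma abs_cont_on_cmult: "abs_cont_on a b f f' \<Longrightarrow> abs_cont_on a b (\<lambda>x. c * f x) (\<lambda>x. c * f' x)"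
  by (rule abs_cont_on_cong[OF abs_cont_on_mult[OF abs_cont_on_const[of a b c]]]) auto

lemma abs_cont_on_power:
  assumes "abs_cont_on a b f f'"
  shows "abs_cont_on a b (\<lambda>x. f x ^ Suc n) (\<lambda>x. real (Suc n) * (f x ^ n * f' x))"
proof (induction n)
  case 0 show ?case using assms by simp
next
  case (Suc n)
  show ?case
    by (rule abs_cont_on_cong[OF abs_cont_on_mult[OF assms Suc]]) (auto simp: algebra_simps)
qed

text \<open>
  The derivative of an absolutely continuous \<open>f \<ge> 0\<close> vanishes almost everywhere on the zero set of
  \<open>f\<close>; the formulation with test functions \<open>P\<close> is the one needed, and it avoids differentiation at
  points. With \<open>g = 1 - f / M\<close>, which has values in \<open>[0, 1]\<close> and equals 1 exactly where \<open>f\<close> vanishes,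
  \<open>g\<^sup>n\<close> tends to the indicator of the zero set, while \<open>g\<^sup>n f'\<close> is the derivative of
  \<open>- M g\<^sup>n\<^sup>+\<^sup>1 / (n + 1)\<close>, which tends to 0 uniformly.
\<close>
lemma abs_cont_on_integral_zero_set:
  assumes ab: "a \<le> b" and f: "abs_cont_on a b f f'" and P: "abs_cont_on a b P P'"
    and nonneg: "\<And>x. x \<in> {a..b} \<Longrightarrow> 0 \<le> f x"
  shows "(LBINT x:{a..b}. (if f x = 0 then P x * f' x else 0)) = 0"
proof -
  obtain M where M: "0 < M" "\<And>x. x \<in> {a..b} \<Longrightarrow> f x \<le> M"
  proof -
    have "bounded (f ` {a..b})"
      by (intro compact_imp_bounded compact_continuous_image compact_Icc abs_cont_on_continuous[OF f])
    then obtain B where "0 < B" "\<forall>x\<in>{a..b}. \<bar>f x\<bar> \<le> B" by (auto simp: bounded_pos)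
    then show ?thesis by (intro that[of B]) fastforce+
  qed
  define g where "g = (\<lambda>x. 1 - f x / M)"
  have g01: "0 \<le> g x" "g x \<le> 1" if "x \<in> {a..b}" for x
    using M nonneg[OF that] M(2)[OF that] by (simp_all add: g_def field_simps)
  have g1: "g x = 1 \<longleftrightarrow> f x = 0" for x using M by (simp add: g_def)
  have gAC: "abs_cont_on a b g (\<lambda>x. - (1 / M) * f' x)"
    by (rule abs_cont_on_cong[OF abs_cont_on_add[OF abs_cont_on_const[of _ _ 1] abs_cont_on_cmult[OF f, of "- (1 / M)"]]])
      (simp_all add: g_def)
  have contP: "continuous_on {a..b} P" and contg: "continuous_on {a..b} g"
    using P gAC by (auto intro: abs_cont_on_continuous)
  have if': "set_integrable lborel {a..b} f'" and iP': "set_integrable lborel {a..b} P'"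
    by (rule abs_cont_on_integrable[OF f], rule abs_cont_on_integrable[OF P])
  have iPf: "set_integrable lborel {a..b} (\<lambda>x. P x * f' x)"
    by (rule set_integrable_continuous_mult[OF contP if'])
  define K where "K = \<bar>P b\<bar> + \<bar>P a\<bar> + (LBINT x:{a..b}. \<bar>P' x\<bar>)"
  define A where "A = (\<lambda>n. LBINT x:{a..b}. g x ^ n * (P x * f' x))"
  have A_bound: "\<bar>A n\<bar> \<le> M * K * (1 / real (Suc n))" for n
  proof -
    have gn: "continuous_on {a..b} (\<lambda>x. g x ^ k)" for k by (intro continuous_intros contg)
    have i1: "set_integrable lborel {a..b} (\<lambda>x. g x ^ Suc n * P' x)"
      by (rule set_integrable_continuous_mult[OF gn iP'])
    have i2: "set_integrable lborel {a..b} (\<lambda>x. g x ^ n * (P x * f' x))"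
      by (rule set_integrable_continuous_mult[OF gn iPf])
    have "abs_cont_on a b (\<lambda>x. P x * g x ^ Suc n)
      (\<lambda>x. g x ^ Suc n * P' x + - (real (Suc n) / M) * (g x ^ n * (P x * f' x)))"
      by (rule abs_cont_on_cong[OF abs_cont_on_mult[OF P abs_cont_on_power[OF gAC, of n]]])
        (auto simp: field_simps)
    from abs_cont_on_eq[OF this, of b] have "P b * g b ^ Suc n - P a * g a ^ Suc n
      = (LBINT x:{a..b}. g x ^ Suc n * P' x + - (real (Suc n) / M) * (g x ^ n * (P x * f' x)))"
      using ab by (simp del: power_Suc)
    also have "\<dots> = (LBINT x:{a..b}. g x ^ Suc n * P' x) + - (real (Suc n) / M) * A n"
    proof -
      have "(LBINT x:{a..b}. g x ^ Suc n * P' x + - (real (Suc n) / M) * (g x ^ n * (P x * f' x)))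
        = (LBINT x:{a..b}. g x ^ Suc n * P' x)
          + (LBINT x:{a..b}. - (real (Suc n) / M) * (g x ^ n * (P x * f' x)))"
        by (intro set_integral_add i1 set_integrable_mult_right i2)
      then show ?thesis by (simp only: A_def set_integral_mult_right)
    qed
    finally have eq: "real (Suc n) / M * A n = (LBINT x:{a..b}. g x ^ Suc n * P' x) - P b * g b ^ Suc n + P a * g a ^ Suc n"
      by simp
    have le1: "\<bar>P x * g x ^ Suc n\<bar> \<le> \<bar>P x\<bar>" if "x \<in> {a..b}" for x
      using g01[OF that] power_le_one[of "g x" "Suc n"]
      by (simp only: abs_mult) (simp add: mult_left_le power_abs abs_of_nonneg del: power_Suc)
    have "\<bar>LBINT x:{a..b}. g x ^ Suc n * P' x\<bar> \<le> (LBINT x:{a..b}. \<bar>g x ^ Suc n * P' x\<bar>)"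
      using set_integral_norm_bound[OF i1] by simp
    also have "\<dots> \<le> (LBINT x:{a..b}. \<bar>P' x\<bar>)"
    proof (rule set_integral_mono)
      show "\<bar>g x ^ Suc n * P' x\<bar> \<le> \<bar>P' x\<bar>" if "x \<in> {a..b}" for x
        using g01[OF that] power_le_one[of "g x" "Suc n"]
        by (simp only: abs_mult) (simp add: mult_right_le_one_le mult_left_le_one_le abs_of_nonneg del: power_Suc)
    qed (use i1 iP' in \<open>auto intro: set_integrable_abs\<close>)
    finally have "\<bar>real (Suc n) / M * A n\<bar> \<le> K"
      unfolding eq K_def using le1[of a] le1[of b] ab by (auto simp del: power_Suc)
    then have "real (Suc n) / M * \<bar>A n\<bar> \<le> K"
      using M by (simp add: abs_mult)
    then show ?thesis using M by (simp add: field_simps)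
  qed
  have A0: "A \<longlonglongrightarrow> 0"
  proof (rule Lim_null_comparison)
    show "eventually (\<lambda>n. norm (A n) \<le> M * K * (1 / real (Suc n))) sequentially"
      using A_bound by simp
    have "(\<lambda>n. M * K * (1 / real (Suc n))) \<longlonglongrightarrow> M * K * 0"
      by (intro tendsto_mult_left LIMSEQ_Suc lim_1_over_n)
    then show "(\<lambda>n. M * K * (1 / real (Suc n))) \<longlonglongrightarrow> 0" by simp
  qed
  have lim: "(\<lambda>n. indicator {a..b} x *\<^sub>R (g x ^ n * (P x * f' x)))
      \<longlonglongrightarrow> indicator {a..b} x *\<^sub>R (if f x = 0 then P x * f' x else 0)" for x
  proof -
    have "(\<lambda>n. g x ^ n * (P x * f' x)) \<longlonglongrightarrow> (if f x = 0 then P x * f' x else 0)" if "x \<in> {a..b}"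
    proof (cases "f x = 0")
      case False
      then have "\<bar>g x\<bar> < 1" using g01[OF that] g1[of x] by auto
      then have "(\<lambda>n. g x ^ n * (P x * f' x)) \<longlonglongrightarrow> 0 * (P x * f' x)"
        by (intro tendsto_mult_right LIMSEQ_power_zero) simp
      with False show ?thesis by simp
    qed (simp add: g1[THEN iffD2])
    then show "(\<lambda>n. indicator {a..b} x *\<^sub>R (g x ^ n * (P x * f' x)))
      \<longlonglongrightarrow> indicator {a..b} x *\<^sub>R (if f x = 0 then P x * f' x else 0)"
      by (cases "x \<in> {a..b}") auto
  qed
  have "A \<longlonglongrightarrow> (LBINT x:{a..b}. (if f x = 0 then P x * f' x else 0))"
    unfolding A_def set_lebesgue_integral_def
  proof (rule integral_dominated_convergence)
    show "AE x in lborel. (\<lambda>n. indicator {a..b} x *\<^sub>R (g x ^ n * (P x * f' x)))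
        \<longlonglongrightarrow> indicator {a..b} x *\<^sub>R (if f x = 0 then P x * f' x else 0)"
      using lim by (intro AE_I2)
    show meas: "(\<lambda>x. indicator {a..b} x *\<^sub>R (g x ^ n * (P x * f' x))) \<in> borel_measurable lborel" for n
      using set_integrable_continuous_mult[OF continuous_on_power[OF contg, of n] iPf]
      by (auto simp: set_integrable_def)
    show "integrable lborel (\<lambda>x. \<bar>indicator {a..b} x *\<^sub>R (P x * f' x)\<bar>)"
      using iPf by (simp add: set_integrable_def)
    show "AE x in lborel. norm (indicator {a..b} x *\<^sub>R (g x ^ n * (P x * f' x))) \<le> \<bar>indicator {a..b} x *\<^sub>R (P x * f' x)\<bar>" for n
    proof (rule AE_I2)
      fix x
      show "norm (indicator {a..b} x *\<^sub>R (g x ^ n * (P x * f' x))) \<le> \<bar>indicator {a..b} x *\<^sub>R (P x * f' x)\<bar>"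
      proof (cases "x \<in> {a..b}")
        case True
        have "\<bar>g x ^ n\<bar> \<le> 1" using g01[OF True] by (simp add: power_le_one)
        then have "\<bar>g x ^ n\<bar> * \<bar>P x * f' x\<bar> \<le> 1 * \<bar>P x * f' x\<bar>" by (intro mult_right_mono) auto
        then show ?thesis using True by (simp add: abs_mult)
      qed simp
    qed
    show "(\<lambda>x. indicator {a..b} x *\<^sub>R (if f x = 0 then P x * f' x else 0)) \<in> borel_measurable lborel"
      by (rule borel_measurable_LIMSEQ_metric[OF meas lim])
  qed
  with A0 show ?thesis by (rule LIMSEQ_unique[symmetric])
qed

section \<open>Monotone transport and the logarithmic Sobolev inequality\<close>
lemma primitive_of_positive:
  fixes f F :: "real \<Rightarrow> real"
  assumes ab: "a < b" and cont: "continuous_on {a..b} f" and pos: "\<forall>x\<in>{a..b}. 0 < f x"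
    and F_def: "F = (\<lambda>x. LBINT t:{a..x}. f t)"
  shows "continuous_on {a..b} F" "F a = 0" "0 < F b"
    and "\<And>x. a < x \<Longrightarrow> x < b \<Longrightarrow> (F has_real_derivative f x) (at x)"
    and "\<And>x y. a \<le> x \<Longrightarrow> x < y \<Longrightarrow> y \<le> b \<Longrightarrow> F x < F y"
proof -
  have F: "F x = integral {a..x} f" if "x \<le> b" for x
    unfolding F_def using that
    by (intro set_borel_integral_eq_integral(2) borel_integrable_atLeastAtMost' continuous_on_subset[OF cont]) auto
  have "continuous_on {a..b} (\<lambda>x. integral {a..x} f)"
    by (intro indefinite_integral_continuous_1 integrable_continuous_interval cont)
  then show contF: "continuous_on {a..b} F"
    by (rule continuous_on_eq) (simp add: F)
  show "F a = 0" using F[of a] ab by simp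
  show deriv: "(F has_real_derivative f x) (at x)" if "a < x" "x < b" for x
  proof -
    have "((\<lambda>x. integral {a..x} f) has_real_derivative f x) (at x within {a..b})"
      using that by (intro integral_has_real_derivative[OF cont]) auto
    then have "((\<lambda>x. integral {a..x} f) has_real_derivative f x) (at x)"
      using that by (simp add: at_within_Icc_at)
    then show ?thesis
      by (rule has_field_derivative_transform_within_open[where S="{a<..<b}"]) (use that F in auto)
  qed
  show mono: "F x < F y" if "a \<le> x" "x < y" "y \<le> b" for x y
  proof (rule DERIV_pos_imp_increasing_open[OF that(2)])
    show "\<exists>y. (F has_real_derivative y) (at z) \<and> 0 < y" if "x < z" "z < y" for z
      using deriv[of z] bspec[OF pos, of z] that \<open>a \<le> x\<close> \<open>y \<le> b\<close> by (intro exI[of _ "f z"]) auto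
    show "continuous_on {x..y} F" by (rule continuous_on_subset[OF contF]) (use that in auto)
  qed
  show "0 < F b" using mono[of a b] ab \<open>F a = 0\<close> by simp
qed

text \<open>
  On an interval the map that carries the density \<open>f\<close> to \<open>g\<close> is explicit: the inverse of the
  distribution function of \<open>g\<close> applied to that of \<open>f\<close>. It fixes both end points, so that
  integrations by parts below have no boundary terms.
\<close>
lemma monotone_transport:
  fixes f g :: "real \<Rightarrow> real"
  assumes ab: "a < b"
    and f: "continuous_on {a..b} f" "\<forall>x\<in>{a..b}. 0 < f x"
    and g: "continuous_on {a..b} g" "\<forall>x\<in>{a..b}. 0 < g x"
    and mass: "(LBINT x:{a..b}. f x) = (LBINT x:{a..b}. g x)"
  obtains T where "continuous_on {a..b} T" "T a = a" "T b = b"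
    "\<And>x. x \<in> {a..b} \<Longrightarrow> T x \<in> {a..b}"
    "\<And>x. a < x \<Longrightarrow> x < b \<Longrightarrow> (T has_real_derivative f x / g (T x)) (at x)"
proof -
  define F where "F = (\<lambda>x. LBINT t:{a..x}. f t)"
  define G where "G = (\<lambda>x. LBINT t:{a..x}. g t)"
  note F = primitive_of_positive[OF ab f(1) f(2) F_def]
  note G = primitive_of_positive[OF ab g(1) g(2) G_def]
  have Fb: "F b = G b" using mass by (simp add: F_def G_def)
  have injG: "inj_on G {a..b}"
  proof (rule linorder_inj_onI')
    show "G i \<noteq> G j" if "i \<in> {a..b}" "j \<in> {a..b}" "i < j" for i j
      using G(5)[of i j] that by simp
  qed
  have Fle: "0 \<le> F x" "F x \<le> F b" if "x \<in> {a..b}" for x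
    using F(5)[of a x] F(5)[of x b] F(2) that by (cases "x = a"; cases "x = b"; auto)+
  have onto: "y \<in> G ` {a..b}" if y: "0 \<le> y" "y \<le> G b" for y
  proof -
    obtain x where "a \<le> x" "x \<le> b" "G x = y"
      using IVT'[of G a y b] G(1,2) ab y by auto
    then show ?thesis by (intro image_eqI[of _ _ x]) auto
  qed
  have surj: "F x \<in> G ` {a..b}" if "x \<in> {a..b}" for x
    using Fle[OF that] Fb by (intro onto) auto
  define T where "T = (\<lambda>x. inv_into {a..b} G (F x))"
  have T: "T x \<in> {a..b}" "G (T x) = F x" if "x \<in> {a..b}" for x
    unfolding T_def by (rule inv_into_into[OF surj[OF that]], rule f_inv_into_f[OF surj[OF that]])
  have contT: "continuous_on {a..b} T"
    unfolding T_def
  proof (rule continuous_on_compose2[OF _ F(1)])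
    show "continuous_on (G ` {a..b}) (inv_into {a..b} G)"
      by (rule continuous_on_inv[OF G(1)]) (use injG in auto)
  qed (use surj in auto)
  have Ta: "T a = a" and Tb: "T b = b"
    using ab inj_onD[OF injG, of "T a" a] inj_onD[OF injG, of "T b" b] T[of a] T[of b] F(2) G(2) Fb by auto
  have T_in: "a < T x" "T x < b" if "a < x" "x < b" for x
  proof -
    have "G a < G (T x)" "G (T x) < G b"
      using T[of x] F(5)[of a x] F(5)[of x b] F(2) G(2) Fb that by auto
    then have "T x \<noteq> a" "T x \<noteq> b" by auto
    then show "a < T x" "T x < b" using T(1)[of x] that by auto
  qed
  have "(T has_real_derivative f x / g (T x)) (at x)" if x: "a < x" "x < b" for x
  proof -
    let ?I = "inv_into {a..b} G"
    have Gx: "G (?I y) = y" if "0 < y" "y < G b" for y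
      using that by (intro f_inv_into_f onto) auto
    have Fx: "0 < F x" "F x < G b" using F(5)[of a x] F(5)[of x b] F(2) Fb x by auto
    have cont: "continuous_on (G ` {a..b}) ?I"
      by (rule continuous_on_inv[OF G(1)]) (use injG in auto)
    have "{0<..<G b} \<subseteq> G ` {a..b}"
      using onto by auto
    then have "continuous_on {0<..<G b} ?I" by (rule continuous_on_subset[OF cont])
    then have "isCont ?I (F x)"
      using Fx by (simp add: continuous_on_eq_continuous_at)
    then have "(?I has_real_derivative inverse (g (?I (F x)))) (at (F x))"
      using G(4)[of "T x"] T_in[OF x] bspec[OF g(2), of "T x"] Gx Fx
      by (intro DERIV_inverse_function[of G _ _ _ 0 "G b"]) (auto simp: T_def)
    from DERIV_chain2[OF this F(4)[OF x]] show ?thesis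
      by (simp add: T_def divide_inverse mult.commute)
  qed
  then show ?thesis using contT Ta Tb T(1) by (intro that[of T]) auto
qed

text \<open>
  The integrand of the relative entropy \<open>\<integral> f ln (f / c)\<close>, made nonnegative by terms that integrate to
  0 if \<open>c\<close> is the mean of \<open>f\<close>. Being nonnegative, it can be compared pointwise when the reference
  measure changes, and Fatou's lemma applies to it.
\<close>
definition entropy_excess :: "real \<Rightarrow> real \<Rightarrow> real" where
  "entropy_excess c y = y * ln (y / c) - y + c"

lemma entropy_excess_nonneg: "0 \<le> entropy_excess c y" if "0 < c" "0 \<le> y"
proof (cases "y = 0")
  case False
  have "- ln (y / c) = ln (c / y)" using that False by (simp add: ln_div)
  also have "\<dots> \<le> c / y - 1" using that False by (intro ln_le_minus_one) simp
  finally have "y * (- ln (y / c)) \<le> y * (c / y - 1)" using that by (intro mult_left_mono) auto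
  also have "\<dots> = c - y" using False by (simp add: right_diff_distrib)
  finally show ?thesis by (simp add: entropy_excess_def)
qed (use that in \<open>simp add: entropy_excess_def\<close>)

text \<open>
  Let \<open>T\<close> carry \<open>f exp (- U) / c\<close> to \<open>exp (- U)\<close> and \<open>\<tau> = T - id\<close>. The change of variables says
  \<open>ln (f / c) = ln T' + U - U \<circ> T\<close>. Bounding \<open>ln T' \<le> T' - 1\<close> and \<open>U \<circ> T\<close> from below by convexity
  leaves \<open>f\<close> times the derivative of \<open>\<tau> exp (- U)\<close>, which is integrated by parts.
\<close>
lemma transport_entropy_bound:
  fixes f f' U U' :: "real \<Rightarrow> real"
  assumes ab: "a < b"
    and U: "\<And>x. (U has_real_derivative U' x) (at x)" "continuous_on UNIV U'"
    and convex: "\<And>x y. U x + U' x * (y - x) + K / 2 * (y - x)\<^sup>2 \<le> U y"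
    and f: "abs_cont_on a b f f'" "\<And>x. x \<in> {a..b} \<Longrightarrow> 0 < f x"
    and c: "(LBINT x:{a..b}. f x * exp (- U x)) = c * (LBINT x:{a..b}. exp (- U x))"
  obtains \<tau> P' where "continuous_on {a..b} \<tau>"
    "abs_cont_on a b (\<lambda>x. \<tau> x * exp (- U x)) P'"
    "(LBINT x:{a..b}. f x * ln (f x / c) * exp (- U x))
      \<le> - (LBINT x:{a..b}. \<tau> x * exp (- U x) * f' x)
        - K / 2 * (LBINT x:{a..b}. (\<tau> x)\<^sup>2 * f x * exp (- U x))"
proof -
  let ?w = "\<lambda>x. exp (- U x)"
  have contU: "continuous_on S U" for S
    using U(1) by (auto intro!: continuous_at_imp_continuous_on DERIV_isCont)
  have contU': "continuous_on S U'" for S using U(2) continuous_on_subset by blast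
  have contw: "continuous_on S ?w" for S by (intro continuous_intros contU)
  have contf: "continuous_on {a..b} f" by (rule abs_cont_on_continuous[OF f(1)])
  have int_pos: "0 < (LBINT x:{a..b}. g x)" if "continuous_on {a..b} g" "\<forall>x\<in>{a..b}. 0 < g x" for g :: "real \<Rightarrow> real"
    using primitive_of_positive(3)[OF ab that refl] by simp
  have "0 < (LBINT x:{a..b}. f x * ?w x)" "0 < (LBINT x:{a..b}. ?w x)"
    using f(2) by (auto intro!: int_pos continuous_intros contf contU)
  then have c0: "0 < c" unfolding c by (simp add: zero_less_mult_iff)
  have "(LBINT x:{a..b}. f x * ?w x / c) = (LBINT x:{a..b}. ?w x)"
    using c c0 by simp
  note mass = this
  have src: "continuous_on {a..b} (\<lambda>x. f x * ?w x / c)" "\<forall>x\<in>{a..b}. 0 < f x * ?w x / c"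
    using f(2) c0 by (auto intro!: continuous_intros contf contU)
  have tgt: "\<forall>x\<in>{a..b}. 0 < ?w x" by simp
  obtain T where T: "continuous_on {a..b} T" "T a = a" "T b = b"
    "\<And>x. x \<in> {a..b} \<Longrightarrow> T x \<in> {a..b}"
    "\<And>x. a < x \<Longrightarrow> x < b \<Longrightarrow> (T has_real_derivative f x * ?w x / c / ?w (T x)) (at x)"
    by (rule monotone_transport[OF ab src contw tgt mass]) (rule that, assumption+)
  define T' where "T' = (\<lambda>x. f x * ?w x / c / ?w (T x))"
  define \<tau> where "\<tau> = (\<lambda>x. T x - x)"
  define P' where "P' = (\<lambda>x. (T' x - 1) * ?w x - U' x * \<tau> x * ?w x)"
  have cont\<tau>: "continuous_on {a..b} \<tau>" unfolding \<tau>_def by (intro continuous_intros T(1))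
  have contUT: "continuous_on {a..b} (\<lambda>x. U (T x))"
    by (rule continuous_on_compose2[OF contU[of UNIV] T(1)]) simp
  have contT': "continuous_on {a..b} T'"
    unfolding T'_def using c0 by (intro continuous_intros contf contU contUT) auto
  have contP': "continuous_on {a..b} P'"
    unfolding P'_def by (intro continuous_intros contT' contU' contU cont\<tau>)
  have PAC: "abs_cont_on a b (\<lambda>x. \<tau> x * ?w x) P'"
  proof (rule abs_cont_on_of_C1[OF _ contP'])
    show "continuous_on {a..b} (\<lambda>x. \<tau> x * ?w x)" by (intro continuous_intros cont\<tau> contU)
    fix x assume x: "a < x" "x < b"
    have "(\<tau> has_real_derivative T' x - 1) (at x)"
      unfolding \<tau>_def using T(5)[OF x] by (auto intro!: derivative_eq_intros simp: T'_def)
    moreover have "(?w has_real_derivative ?w x * - U' x) (at x)"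
      using U(1)[of x] by (auto intro!: derivative_eq_intros)
    ultimately have "((\<lambda>x. \<tau> x * ?w x) has_real_derivative (T' x - 1) * ?w x + (?w x * - U' x) * \<tau> x) (at x)"
      by (rule DERIV_mult)
    then show "((\<lambda>x. \<tau> x * ?w x) has_real_derivative P' x) (at x)"
      by (rule DERIV_cong) (simp add: P'_def)
  qed
  have pointwise: "f x * ln (f x / c) * ?w x \<le> f x * P' x - K / 2 * ((\<tau> x)\<^sup>2 * f x * ?w x)"
    if x: "x \<in> {a..b}" for x
  proof -
    have T'pos: "0 < T' x" unfolding T'_def using f(2)[OF x] c0 by simp
    have "ln (T' x) = ln (f x / c * exp (U (T x) - U x))"
      by (simp add: T'_def exp_diff exp_minus field_simps)
    also have "\<dots> = ln (f x / c) + (U (T x) - U x)"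
      using f(2)[OF x] c0 by (subst ln_mult) auto
    finally have "ln (f x / c) = ln (T' x) + U x - U (T x)" by simp
    also have "\<dots> \<le> T' x - 1 - U' x * \<tau> x - K / 2 * (\<tau> x)\<^sup>2"
      using ln_le_minus_one[OF T'pos] convex[of x "T x"] by (simp add: \<tau>_def)
    finally have "f x * ?w x * ln (f x / c) \<le> f x * ?w x * (T' x - 1 - U' x * \<tau> x - K / 2 * (\<tau> x)\<^sup>2)"
      using f(2)[OF x] by (intro mult_left_mono) auto
    then show ?thesis by (simp add: P'_def algebra_simps)
  qed
  have i1: "set_integrable lborel {a..b} (\<lambda>x. f x * ln (f x / c) * ?w x)"
    using f(2) c0 by (intro borel_integrable_atLeastAtMost' continuous_intros contf contU) fastforce+
  have i2: "set_integrable lborel {a..b} (\<lambda>x. f x * P' x)"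
    by (intro borel_integrable_atLeastAtMost' continuous_intros contf contP')
  have i3: "set_integrable lborel {a..b} (\<lambda>x. (\<tau> x)\<^sup>2 * f x * ?w x)"
    by (intro borel_integrable_atLeastAtMost' continuous_intros contf contU cont\<tau>)
  have i4: "set_integrable lborel {a..b} (\<lambda>x. \<tau> x * ?w x * f' x)"
    by (intro set_integrable_continuous_mult abs_cont_on_integrable[OF f(1)] continuous_intros contU cont\<tau>)
  have "(LBINT x:{a..b}. f x * ln (f x / c) * ?w x)
    \<le> (LBINT x:{a..b}. f x * P' x - K / 2 * ((\<tau> x)\<^sup>2 * f x * ?w x))"
    by (intro set_integral_mono i1 pointwise set_integral_diff(1) i2 set_integrable_mult_right i3)
  also have "\<dots> = (LBINT x:{a..b}. f x * P' x) - (LBINT x:{a..b}. K / 2 * ((\<tau> x)\<^sup>2 * f x * ?w x))"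
    by (intro set_integral_diff(2) i2 set_integrable_mult_right i3)
  also have "(LBINT x:{a..b}. K / 2 * ((\<tau> x)\<^sup>2 * f x * ?w x)) = K / 2 * (LBINT x:{a..b}. (\<tau> x)\<^sup>2 * f x * ?w x)"
    by (rule set_integral_mult_right)
  also have "(LBINT x:{a..b}. f x * P' x) = - (LBINT x:{a..b}. \<tau> x * ?w x * f' x)"
  proof -
    have "0 = (LBINT x:{a..b}. f x * P' x + \<tau> x * ?w x * f' x)"
      using abs_cont_on_eq[OF abs_cont_on_mult[OF PAC f(1)], of b] ab T(2,3) by (simp add: \<tau>_def)
    also have "\<dots> = (LBINT x:{a..b}. f x * P' x) + (LBINT x:{a..b}. \<tau> x * ?w x * f' x)"
      by (intro set_integral_add i2 i4)
    finally show ?thesis by simp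
  qed
  finally show ?thesis by (intro that[OF cont\<tau> PAC]) simp
qed

text \<open>
  Complete the square in \<open>\<tau>\<close> in the transport bound. The transport needs a positive density, hence the
  shift of \<open>f\<close> by \<open>\<delta>\<close>; on the zero set of \<open>f\<close>, where \<open>f'\<^sup>2 / f\<close> is 0 by convention and gives no
  control, the term with \<open>f'\<close> integrates to 0.
\<close>
lemma log_sobolev_interval:
  fixes f f' U U' :: "real \<Rightarrow> real"
  assumes ab: "a < b" and K: "0 < K" and \<delta>: "0 < \<delta>"
    and U: "\<And>x. (U has_real_derivative U' x) (at x)" "continuous_on UNIV U'"
    and convex: "\<And>x y. U x + U' x * (y - x) + K / 2 * (y - x)\<^sup>2 \<le> U y"
    and f: "abs_cont_on a b f f'" "\<And>x. x \<in> {a..b} \<Longrightarrow> 0 \<le> f x"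
    and c: "(LBINT x:{a..b}. f x * exp (- U x)) = c * (LBINT x:{a..b}. exp (- U x))"
    and J: "set_integrable lborel {a..b} (\<lambda>x. (f' x)\<^sup>2 / f x * exp (- U x))"
  shows "(LBINT x:{a..b}. entropy_excess (c + \<delta>) (f x + \<delta>) * exp (- U x))
    \<le> 1 / (2 * K) * (LBINT x:{a..b}. (f' x)\<^sup>2 / f x * exp (- U x))"
proof -
  let ?w = "\<lambda>x. exp (- U x)"
  have contU: "continuous_on S U" for S
    using U(1) by (auto intro!: continuous_at_imp_continuous_on DERIV_isCont)
  have contf: "continuous_on {a..b} f" by (rule abs_cont_on_continuous[OF f(1)])
  have iw: "set_integrable lborel {a..b} ?w" and ifw: "set_integrable lborel {a..b} (\<lambda>x. f x * ?w x)"
    by (intro borel_integrable_atLeastAtMost' continuous_intros contf contU)+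
  have "0 < (LBINT x:{a..b}. ?w x)"
    by (rule primitive_of_positive(3)[OF ab _ _ refl]) (intro continuous_intros contU, simp)
  moreover have "0 \<le> (LBINT x:{a..b}. f x * ?w x)"
    unfolding set_lebesgue_integral_def using f(2) by (intro integral_nonneg_AE AE_I2) (auto simp: indicator_def)
  ultimately have c0: "0 \<le> c" unfolding c by (simp add: zero_le_mult_iff)
  define g where "g = (\<lambda>x. f x + \<delta>)"
  have gpos: "0 < g x" if "x \<in> {a..b}" for x using f(2)[OF that] \<delta> by (simp add: g_def)
  have gAC: "abs_cont_on a b g f'"
    by (rule abs_cont_on_cong[OF abs_cont_on_add[OF f(1) abs_cont_on_const[of _ _ \<delta>]]]) (simp_all add: g_def)
  have contg: "continuous_on {a..b} g" by (rule abs_cont_on_continuous[OF gAC])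
  have igw: "set_integrable lborel {a..b} (\<lambda>x. g x * ?w x)"
    by (intro borel_integrable_atLeastAtMost' continuous_intros contg contU)
  have cg: "(LBINT x:{a..b}. g x * ?w x) = (c + \<delta>) * (LBINT x:{a..b}. ?w x)"
  proof -
    have "(LBINT x:{a..b}. g x * ?w x) = (LBINT x:{a..b}. f x * ?w x + \<delta> * ?w x)"
      by (simp add: g_def distrib_right)
    also have "\<dots> = (LBINT x:{a..b}. f x * ?w x) + (LBINT x:{a..b}. \<delta> * ?w x)"
      by (intro set_integral_add ifw set_integrable_mult_right iw)
    finally show ?thesis by (simp add: c distrib_right)
  qed
  obtain \<tau> P' where \<tau>: "continuous_on {a..b} \<tau>" and PAC: "abs_cont_on a b (\<lambda>x. \<tau> x * ?w x) P'"
    and bound: "(LBINT x:{a..b}. g x * ln (g x / (c + \<delta>)) * ?w x)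
      \<le> - (LBINT x:{a..b}. \<tau> x * ?w x * f' x) - K / 2 * (LBINT x:{a..b}. (\<tau> x)\<^sup>2 * g x * ?w x)"
    using transport_entropy_bound[OF ab U convex gAC gpos cg] by blast
  have i1: "set_integrable lborel {a..b} (\<lambda>x. g x * ln (g x / (c + \<delta>)) * ?w x)"
    using gpos c0 \<delta> by (intro borel_integrable_atLeastAtMost' continuous_intros contg contU) fastforce+
  have i2: "set_integrable lborel {a..b} (\<lambda>x. \<tau> x * ?w x * f' x)"
    by (intro set_integrable_continuous_mult abs_cont_on_integrable[OF f(1)] continuous_intros contU \<tau>)
  have i3: "set_integrable lborel {a..b} (\<lambda>x. (\<tau> x)\<^sup>2 * g x * ?w x)"
    by (intro borel_integrable_atLeastAtMost' continuous_intros contg contU \<tau>)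
  have i4: "set_integrable lborel {a..b} (\<lambda>x. if f x = 0 then \<tau> x * ?w x * f' x else 0)"
  proof -
    have m: "(\<lambda>x. indicator {a..b} x *\<^sub>R f x) \<in> borel_measurable lborel"
      using borel_integrable_atLeastAtMost'[OF contf] by (simp add: set_integrable_def)
    have z: "indicator {a..b} x *\<^sub>R (if f x = 0 then \<tau> x * ?w x * f' x else 0)
      = (if indicator {a..b} x *\<^sub>R f x = 0 then indicator {a..b} x *\<^sub>R (\<tau> x * ?w x * f' x) else 0)" for x
      by (auto simp: indicator_def)
    show ?thesis unfolding set_integrable_def
    proof (rule Bochner_Integration.integrable_bound)
      show "integrable lborel (\<lambda>x. indicator {a..b} x *\<^sub>R (\<tau> x * ?w x * f' x))" using i2 by (simp add: set_integrable_def)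
      show "(\<lambda>x. indicator {a..b} x *\<^sub>R (if f x = 0 then \<tau> x * ?w x * f' x else 0)) \<in> borel_measurable lborel"
      proof -
        define F where "F = (\<lambda>x. indicator {a..b} x *\<^sub>R f x)"
        define H where "H = (\<lambda>x. indicator {a..b} x *\<^sub>R (\<tau> x * ?w x * f' x))"
        have [measurable]: "F \<in> borel_measurable borel" "H \<in> borel_measurable borel"
          using m i2 by (simp_all add: F_def H_def set_integrable_def)
        have "(\<lambda>x. if F x = 0 then H x else 0) \<in> borel_measurable lborel" by measurable
        then show ?thesis unfolding z F_def H_def .
      qed
      show "AE x in lborel. norm (indicator {a..b} x *\<^sub>R (if f x = 0 then \<tau> x * ?w x * f' x else 0))
        \<le> norm (indicator {a..b} x *\<^sub>R (\<tau> x * ?w x * f' x))"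
        by (rule AE_I2) (simp only: norm_scaleR, rule mult_left_mono, simp_all)
    qed
  qed
  have zero: "(LBINT x:{a..b}. if f x = 0 then \<tau> x * ?w x * f' x else 0) = 0"
    using abs_cont_on_integral_zero_set[OF _ f(1) PAC f(2)] ab by simp
  have pointwise: "(if f x = 0 then \<tau> x * ?w x * f' x else 0) - \<tau> x * ?w x * f' x
      - K / 2 * ((\<tau> x)\<^sup>2 * g x * ?w x) \<le> 1 / (2 * K) * ((f' x)\<^sup>2 / f x * ?w x)"
    if x: "x \<in> {a..b}" for x
  proof (cases "f x = 0")
    case True
    then show ?thesis using K \<delta> by (simp add: g_def)
  next
    case False
    then have f0: "0 < f x" using f(2)[OF x] by simp
    have "0 \<le> (K * \<tau> x * f x + f' x)\<^sup>2 / (2 * K * f x)" using K f0 by simp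
    also have "\<dots> = K / 2 * ((\<tau> x)\<^sup>2 * f x) + \<tau> x * f' x + 1 / (2 * K) * ((f' x)\<^sup>2 / f x)"
      using K f0 by (simp add: field_simps power2_eq_square)
    also have "\<dots> \<le> K / 2 * ((\<tau> x)\<^sup>2 * g x) + \<tau> x * f' x + 1 / (2 * K) * ((f' x)\<^sup>2 / f x)"
      using K \<delta> by (simp add: g_def mult_left_mono)
    finally have "0 \<le> (K / 2 * ((\<tau> x)\<^sup>2 * g x) + \<tau> x * f' x + 1 / (2 * K) * ((f' x)\<^sup>2 / f x)) * ?w x"
      by simp
    then show ?thesis using False by (simp add: algebra_simps)
  qed
  have "(LBINT x:{a..b}. entropy_excess (c + \<delta>) (f x + \<delta>) * ?w x)
    = (LBINT x:{a..b}. g x * ln (g x / (c + \<delta>)) * ?w x - g x * ?w x + (c + \<delta>) * ?w x)"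
    by (simp add: entropy_excess_def g_def algebra_simps)
  also have "\<dots> = (LBINT x:{a..b}. g x * ln (g x / (c + \<delta>)) * ?w x) - (LBINT x:{a..b}. g x * ?w x)
      + (LBINT x:{a..b}. (c + \<delta>) * ?w x)"
    by (subst set_integral_add(2), (intro set_integral_diff(1) i1 igw set_integrable_mult_right iw)+)
      (subst set_integral_diff(2), (intro i1 igw refl)+)
  also have "\<dots> = (LBINT x:{a..b}. g x * ln (g x / (c + \<delta>)) * ?w x)"
    by (simp add: cg)
  also have "\<dots> \<le> (LBINT x:{a..b}. if f x = 0 then \<tau> x * ?w x * f' x else 0)
      - (LBINT x:{a..b}. \<tau> x * ?w x * f' x) - (LBINT x:{a..b}. K / 2 * ((\<tau> x)\<^sup>2 * g x * ?w x))"
    using bound by (simp add: zero)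
  also have "\<dots> = (LBINT x:{a..b}. (if f x = 0 then \<tau> x * ?w x * f' x else 0)
      - \<tau> x * ?w x * f' x - K / 2 * ((\<tau> x)\<^sup>2 * g x * ?w x))"
    by (subst set_integral_diff(2), (intro set_integral_diff(1) i2 i4 set_integrable_mult_right i3)+)
      (subst set_integral_diff(2), (intro i2 i4 refl)+)
  also have "\<dots> \<le> (LBINT x:{a..b}. 1 / (2 * K) * ((f' x)\<^sup>2 / f x * ?w x))"
    by (intro set_integral_mono pointwise set_integral_diff(1) i2 i4 set_integrable_mult_right i3 J)
  finally show ?thesis by (simp only: set_integral_mult_right)
qed

lemma integral_expanding_intervals:
  assumes "integrable lborel (g :: real \<Rightarrow> real)"
  shows "(\<lambda>n. LBINT x:{- real (Suc n)..real (Suc n)}. g x) \<longlonglongrightarrow> (LBINT x. g x)"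
  unfolding set_lebesgue_integral_def
proof (rule integral_dominated_convergence)
  show "integrable lborel (\<lambda>x. \<bar>g x\<bar>)" using assms by simp
  show "AE x in lborel. (\<lambda>n. indicator {- real (Suc n)..real (Suc n)} x *\<^sub>R g x) \<longlonglongrightarrow> g x"
  proof (rule AE_I2)
    fix x :: real
    obtain N where "\<bar>x\<bar> \<le> real N" using real_arch_simple by blast
    then have "eventually (\<lambda>n. indicator {- real (Suc n)..real (Suc n)} x *\<^sub>R g x = g x) sequentially"
      by (intro eventually_sequentiallyI[of N]) (auto simp: indicator_def)
    then show "(\<lambda>n. indicator {- real (Suc n)..real (Suc n)} x *\<^sub>R g x) \<longlonglongrightarrow> g x"
      by (rule tendsto_eventually)
  qed
qed (use assms in \<open>auto simp: indicator_def\<close>)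

lemma entropy_excess_tendsto:
  assumes y: "y \<longlonglongrightarrow> y0" "\<And>n. y n = y0 + 1 / real (Suc n)" "0 \<le> y0" and d: "d \<longlonglongrightarrow> d0" "0 < d0" "\<And>n. 0 < d n"
  shows "(\<lambda>n. entropy_excess (d n) (y n)) \<longlonglongrightarrow> entropy_excess d0 y0"
proof (cases "y0 = 0")
  case False
  then have "0 < y0 / d0" using y d by simp
  then show ?thesis unfolding entropy_excess_def using d(2) by (intro tendsto_intros y(1) d(1)) auto
next
  case True
  have 1: "(\<lambda>n. 1 / real (Suc n) * ln (1 / real (Suc n))) \<longlonglongrightarrow> 0" by real_asymp
  have 2: "(\<lambda>n. 1 / real (Suc n) * ln (d n)) \<longlonglongrightarrow> 0 * ln d0"
    using d by (intro tendsto_mult LIMSEQ_Suc[OF lim_1_over_n] tendsto_ln) auto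
  have "(\<lambda>n. 1 / real (Suc n) * ln (1 / real (Suc n)) - 1 / real (Suc n) * ln (d n) - y n + d n) \<longlonglongrightarrow> 0 - 0 * ln d0 - y0 + d0"
    by (intro tendsto_add tendsto_diff 1 2 y(1) d(1))
  moreover have "1 / real (Suc n) * ln (1 / real (Suc n)) - 1 / real (Suc n) * ln (d n) - y n + d n = entropy_excess (d n) (y n)" for n
  proof -
    have "y n = 1 / real (Suc n)" using y(2) True by simp
    then have "ln (y n / d n) = ln (1 / real (Suc n)) - ln (d n)"
      using d(3)[of n] by (simp only:) (subst ln_div, auto)
    then have "entropy_excess (d n) (y n) = y n * (ln (1 / real (Suc n)) - ln (d n)) - y n + d n"
      by (simp only: entropy_excess_def)
    then show ?thesis by (simp only: \<open>y n = 1 / real (Suc n)\<close> right_diff_distrib)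
  qed
  ultimately show ?thesis using True by (simp add: entropy_excess_def)
qed

text \<open>
  Exhaust the line by intervals and let \<open>\<delta>\<close> tend to 0 at the same time. The constant of the interval
  inequality does not depend on the interval, and Fatou's lemma suffices as the integrands are
  nonnegative.
\<close>
lemma log_sobolev_uniformly_convex:
  fixes f f' U U' :: "real \<Rightarrow> real"
  assumes K: "0 < K"
    and U: "\<And>x. (U has_real_derivative U' x) (at x)" "continuous_on UNIV U'"
    and convex: "\<And>x y. U x + U' x * (y - x) + K / 2 * (y - x)\<^sup>2 \<le> U y"
    and f: "\<And>a b. abs_cont_on a b f f'" "\<And>x. 0 \<le> f x"
    and w: "integrable lborel (\<lambda>x. exp (- U x))" and fw: "integrable lborel (\<lambda>x. f x * exp (- U x))"
    and mass: "0 < (LBINT x. f x * exp (- U x))"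
    and J: "integrable lborel (\<lambda>x. (f' x)\<^sup>2 / f x * exp (- U x))"
  defines "c \<equiv> (LBINT x. f x * exp (- U x)) / (LBINT x. exp (- U x))"
  shows "0 < c" and "(\<integral>\<^sup>+x. ennreal (entropy_excess c (f x) * exp (- U x)) \<partial>lborel)
    \<le> ennreal (1 / (2 * K) * (LBINT x. (f' x)\<^sup>2 / f x * exp (- U x)))"
proof -
  let ?w = "\<lambda>x. exp (- U x)"
  let ?A = "\<lambda>n. {- real (Suc n)..real (Suc n)}"
  have contU: "continuous_on S U" for S
    using U(1) by (auto intro!: continuous_at_imp_continuous_on DERIV_isCont)
  have contf: "continuous_on {a..b} f" for a b by (rule abs_cont_on_continuous[OF f(1)])
  have wpos: "0 < (LBINT x. ?w x)" by (rule integral_pos_of_pos[OF w]) simp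
  show c: "0 < c" unfolding c_def using wpos mass by simp
  have mU [measurable]: "U \<in> borel_measurable borel" by (rule borel_measurable_continuous_onI[OF contU])
  have "continuous_on UNIV f"
  proof (rule continuous_at_imp_continuous_on, rule ballI)
    fix x show "isCont f x"
      using contf[of "x - 1" "x + 1"] by (auto intro: continuous_on_interior simp: interior_atLeastAtMost_real)
  qed
  then have mf [measurable]: "f \<in> borel_measurable borel" by (rule borel_measurable_continuous_onI)
  define W where "W = (\<lambda>n. LBINT x:?A n. ?w x)"
  define d where "d = (\<lambda>n. (LBINT x:?A n. f x * ?w x) / W n)"
  define \<delta> where "\<delta> = (\<lambda>n. 1 / real (Suc n))"
  have \<delta>: "0 < \<delta> n" for n by (simp add: \<delta>_def)
  have Wpos: "0 < W n" for n
    unfolding W_def by (rule primitive_of_positive(3)[OF _ _ _ refl]) (auto intro!: continuous_intros contU)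
  have d0: "0 \<le> d n" for n
    unfolding d_def set_lebesgue_integral_def using Wpos[of n] f(2)
    by (intro divide_nonneg_pos integral_nonneg_AE AE_I2) auto
  have dlim: "d \<longlonglongrightarrow> c"
    unfolding d_def W_def c_def using wpos
    by (intro tendsto_divide integral_expanding_intervals w fw) auto
  have \<delta>lim: "\<delta> \<longlonglongrightarrow> 0" unfolding \<delta>_def by (intro LIMSEQ_Suc lim_1_over_n)
  \<comment> \<open>\<open>d n\<close> is the mean of \<open>f\<close> over the \<open>n\<close>-th interval\<close>
  define u where "u = (\<lambda>n x. indicator (?A n) x *\<^sub>R (entropy_excess (d n + \<delta> n) (f x + \<delta> n) * ?w x))"
  have u_nonneg: "0 \<le> u n x" for n x
    unfolding u_def using d0[of n] \<delta>[of n] f(2)[of x]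
    by (intro scaleR_nonneg_nonneg mult_nonneg_nonneg entropy_excess_nonneg) auto
  have u_int: "integrable lborel (u n)" for n
  proof -
    have "set_integrable lborel (?A n) (\<lambda>x. entropy_excess (d n + \<delta> n) (f x + \<delta> n) * ?w x)"
      unfolding entropy_excess_def
    proof (intro borel_integrable_atLeastAtMost' continuous_intros contf contU ballI)
      fix x show "(f x + \<delta> n) / (d n + \<delta> n) \<noteq> 0" "d n + \<delta> n \<noteq> 0"
        using d0[of n] \<delta>[of n] f(2)[of x] by auto
    qed
    then show ?thesis by (simp add: set_integrable_def u_def)
  qed
  have u_le: "(\<integral>\<^sup>+x. ennreal (u n x) \<partial>lborel) \<le> ennreal (1 / (2 * K) * (LBINT x. (f' x)\<^sup>2 / f x * ?w x))" for n
  proof -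
    have J': "set_integrable lborel (?A n) (\<lambda>x. (f' x)\<^sup>2 / f x * ?w x)"
      unfolding set_integrable_def using J by (rule integrable_mult_indicator[rotated]) simp
    have "(LBINT x. u n x) \<le> 1 / (2 * K) * (LBINT x:?A n. (f' x)\<^sup>2 / f x * ?w x)"
      unfolding u_def set_lebesgue_integral_def[symmetric]
    proof (rule log_sobolev_interval[OF _ K \<delta> U convex f(1) _ _ J'])
      show "(LBINT x:?A n. f x * ?w x) = d n * (LBINT x:?A n. ?w x)"
        using Wpos[of n] by (simp add: d_def W_def)
    qed (use f(2) in auto)
    also have "\<dots> \<le> 1 / (2 * K) * (LBINT x. (f' x)\<^sup>2 / f x * ?w x)"
    proof (rule mult_left_mono)
      show "(LBINT x:?A n. (f' x)\<^sup>2 / f x * ?w x) \<le> (LBINT x. (f' x)\<^sup>2 / f x * ?w x)"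
        unfolding set_lebesgue_integral_def
        using J J' f(2) by (intro integral_mono) (auto simp: set_integrable_def indicator_def)
    qed (use K in simp)
    finally show ?thesis
      by (subst nn_integral_eq_integral[OF u_int]) (auto simp: u_nonneg intro: ennreal_leI)
  qed
  have lim: "(\<lambda>n. ennreal (u n x)) \<longlonglongrightarrow> ennreal (entropy_excess c (f x) * ?w x)" for x
  proof (rule tendsto_ennrealI)
    obtain N where N: "\<bar>x\<bar> \<le> real N" using real_arch_simple by blast
    have ev: "eventually (\<lambda>n. entropy_excess (d n + \<delta> n) (f x + \<delta> n) * ?w x = u n x) sequentially"
      using N by (intro eventually_sequentiallyI[of N]) (auto simp: u_def indicator_def)
    have "(\<lambda>n. entropy_excess (d n + \<delta> n) (f x + \<delta> n)) \<longlonglongrightarrow> entropy_excess c (f x)"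
    proof (rule entropy_excess_tendsto)
      show "(\<lambda>n. f x + \<delta> n) \<longlonglongrightarrow> f x" using tendsto_add[OF tendsto_const \<delta>lim, of "f x"] by simp
      show "(\<lambda>n. d n + \<delta> n) \<longlonglongrightarrow> c" using tendsto_add[OF dlim \<delta>lim] by simp
      show "0 < d n + \<delta> n" for n using d0[of n] \<delta>[of n] by simp
    qed (use f(2) c in \<open>auto simp: \<delta>_def\<close>)
    then have "(\<lambda>n. entropy_excess (d n + \<delta> n) (f x + \<delta> n) * ?w x) \<longlonglongrightarrow> entropy_excess c (f x) * ?w x"
      by (rule tendsto_mult_right)
    then show "(\<lambda>n. u n x) \<longlonglongrightarrow> entropy_excess c (f x) * ?w x"
      by (rule Lim_transform_eventually[OF _ ev])
  qed
  have "(\<integral>\<^sup>+x. ennreal (entropy_excess c (f x) * ?w x) \<partial>lborel) = (\<integral>\<^sup>+x. liminf (\<lambda>n. ennreal (u n x)) \<partial>lborel)"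
    by (intro nn_integral_cong lim_imp_Liminf[symmetric] lim) simp
  also have "\<dots> \<le> liminf (\<lambda>n. \<integral>\<^sup>+x. ennreal (u n x) \<partial>lborel)"
    using u_int by (intro nn_integral_liminf) auto
  also have "\<dots> \<le> limsup (\<lambda>n. \<integral>\<^sup>+x. ennreal (u n x) \<partial>lborel)"
    by (intro Liminf_le_Limsup) simp
  also have "\<dots> \<le> ennreal (1 / (2 * K) * (LBINT x. (f' x)\<^sup>2 / f x * ?w x))"
    by (intro Limsup_bounded always_eventually allI u_le)
  finally show "(\<integral>\<^sup>+x. ennreal (entropy_excess c (f x) * ?w x) \<partial>lborel)
    \<le> ennreal (1 / (2 * K) * (LBINT x. (f' x)\<^sup>2 / f x * ?w x))" .
qed

lemma double_well_correction_deriv: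
  "((\<lambda>x::real. x ^ 4 / 4 - x\<^sup>2 / 2 - (32 / 27) / (1 + x\<^sup>2)) has_real_derivative
    z ^ 3 - z + (64 / 27) * z / (1 + z\<^sup>2)\<^sup>2) (at z)"
proof -
  have pos: "1 + z\<^sup>2 \<noteq> 0" using zero_le_power2[of z] by linarith
  have "((\<lambda>x. inverse (1 + x\<^sup>2)) has_real_derivative - (inverse (1 + z\<^sup>2) * (2 * z) * inverse (1 + z\<^sup>2))) (at z)"
    using pos by (auto intro!: derivative_eq_intros)
  from DERIV_cmult[OF this, of "32 / 27"]
  have corr: "((\<lambda>x. 32 / 27 * inverse (1 + x\<^sup>2)) has_real_derivative
      32 / 27 * - (inverse (1 + z\<^sup>2) * (2 * z) * inverse (1 + z\<^sup>2))) (at z)" .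
  have "((\<lambda>x. x ^ 4 / 4 - x\<^sup>2 / 2) has_real_derivative z ^ 3 - z) (at z)"
    by (auto intro!: derivative_eq_intros)
  note diff = DERIV_diff[OF this corr]
  have val: "z ^ 3 - z - 32 / 27 * - (inverse (1 + z\<^sup>2) * (2 * z) * inverse (1 + z\<^sup>2))
    = z ^ 3 - z + (64 / 27) * z / (1 + z\<^sup>2)\<^sup>2"
  proof -
    have "(64 / 27) * z / (1 + z\<^sup>2)\<^sup>2 = (64 / 27) * z * (inverse (1 + z\<^sup>2))\<^sup>2"
      by (simp only: divide_inverse power_inverse)
    then show ?thesis by (simp add: power2_eq_square)
  qed
  show ?thesis using diff unfolding val by (simp only: divide_inverse)
qed

text \<open>
  The constant \<open>32/27\<close> makes the double well convex: the second derivative of the sum factorises as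
  \<open>(3 x\<^sup>2 - 1) (1 - (64/27) / (1 + x\<^sup>2)\<^sup>3)\<close>, and both factors change sign at \<open>x\<^sup>2 = 1/3\<close>.
\<close>
lemma double_well_correction_above_tangent:
  fixes x y :: real
  defines "Q \<equiv> \<lambda>x::real. x ^ 4 / 4 - x\<^sup>2 / 2 - (32 / 27) / (1 + x\<^sup>2)"
  shows "Q x + (x ^ 3 - x + (64 / 27) * x / (1 + x\<^sup>2)\<^sup>2) * (y - x) \<le> Q y"
proof -
  let ?Q' = "\<lambda>x::real. x ^ 3 - x + (64 / 27) * x / (1 + x\<^sup>2)\<^sup>2"
  have pos: "1 + z\<^sup>2 \<noteq> 0" for z :: real using zero_le_power2[of z] by linarith
  have d1: "(Q has_real_derivative ?Q' z) (at z)" for z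
    unfolding Q_def by (rule double_well_correction_deriv)
  have d2: "(?Q' has_real_derivative (3 * z\<^sup>2 - 1) * (1 - (64 / 27) / (1 + z\<^sup>2) ^ 3)) (at z)" for z
  proof -
    define i where "i = inverse (1 + z\<^sup>2)"
    have i: "i\<^sup>2 = (1 + z\<^sup>2) * i ^ 3"
      using pos[of z] by (simp add: i_def power2_eq_square power3_eq_cube)
    have "((\<lambda>x. inverse (1 + x\<^sup>2)) has_real_derivative - (i * (2 * z) * i)) (at z)"
      unfolding i_def using pos[of z] by (auto intro!: derivative_eq_intros)
    then have inv: "((\<lambda>x. x * (inverse (1 + x\<^sup>2))\<^sup>2) has_real_derivative i\<^sup>2 - 4 * z\<^sup>2 * i ^ 3) (at z)"
      using pos[of z] by (auto intro!: derivative_eq_intros simp: i_def power2_eq_square power3_eq_cube)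
    have "((\<lambda>x. x ^ 3 - x) has_real_derivative 3 * z\<^sup>2 - 1) (at z)"
      by (auto intro!: derivative_eq_intros)
    from DERIV_add[OF this DERIV_cmult[OF inv, of "64 / 27"]]
    have "(?Q' has_real_derivative 3 * z\<^sup>2 - 1 + 64 / 27 * (i\<^sup>2 - 4 * z\<^sup>2 * i ^ 3)) (at z)"
      by (simp only: divide_inverse power_inverse mult.assoc)
    moreover have "3 * z\<^sup>2 - 1 + 64 / 27 * (i\<^sup>2 - 4 * z\<^sup>2 * i ^ 3) = (3 * z\<^sup>2 - 1) * (1 - (64 / 27) * i ^ 3)"
    proof -
      have "3 * A - 1 + k * ((1 + A) * j - 4 * A * j) = (3 * A - 1) * (1 - k * j)" for A j k :: real
        by (simp add: algebra_simps)
      then show ?thesis unfolding i .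
    qed
    ultimately show ?thesis by (simp only: i_def divide_inverse power_inverse)
  qed
  have d2_nonneg: "0 \<le> (3 * z\<^sup>2 - 1) * (1 - (64 / 27) / (1 + z\<^sup>2) ^ 3)" for z :: real
  proof (cases "1 / 3 \<le> z\<^sup>2")
    case True
    then have "(4 / 3) ^ 3 \<le> (1 + z\<^sup>2) ^ 3" by (intro power_mono) auto
    then show ?thesis using True by (intro mult_nonneg_nonneg) (auto simp: divide_le_eq power3_eq_cube)
  next
    case False
    then have "(1 + z\<^sup>2) ^ 3 \<le> (4 / 3) ^ 3" by (intro power_mono) auto
    moreover have "0 < (1 + z\<^sup>2) ^ 3" using zero_le_power2[of z] by (intro zero_less_power) linarith
    ultimately have "1 \<le> (64 / 27) / (1 + z\<^sup>2) ^ 3" by (simp add: le_divide_eq power3_eq_cube)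
    then show ?thesis using False by (intro mult_nonpos_nonpos) auto
  qed
  have "convex_on UNIV Q"
    by (rule f''_ge0_imp_convex[OF _ d1 d2]) (use d2_nonneg in auto)
  then have "?Q' x * (y - x) \<le> Q y - Q x"
    by (rule convex_on_imp_above_tangent) (use d1 in auto)
  then show ?thesis by simp
qed

text \<open>
  The corrected potential \<open>U\<close> is uniformly convex with constant \<open>2 \<theta> / \<sigma>\<^sup>2\<close>, and \<open>exp (- U)\<close> differs from
  the weight \<open>\<Omega>\<close> by a factor between 1 and \<open>exp (32 / (27 \<sigma>\<^sup>2))\<close>. Passing back to \<open>\<Omega>\<close> is the argument of
  Holley and Stroock: the entropy is the minimum over \<open>c\<close> of the integral of the nonnegative entropy
  excess, so the constant \<open>c\<close> of the corrected measure may be kept.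
\<close>
lemma log_sobolev_tilted_double_well:
  fixes f f' :: "real \<Rightarrow> real" and h :: real
  assumes \<theta>: "0 < \<theta>" and \<sigma>: "0 < \<sigma>"
    and f: "\<And>a b. abs_cont_on a b f f'" "\<And>x. 0 \<le> f x"
  defines "\<Omega> \<equiv> \<lambda>x. exp (h * x) * quartic_weight (1 / (4 * \<sigma>\<^sup>2)) ((\<theta> - 1 / 2) / \<sigma>\<^sup>2) x"
  assumes fw: "integrable lborel (\<lambda>x. f x * \<Omega> x)" and mass: "(LBINT x. f x * \<Omega> x) = (LBINT x. \<Omega> x)"
    and J: "integrable lborel (\<lambda>x. (f' x)\<^sup>2 / f x * \<Omega> x)"
  shows "integrable lborel (\<lambda>x. f x * ln (f x) * \<Omega> x)"
    and "(LBINT x. f x * ln (f x) * \<Omega> x)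
      \<le> \<sigma>\<^sup>2 / (4 * \<theta>) * exp (32 / (27 * \<sigma>\<^sup>2)) * (LBINT x. (f' x)\<^sup>2 / f x * \<Omega> x)"
proof -
  define Q where "Q = (\<lambda>x::real. x ^ 4 / 4 - x\<^sup>2 / 2 - (32 / 27) / (1 + x\<^sup>2))"
  define Q' where "Q' = (\<lambda>x::real. x ^ 3 - x + (64 / 27) * x / (1 + x\<^sup>2)\<^sup>2)"
  define U where "U = (\<lambda>x. (Q x + \<theta> * x\<^sup>2) / \<sigma>\<^sup>2 - h * x)"
  define U' where "U' = (\<lambda>x. (Q' x + \<theta> * (2 * x)) / \<sigma>\<^sup>2 - h)"
  define K where "K = 2 * \<theta> / \<sigma>\<^sup>2"
  define B where "B = exp (32 / (27 * \<sigma>\<^sup>2))"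
  have K: "0 < K" using \<theta> \<sigma> by (simp add: K_def)
  have pos: "1 + z\<^sup>2 \<noteq> 0" for z :: real using zero_le_power2[of z] by linarith
  have dQ: "(Q has_real_derivative Q' z) (at z)" for z
    unfolding Q_def Q'_def by (rule double_well_correction_deriv)
  have U: "(U has_real_derivative U' x) (at x)" for x
  proof -
    have "((\<lambda>x. Q x + \<theta> * x\<^sup>2) has_real_derivative Q' x + \<theta> * (2 * x)) (at x)"
      by (auto intro!: derivative_eq_intros dQ)
    from DERIV_diff[OF DERIV_cdivide[OF this] DERIV_cmult_Id[of h]] show ?thesis
      unfolding U_def U'_def .
  qed
  have U'cont: "continuous_on UNIV U'"
    unfolding U'_def Q'_def using pos \<sigma> by (intro continuous_intros) auto
  have convex: "U x + U' x * (y - x) + K / 2 * (y - x)\<^sup>2 \<le> U y" for x y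
  proof -
    have "Q x + Q' x * (y - x) \<le> Q y"
      using double_well_correction_above_tangent[of x y] by (simp add: Q_def Q'_def)
    then have "(Q x + Q' x * (y - x) + \<theta> * y\<^sup>2) / \<sigma>\<^sup>2 \<le> (Q y + \<theta> * y\<^sup>2) / \<sigma>\<^sup>2"
      by (intro divide_right_mono) auto
    moreover have "U x + U' x * (y - x) + K / 2 * (y - x)\<^sup>2
      = (Q x + Q' x * (y - x) + \<theta> * y\<^sup>2) / \<sigma>\<^sup>2 - h * y"
    proof -
      define s where "s = 1 / \<sigma>\<^sup>2"
      have "(Q x + \<theta> * x\<^sup>2) * s - h * x + ((Q' x + \<theta> * (2 * x)) * s - h) * (y - x) + \<theta> * s * (y - x)\<^sup>2
        = (Q x + Q' x * (y - x) + \<theta> * y\<^sup>2) * s - h * y"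
        by (simp add: algebra_simps power2_eq_square)
      then show ?thesis by (simp add: U_def U'_def K_def s_def)
    qed
    ultimately show ?thesis by (simp add: U_def)
  qed
  have w: "exp (- U x) = \<Omega> x * exp ((32 / 27) / (1 + x\<^sup>2) / \<sigma>\<^sup>2)" for x
  proof -
    define s where "s = 1 / \<sigma>\<^sup>2"
    have "- ((Q x + \<theta> * x\<^sup>2) * s - h * x)
      = h * x + - (s / 4 * x ^ 4 + (\<theta> - 1 / 2) * s * x\<^sup>2) + (32 / 27) / (1 + x\<^sup>2) * s"
      by (simp add: Q_def algebra_simps)
    then show ?thesis
      by (simp add: U_def \<Omega>_def quartic_weight_def s_def flip: exp_add)
  qed
  have \<Omega>_pos: "0 < \<Omega> x" for x by (simp add: \<Omega>_def)
  have \<Omega>_int: "integrable lborel \<Omega>"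
    unfolding \<Omega>_def using integrable_quartic_moment[of "1 / (4 * \<sigma>\<^sup>2)" 0 h] \<sigma> by simp
  have w_ge: "\<Omega> x \<le> exp (- U x)" for x
    unfolding w using \<Omega>_pos[of x] zero_le_power2[of x] by (simp add: less_imp_le add_nonneg_nonneg)
  have w_le: "exp (- U x) \<le> B * \<Omega> x" for x
  proof -
    have "(32 / 27) / (1 + x\<^sup>2) \<le> 32 / 27" using zero_le_power2[of x] by (simp add: divide_le_eq pos add_pos_nonneg)
    then have "(32 / 27) / (1 + x\<^sup>2) / \<sigma>\<^sup>2 \<le> 32 / 27 / \<sigma>\<^sup>2" by (rule divide_right_mono) simp
    then have "exp ((32 / 27) / (1 + x\<^sup>2) / \<sigma>\<^sup>2) \<le> B" by (simp add: B_def)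
    then show ?thesis unfolding w using \<Omega>_pos[of x] by (simp add: mult.commute)
  qed
  have mw [measurable]: "(\<lambda>x. exp (- U x)) \<in> borel_measurable borel"
    unfolding U_def Q_def by measurable
  have dominated: "integrable lborel (\<lambda>x. g x * exp (- U x))"
    if "integrable lborel (\<lambda>x. g x * \<Omega> x)" "\<And>x. 0 \<le> g x" "g \<in> borel_measurable borel" for g :: "real \<Rightarrow> real"
  proof (rule Bochner_Integration.integrable_bound)
    show "integrable lborel (\<lambda>x. B * (g x * \<Omega> x))" using that by simp
    show "(\<lambda>x. g x * exp (- U x)) \<in> borel_measurable lborel" using that by simp
    show "AE x in lborel. norm (g x * exp (- U x)) \<le> norm (B * (g x * \<Omega> x))"
      using mult_left_mono[OF w_le that(2)] that(2) \<Omega>_pos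
      by (intro AE_I2) (simp add: B_def abs_mult less_imp_le mult_ac)
  qed
  have m\<Omega> [measurable]: "\<Omega> \<in> borel_measurable borel" unfolding \<Omega>_def by measurable
  have mf: "f \<in> borel_measurable borel"
  proof -
    have "(\<lambda>x. f x * \<Omega> x / \<Omega> x) \<in> borel_measurable borel"
      using borel_measurable_integrable[OF fw] by measurable
    then show ?thesis using \<Omega>_pos by (simp add: less_imp_neq[symmetric])
  qed
  note [measurable] = mf
  have mJ: "(\<lambda>x. (f' x)\<^sup>2 / f x) \<in> borel_measurable borel"
  proof -
    have "(\<lambda>x. (f' x)\<^sup>2 / f x * \<Omega> x / \<Omega> x) \<in> borel_measurable borel"
      using borel_measurable_integrable[OF J] by measurable
    then show ?thesis using \<Omega>_pos by (simp add: less_imp_neq[symmetric])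
  qed
  have iw: "integrable lborel (\<lambda>x. exp (- U x))" using dominated[of "\<lambda>_. 1"] \<Omega>_int by simp
  have ifw: "integrable lborel (\<lambda>x. f x * exp (- U x))" by (rule dominated[OF fw f(2) mf])
  have iJw: "integrable lborel (\<lambda>x. (f' x)\<^sup>2 / f x * exp (- U x))"
    using f(2) by (intro dominated J mJ) auto
  have "0 < (LBINT x. f x * \<Omega> x)" unfolding mass by (rule integral_pos_of_pos[OF \<Omega>_int]) (simp add: \<Omega>_pos)
  also have "\<dots> \<le> (LBINT x. f x * exp (- U x))"
    using w_ge f(2) by (intro integral_mono fw ifw mult_left_mono) auto
  finally have mass': "0 < (LBINT x. f x * exp (- U x))" .
  define c where "c = (LBINT x. f x * exp (- U x)) / (LBINT x. exp (- U x))"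
  note ls = log_sobolev_uniformly_convex[OF K U U'cont convex f iw ifw mass' iJw, folded c_def]
  have c: "0 < c" by (rule ls(1))
  let ?E = "\<lambda>x. entropy_excess c (f x) * \<Omega> x"
  let ?J = "LBINT x. (f' x)\<^sup>2 / f x * \<Omega> x"
  have E_nonneg: "0 \<le> ?E x" for x
    using entropy_excess_nonneg[OF c f(2)] \<Omega>_pos[of x] by (simp add: less_imp_le)
  have J_le: "(LBINT x. (f' x)\<^sup>2 / f x * exp (- U x)) \<le> B * ?J"
  proof -
    have "(LBINT x. (f' x)\<^sup>2 / f x * exp (- U x)) \<le> (LBINT x. B * ((f' x)\<^sup>2 / f x * \<Omega> x))"
      using mult_left_mono[OF w_le, of "(f' x)\<^sup>2 / f x" x for x] f(2)
      by (intro integral_mono iJw integrable_mult_right J) (simp add: mult_ac)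
    then show ?thesis by (simp only: integral_mult_right_zero)
  qed
  have "(\<integral>\<^sup>+x. ennreal (?E x) \<partial>lborel) \<le> (\<integral>\<^sup>+x. ennreal (entropy_excess c (f x) * exp (- U x)) \<partial>lborel)"
    by (intro nn_integral_mono ennreal_leI mult_left_mono w_ge entropy_excess_nonneg c f(2))
  also note ls(2)
  also have "ennreal (1 / (2 * K) * (LBINT x. (f' x)\<^sup>2 / f x * exp (- U x))) \<le> ennreal (1 / (2 * K) * (B * ?J))"
    using K J_le by (intro ennreal_leI mult_left_mono) auto
  finally have E_le: "(\<integral>\<^sup>+x. ennreal (?E x) \<partial>lborel) \<le> ennreal (1 / (2 * K) * (B * ?J))" .
  have J_nonneg: "0 \<le> ?J" using f(2) \<Omega>_pos by (intro integral_nonneg_AE AE_I2) (simp add: less_imp_le)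
  have E_int: "integrable lborel ?E"
  proof (rule integrableI_nonneg)
    show "?E \<in> borel_measurable lborel" unfolding entropy_excess_def by measurable
    show "(\<integral>\<^sup>+x. ennreal (?E x) \<partial>lborel) < \<infinity>" using E_le by (rule order.strict_trans1) simp
  qed (simp add: E_nonneg)
  have E_integral: "(LBINT x. ?E x) \<le> 1 / (2 * K) * (B * ?J)"
  proof -
    have "ennreal (LBINT x. ?E x) \<le> ennreal (1 / (2 * K) * (B * ?J))"
      using E_le by (subst (asm) nn_integral_eq_integral[OF E_int]) (auto simp: E_nonneg)
    then show ?thesis using K J_nonneg by (subst (asm) ennreal_le_iff) (auto simp: B_def)
  qed
  have split: "f x * ln (f x) * \<Omega> x = ?E x + (1 + ln c) * (f x * \<Omega> x) - c * \<Omega> x" for x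
  proof (cases "f x = 0")
    case False
    then have ln_eq: "ln (f x / c) = ln (f x) - ln c" using f(2)[of x] c by (simp add: ln_div)
    show ?thesis unfolding entropy_excess_def ln_eq by (simp add: algebra_simps)
  qed (simp add: entropy_excess_def)
  show "integrable lborel (\<lambda>x. f x * ln (f x) * \<Omega> x)"
    unfolding split using E_int fw \<Omega>_int by simp
  have "(LBINT x. f x * ln (f x) * \<Omega> x) = (LBINT x. ?E x) + (1 + ln c - c) * (LBINT x. \<Omega> x)"
    unfolding split using E_int fw \<Omega>_int mass by (simp add: algebra_simps)
  also have "\<dots> \<le> (LBINT x. ?E x)"
    using ln_le_minus_one[OF c] integral_pos_of_pos[OF \<Omega>_int] \<Omega>_pos by (simp add: mult_nonpos_nonneg less_imp_le)
  also have "\<dots> \<le> 1 / (2 * K) * (B * ?J)" by (rule E_integral)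
  also have "\<dots> = \<sigma>\<^sup>2 / (4 * \<theta>) * exp (32 / (27 * \<sigma>\<^sup>2)) * ?J" by (simp add: K_def B_def)
  finally show "(LBINT x. f x * ln (f x) * \<Omega> x)
      \<le> \<sigma>\<^sup>2 / (4 * \<theta>) * exp (32 / (27 * \<sigma>\<^sup>2)) * ?J" .
qed

section \<open>The free energy as an entropy\<close>
lemma ext_integral_eq_integral:
  assumes "integrable M g" shows "ext_integral M g = ereal (\<integral>x. g x \<partial>M)"
proof -
  obtain r q where rq: "0 \<le> r" "0 \<le> q" "(\<integral>\<^sup>+x. ennreal (g x) \<partial>M) = ennreal r"
    "(\<integral>\<^sup>+x. ennreal (- g x) \<partial>M) = ennreal q" "(\<integral>x. g x \<partial>M) = r - q"
    using integrableE[OF assms] by blast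
  show ?thesis unfolding ext_integral_def rq(3-5) using rq(1,2) by (simp add: enn2ereal_ennreal)
qed

lemma ext_integral_bounded_below:
  assumes "g \<in> borel_measurable M" "(\<integral>\<^sup>+x. ennreal (- g x) \<partial>M) < \<infinity>"
  shows "ext_integral M g = \<infinity> \<or> integrable M g"
proof (cases "(\<integral>\<^sup>+x. ennreal (g x) \<partial>M) = \<infinity>")
  case True
  obtain q where q: "0 \<le> q" "(\<integral>\<^sup>+x. ennreal (- g x) \<partial>M) = ennreal q"
    using assms(2) by (cases "\<integral>\<^sup>+x. ennreal (- g x) \<partial>M" rule: ennreal_cases) auto
  show ?thesis
    unfolding ext_integral_def True q(2) using q(1) by (simp add: enn2ereal_ennreal)
next
  case False
  moreover have "(\<integral>\<^sup>+x. ennreal (- g x) \<partial>M) \<noteq> \<infinity>" using assms(2) by simp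
  ultimately show ?thesis using assms(1) unfolding real_integrable_def by blast
qed

text \<open>
  Convex duality between \<open>y ln y - y\<close> and \<open>exp\<close>. It gives lower bounds for entropies, and moment
  bounds from finite entropy.
\<close>
lemma Young_entropy: "y * A \<le> y * ln y - y + exp A" if "0 \<le> y" for y A :: real
proof (cases "y = 0")
  case False
  with that have y: "0 < y" by simp
  have "1 + (A - ln y) \<le> exp (A - ln y)" by (rule exp_ge_add_one_self)
  then have "y * (1 + (A - ln y)) \<le> y * exp (A - ln y)" using y by (intro mult_left_mono) auto
  also have "y * exp (A - ln y) = exp A" using y by (simp add: exp_diff)
  finally show ?thesis by (simp add: algebra_simps)
qed simp

context
  fixes \<rho> :: "real measure" and r :: "real \<Rightarrow> real"
  assumes P2: "\<rho> \<in> P2" and density: "\<rho> = density lborel (\<lambda>x. ennreal (r x))"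
    and r_meas [measurable]: "r \<in> borel_measurable borel" and r_nonneg: "\<And>x. 0 \<le> r x"
begin

lemma density_integrable_iff:
  "g \<in> borel_measurable borel \<Longrightarrow> integrable \<rho> g \<longleftrightarrow> integrable lborel (\<lambda>x. r x * g x)"
  unfolding density using r_nonneg by (subst integrable_real_density) auto

lemma density_integral_eq:
  "g \<in> borel_measurable borel \<Longrightarrow> (\<integral>x. g x \<partial>\<rho>) = (LBINT x. r x * g x)"
  unfolding density using r_nonneg by (subst integral_real_density) auto

lemma density_prob: "prob_space \<rho>"
  using P2 by (simp add: P2_def real_distribution_def)

lemma density_moments:
  shows "integrable \<rho> (\<lambda>x. x\<^sup>2)" "integrable \<rho> (\<lambda>x. x)" "integrable \<rho> (\<lambda>x. 1)"
proof -
  interpret prob_space \<rho> by (rule density_prob)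
  have sets: "sets \<rho> = sets borel" by (simp add: density)
  show 2: "integrable \<rho> (\<lambda>x. x\<^sup>2)" using P2 by (simp add: P2_def)
  show "integrable \<rho> (\<lambda>x. 1)" by simp
  show "integrable \<rho> (\<lambda>x. x)"
  proof (rule Bochner_Integration.integrable_bound)
    show "integrable \<rho> (\<lambda>x. 1 + x\<^sup>2)" using 2 by simp
    show "(\<lambda>x. x) \<in> borel_measurable \<rho>" using sets by (simp add: measurable_ident_sets)
    show "AE x in \<rho>. norm x \<le> norm (1 + x\<^sup>2)"
      using abs_le_one_plus_square by (intro AE_I2) simp
  qed
qed

lemma density_moments_lborel:
  shows "integrable lborel (\<lambda>x. r x * x\<^sup>2)" "integrable lborel (\<lambda>x. r x * x)" "integrable lborel r"
    and "(LBINT x. r x) = 1" "(LBINT x. r x * x) = barycenter \<rho>"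
proof -
  show "integrable lborel (\<lambda>x. r x * x\<^sup>2)" "integrable lborel (\<lambda>x. r x * x)"
    by (rule density_integrable_iff[THEN iffD1, OF _ density_moments(1)], measurable)
      (rule density_integrable_iff[THEN iffD1, OF _ density_moments(2)], measurable)
  have "integrable lborel (\<lambda>x. r x * 1)"
    by (rule density_integrable_iff[THEN iffD1, OF _ density_moments(3)]) measurable
  then show "integrable lborel r" by simp
  have "(LBINT x. r x) = (\<integral>x. 1 \<partial>\<rho>)" using density_integral_eq[of "\<lambda>x. 1"] by simp
  also have "\<dots> = 1" using prob_space.prob_space[OF density_prob] by simp
  finally show "(LBINT x. r x) = 1" .
  have "(\<integral>x. x \<partial>\<rho>) = (LBINT x. r x * x)" by (rule density_integral_eq) measurable
  then show "(LBINT x. r x * x) = barycenter \<rho>" unfolding barycenter_def by (rule sym)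
qed

lemma dens_eq_AE: "AE x in lborel. dens \<rho> x = r x"
proof -
  have "AE x in lborel. ennreal (r x) = RN_deriv lborel \<rho> x"
    by (rule sigma_finite_measure.RN_deriv_unique[OF sigma_finite_lborel]) (simp_all add: density)
  then show ?thesis
  proof eventually_elim
    case (elim x)
    show ?case unfolding dens_def elim[symmetric] using r_nonneg[of x] by simp
  qed
qed

lemma absolutely_continuous_density: "absolutely_continuous lborel \<rho>"
  unfolding density by (rule absolutely_continuousI_density) simp

text \<open>
  A multiple of the variance of \<open>\<rho>\<close>; this is what turns the free energy into a relative entropy.
\<close>
lemma interaction_integral:
  "integrable (\<rho> \<Otimes>\<^sub>M \<rho>) (\<lambda>(x, y). W_quad \<theta> x y)"
  "(\<integral>z. (case z of (x, y) \<Rightarrow> W_quad \<theta> x y) \<partial>(\<rho> \<Otimes>\<^sub>M \<rho>)) = 2 * \<theta> * ((\<integral>x. x\<^sup>2 \<partial>\<rho>) - (barycenter \<rho>)\<^sup>2)"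
proof -
  interpret prob_space \<rho> by (rule density_prob)
  interpret pair_prob_space \<rho> \<rho> ..
  note int = density_moments
  have sets [measurable_cong]: "sets \<rho> = sets borel" by (simp add: density)
  have one: "measure \<rho> (space \<rho>) = 1" by (rule prob_space.prob_space[OF density_prob])
  have expand: "W_quad \<theta> x y = \<theta> * x\<^sup>2 * 1 - 2 * \<theta> * x * y + \<theta> * y\<^sup>2" for x y
    by (simp add: W_quad_def power2_eq_square algebra_simps)
  have inner_int: "integrable \<rho> (\<lambda>y. W_quad \<theta> x y)" for x
    unfolding expand using int by (intro Bochner_Integration.integrable_add Bochner_Integration.integrable_diff integrable_mult_right) auto
  have inner: "(\<integral>y. W_quad \<theta> x y \<partial>\<rho>) = \<theta> * x\<^sup>2 - 2 * \<theta> * x * barycenter \<rho> + \<theta> * (\<integral>y. y\<^sup>2 \<partial>\<rho>)" for x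
    unfolding expand using int one by (simp add: barycenter_def)
  have inner_abs: "(\<integral>y. norm (W_quad \<theta> x y) \<partial>\<rho>) = \<bar>\<theta>\<bar> / \<theta> * (\<integral>y. W_quad \<theta> x y \<partial>\<rho>)" for x
  proof -
    have "norm (W_quad \<theta> x y) = \<bar>\<theta>\<bar> / \<theta> * W_quad \<theta> x y" for y by (simp add: W_quad_def abs_mult)
    then show ?thesis by simp
  qed
  show intW: "integrable (\<rho> \<Otimes>\<^sub>M \<rho>) (\<lambda>(x, y). W_quad \<theta> x y)"
  proof (rule Fubini_integrable)
    show "(\<lambda>(x, y). W_quad \<theta> x y) \<in> borel_measurable (\<rho> \<Otimes>\<^sub>M \<rho>)"
      unfolding W_quad_def by measurable
    show "integrable \<rho> (\<lambda>x. \<integral>y. norm (case (x, y) of (x, y) \<Rightarrow> W_quad \<theta> x y) \<partial>\<rho>)"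
      unfolding prod.case inner_abs inner using int by simp
  qed (simp add: inner_int)
  have "(\<integral>z. (case z of (x, y) \<Rightarrow> W_quad \<theta> x y) \<partial>(\<rho> \<Otimes>\<^sub>M \<rho>)) = (\<integral>x. \<integral>y. W_quad \<theta> x y \<partial>\<rho> \<partial>\<rho>)"
    using integral_fst'[OF intW] by simp
  also have "\<dots> = \<theta> * (\<integral>x. x\<^sup>2 \<partial>\<rho>) - 2 * \<theta> * barycenter \<rho> * barycenter \<rho> + \<theta> * (\<integral>y. y\<^sup>2 \<partial>\<rho>)"
    unfolding inner using int one by (simp add: barycenter_def)
  finally show "(\<integral>z. (case z of (x, y) \<Rightarrow> W_quad \<theta> x y) \<partial>(\<rho> \<Otimes>\<^sub>M \<rho>)) = 2 * \<theta> * ((\<integral>x. x\<^sup>2 \<partial>\<rho>) - (barycenter \<rho>)\<^sup>2)"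
    by (simp add: power2_eq_square algebra_simps)
qed

lemma free_energy_parts:
  "free_energy \<sigma> V_dw (W_quad \<theta>) \<rho> = ereal (\<sigma>\<^sup>2) * ext_integral lborel (\<lambda>x. r x * ln (r x))
    + ext_integral \<rho> V_dw + ereal (\<theta> * ((\<integral>x. x\<^sup>2 \<partial>\<rho>) - (barycenter \<rho>)\<^sup>2))"
proof -
  have AE: "AE x in lborel. dens \<rho> x * ln (dens \<rho> x) = r x * ln (r x)"
    using dens_eq_AE by eventually_elim simp
  have "(\<integral>\<^sup>+x. ennreal (dens \<rho> x * ln (dens \<rho> x)) \<partial>lborel) = (\<integral>\<^sup>+x. ennreal (r x * ln (r x)) \<partial>lborel)"
    "(\<integral>\<^sup>+x. ennreal (- (dens \<rho> x * ln (dens \<rho> x))) \<partial>lborel) = (\<integral>\<^sup>+x. ennreal (- (r x * ln (r x))) \<partial>lborel)"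
    by (rule nn_integral_cong_AE, use AE in \<open>eventually_elim, simp\<close>)+
  then have "ext_integral lborel (\<lambda>x. dens \<rho> x * ln (dens \<rho> x)) = ext_integral lborel (\<lambda>x. r x * ln (r x))"
    by (simp only: ext_integral_def)
  moreover have "ext_integral (\<rho> \<Otimes>\<^sub>M \<rho>) (\<lambda>(x, y). W_quad \<theta> x y)
    = ereal (2 * \<theta> * ((\<integral>x. x\<^sup>2 \<partial>\<rho>) - (barycenter \<rho>)\<^sup>2))"
    using ext_integral_eq_integral[OF interaction_integral(1)] interaction_integral(2) by simp
  ultimately show ?thesis
    unfolding free_energy_def by (simp add: absolutely_continuous_density)
qed

text \<open>
  A finite second moment keeps the entropy away from \<open>- \<infinity>\<close>, by comparison with a Gaussian.
\<close>
lemma entropy_negative_part: "(\<integral>\<^sup>+x. ennreal (- (r x * ln (r x))) \<partial>lborel) < \<infinity>"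
proof -
  have "integrable lborel (\<lambda>x. r x * x\<^sup>2 + exp (- x\<^sup>2))"
    using density_moments_lborel(1) integrable_exp_minus_square by simp
  then have fin: "(\<integral>\<^sup>+x. ennreal (r x * x\<^sup>2 + exp (- x\<^sup>2)) \<partial>lborel) < \<infinity>"
    by (simp add: real_integrable_def less_top)
  have "(\<integral>\<^sup>+x. ennreal (- (r x * ln (r x))) \<partial>lborel) \<le> (\<integral>\<^sup>+x. ennreal (r x * x\<^sup>2 + exp (- x\<^sup>2)) \<partial>lborel)"
  proof (intro nn_integral_mono ennreal_leI)
    show "- (r x * ln (r x)) \<le> r x * x\<^sup>2 + exp (- x\<^sup>2)" for x
      using Young_entropy[OF r_nonneg, of x "- x\<^sup>2"] r_nonneg[of x] by simp
  qed
  with fin show ?thesis by (rule order.strict_trans1[rotated])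
qed

lemma potential_bounded_below: "ext_integral \<rho> V_dw = \<infinity> \<or> integrable \<rho> V_dw"
proof (rule ext_integral_bounded_below)
  interpret prob_space \<rho> by (rule density_prob)
  have [measurable_cong]: "sets \<rho> = sets borel" by (simp add: density)
  show "V_dw \<in> borel_measurable \<rho>" unfolding V_dw_def[abs_def] by measurable
  have "- V_dw x \<le> 1 / 4" for x
    using zero_le_power2[of "x\<^sup>2 - 1"] unfolding V_dw_def power2_diff by simp
  then have "(\<integral>\<^sup>+x. ennreal (- V_dw x) \<partial>\<rho>) \<le> (\<integral>\<^sup>+x. ennreal (1 / 4) \<partial>\<rho>)"
    by (intro nn_integral_mono ennreal_leI)
  also have "\<dots> < \<infinity>" by (simp add: emeasure_space_1)
  finally show "(\<integral>\<^sup>+x. ennreal (- V_dw x) \<partial>\<rho>) < \<infinity>" .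
qed

text \<open>
  The relative entropy of \<open>\<rho>\<close> with respect to the normalised tilted weight, with the logarithm of the
  density of that weight expanded.
\<close>
definition tilted_entropy :: "real \<Rightarrow> real \<Rightarrow> real \<Rightarrow> real" where
  "tilted_entropy a b h = (LBINT x. r x * ln (r x)) + a * (LBINT x. r x * x ^ 4)
    + b * (LBINT x. r x * x\<^sup>2) - h * barycenter \<rho> + log_partition a b h"

text \<open>
  Relative entropies are nonnegative; as the tilt \<open>h\<close> is free, this is the Gibbs variational principle.
\<close>
lemma gibbs_variational:
  assumes a: "0 < a" and ent: "integrable lborel (\<lambda>x. r x * ln (r x))"
    and m4: "integrable lborel (\<lambda>x. r x * x ^ 4)"
  shows "0 \<le> tilted_entropy a b h"
proof -
  define L where "L = log_partition a b h"
  have Z: "0 < quartic_moment 0 a b h" by (intro quartic_moment_even_pos a) simp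
  let ?A = "\<lambda>x. h * x - a * x ^ 4 - b * x\<^sup>2 - L"
  have expA: "exp (?A x) = exp (h * x) * quartic_weight a b x / quartic_moment 0 a b h" for x
    using Z by (simp add: quartic_weight_def L_def log_partition_def exp_diff exp_minus exp_add field_simps)
  have iA: "integrable lborel (\<lambda>x. exp (?A x))" and tA: "(LBINT x. exp (?A x)) = 1"
    unfolding expA using integrable_quartic_moment[OF a, of 0 h b] Z by (simp_all add: quartic_moment_def)
  note mom = density_moments_lborel
  have rA: "r x * ?A x = h * (r x * x) - a * (r x * x ^ 4) - b * (r x * x\<^sup>2) - L * r x" for x
    by (simp add: algebra_simps)
  have irA: "integrable lborel (\<lambda>x. r x * ?A x)" unfolding rA using mom m4 by simp
  have "(LBINT x. r x * ?A x) \<le> (LBINT x. r x * ln (r x) - r x + exp (?A x))"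
    using ent mom iA by (intro integral_mono irA Young_entropy r_nonneg) auto
  also have "\<dots> = (LBINT x. r x * ln (r x))" using ent mom iA tA by simp
  finally have "(LBINT x. r x * ?A x) \<le> (LBINT x. r x * ln (r x))" .
  moreover have "(LBINT x. r x * ?A x)
    = h * barycenter \<rho> - a * (LBINT x. r x * x ^ 4) - b * (LBINT x. r x * x\<^sup>2) - L"
    unfolding rA using mom m4 by simp
  ultimately show ?thesis by (simp add: tilted_entropy_def L_def)
qed

lemma free_energy_eq_tilted_entropy:
  assumes \<sigma>: "0 < \<sigma>" and ent: "integrable lborel (\<lambda>x. r x * ln (r x))"
    and m4: "integrable lborel (\<lambda>x. r x * x ^ 4)"
  shows "free_energy \<sigma> V_dw (W_quad \<theta>) \<rho> = ereal (
    \<sigma>\<^sup>2 * tilted_entropy (quartic_coeff \<sigma>) (quadratic_coeff \<theta> \<sigma>) (tilt \<theta> \<sigma> (barycenter \<rho>))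
    + mean_field_energy \<theta> \<sigma> (barycenter \<rho>))"
proof -
  define S where "S = (LBINT x. r x * ln (r x))"
  define M2 where "M2 = (LBINT x. r x * x\<^sup>2)"
  define M4 where "M4 = (LBINT x. r x * x ^ 4)"
  have V: "r x * V_dw x = 1 / 4 * (r x * x ^ 4) - 1 / 2 * (r x * x\<^sup>2)" for x
    by (simp add: V_dw_def field_simps)
  have Vm: "V_dw \<in> borel_measurable borel" unfolding V_dw_def[abs_def] by measurable
  have "integrable \<rho> V_dw"
    unfolding density_integrable_iff[OF Vm] V using m4 density_moments_lborel(1) by simp
  then have "ext_integral \<rho> V_dw = ereal (1 / 4 * M4 - 1 / 2 * M2)"
    using m4 density_moments_lborel(1)
    by (simp add: ext_integral_eq_integral density_integral_eq[OF Vm] V M2_def M4_def)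
  moreover have "(\<integral>x. x\<^sup>2 \<partial>\<rho>) = M2" by (simp add: density_integral_eq M2_def)
  ultimately have "free_energy \<sigma> V_dw (W_quad \<theta>) \<rho>
    = ereal (\<sigma>\<^sup>2 * S + (1 / 4 * M4 - 1 / 2 * M2) + \<theta> * (M2 - (barycenter \<rho>)\<^sup>2))"
    unfolding free_energy_parts ext_integral_eq_integral[OF ent] S_def[symmetric] by simp
  moreover have "\<sigma>\<^sup>2 * tilted_entropy (quartic_coeff \<sigma>) (quadratic_coeff \<theta> \<sigma>) (tilt \<theta> \<sigma> (barycenter \<rho>))
    + mean_field_energy \<theta> \<sigma> (barycenter \<rho>)
    = \<sigma>\<^sup>2 * S + (1 / 4 * M4 - 1 / 2 * M2) + \<theta> * (M2 - (barycenter \<rho>)\<^sup>2)"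
  proof -
    have s: "\<sigma>\<^sup>2 * (quartic_coeff \<sigma> * M4) = 1 / 4 * M4" "\<sigma>\<^sup>2 * (quadratic_coeff \<theta> \<sigma> * M2) = (\<theta> - 1 / 2) * M2"
      "\<sigma>\<^sup>2 * (tilt \<theta> \<sigma> (barycenter \<rho>) * barycenter \<rho>) = 2 * \<theta> * (barycenter \<rho>)\<^sup>2"
      using \<sigma> by (simp_all add: power2_eq_square)
    show ?thesis
      unfolding tilted_entropy_def mean_field_energy_def S_def[symmetric] M2_def[symmetric] M4_def[symmetric]
        distrib_left right_diff_distrib s
      by (simp add: algebra_simps)
  qed
  ultimately show ?thesis by simp
qed

text \<open>
  The negative parts of the entropy and of the potential energy are finite, so the free energy is
  infinite as soon as one of these two terms is; otherwise the Gibbs variational principle applies.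
\<close>
lemma free_energy_ge_mean_field_energy_density:
  assumes \<sigma>: "0 < \<sigma>"
  shows "ereal (mean_field_energy \<theta> \<sigma> (barycenter \<rho>)) \<le> free_energy \<sigma> V_dw (W_quad \<theta>) \<rho>"
proof -
  have ent: "ext_integral lborel (\<lambda>x. r x * ln (r x)) = \<infinity> \<or> integrable lborel (\<lambda>x. r x * ln (r x))"
    by (rule ext_integral_bounded_below[OF _ entropy_negative_part]) measurable
  have not_minf: "ext_integral M g \<noteq> - \<infinity>" if "ext_integral M g = \<infinity> \<or> integrable M g" for M :: "real measure" and g
    using that ext_integral_eq_integral[of M g] by auto
  have s2: "0 < ereal (\<sigma>\<^sup>2)" using \<sigma> by simp
  consider "ext_integral lborel (\<lambda>x. r x * ln (r x)) = \<infinity>" | "integrable lborel (\<lambda>x. r x * ln (r x))" "ext_integral \<rho> V_dw = \<infinity>"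
    | "integrable lborel (\<lambda>x. r x * ln (r x))" "integrable \<rho> V_dw"
    using ent potential_bounded_below by blast
  then show ?thesis
  proof cases
    case 1
    then have "free_energy \<sigma> V_dw (W_quad \<theta>) \<rho> = \<infinity>"
      unfolding free_energy_parts using not_minf[OF potential_bounded_below] s2 by simp
    then show ?thesis by simp
  next
    case 2
    then have "free_energy \<sigma> V_dw (W_quad \<theta>) \<rho> = \<infinity>"
      unfolding free_energy_parts by (simp add: ext_integral_eq_integral)
    then show ?thesis by simp
  next
    case 3
    have Vm: "V_dw \<in> borel_measurable borel" unfolding V_dw_def[abs_def] by measurable
    have "integrable lborel (\<lambda>x. 4 * (r x * V_dw x) + 2 * (r x * x\<^sup>2))"
      using 3(2) density_moments_lborel(1) by (simp add: density_integrable_iff[OF Vm])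
    moreover have "4 * (r x * V_dw x) + 2 * (r x * x\<^sup>2) = r x * x ^ 4" for x
      by (simp add: V_dw_def algebra_simps)
    ultimately have m4: "integrable lborel (\<lambda>x. r x * x ^ 4)" by simp
    have "0 \<le> \<sigma>\<^sup>2 * tilted_entropy (quartic_coeff \<sigma>) (quadratic_coeff \<theta> \<sigma>) (tilt \<theta> \<sigma> (barycenter \<rho>))"
      using \<sigma> by (intro mult_nonneg_nonneg gibbs_variational 3(1) m4) auto
    then show ?thesis unfolding free_energy_eq_tilted_entropy[OF \<sigma> 3(1) m4] by simp
  qed
qed

end

lemma P2_density:
  assumes "\<rho> \<in> P2" "absolutely_continuous lborel \<rho>"
  obtains r where "\<rho> = density lborel (\<lambda>x. ennreal (r x))" "r \<in> borel_measurable borel" "\<And>x. 0 \<le> r x"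
proof -
  have rd: "real_distribution \<rho>" using assms by (simp add: P2_def)
  then interpret real_distribution \<rho> .
  have sets: "sets \<rho> = sets lborel" by simp
  obtain D where D: "D \<in> borel_measurable lborel" "AE x in lborel. RN_deriv lborel \<rho> x = ennreal (D x)" "\<And>x. 0 \<le> D x"
    using sigma_finite_measure.real_RN_deriv[OF sigma_finite_lborel finite_measure_axioms assms(2) sets] by blast
  have "\<rho> = density lborel (RN_deriv lborel \<rho>)"
    using sigma_finite_measure.density_RN_deriv[OF sigma_finite_lborel assms(2) sets] by simp
  also have "\<dots> = density lborel (\<lambda>x. ennreal (D x))"
    using D by (intro density_cong) auto
  finally show ?thesis using that[of D] D by simp
qed

lemma free_energy_ge_mean_field_energy:
  assumes "\<rho> \<in> P2" "0 < \<sigma>"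
  shows "ereal (mean_field_energy \<theta> \<sigma> (barycenter \<rho>)) \<le> free_energy \<sigma> V_dw (W_quad \<theta>) \<rho>"
proof (cases "absolutely_continuous lborel \<rho>")
  case True
  obtain r where "\<rho> = density lborel (\<lambda>x. ennreal (r x))" "r \<in> borel_measurable borel" "\<And>x. 0 \<le> r x"
    using P2_density[OF assms(1) True] by blast
  then show ?thesis by (rule free_energy_ge_mean_field_energy_density[OF assms(1)]) (rule assms(2))
qed (simp add: free_energy_def)

section \<open>Relative Fisher information\<close>
text \<open>
  The continuous representative is nonnegative everywhere, since it is so almost everywhere and
  closed sets of full measure are the whole line.
\<close>
lemma weak_deriv_representative:
  assumes wd: "has_weak_deriv u g" and nonneg: "\<And>x. 0 \<le> u x"
  obtains v where "AE x in lborel. u x = v x" "\<And>a b. abs_cont_on a b v g" "\<And>x. 0 \<le> v x"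
    "v \<in> borel_measurable borel" "g \<in> borel_measurable borel"
proof -
  obtain v where v: "AE x in lborel. u x = v x" "\<And>a b. a \<le> b \<Longrightarrow> v b - v a = (LBINT t:{a..b}. g t)"
    and g: "\<And>a b. set_integrable lborel {a..b} g"
    using wd unfolding has_weak_deriv_def by blast
  have ac: "abs_cont_on a b v g" for a b
  proof (rule abs_cont_onI[OF g])
    show "v x = v a + (LBINT t:{a..x}. g t)" if "a \<le> x" "x \<le> b" for x
      using v(2)[OF that(1)] by simp
  qed
  have cont: "continuous_on UNIV v"
  proof (rule continuous_at_imp_continuous_on, rule ballI)
    fix x show "isCont v x"
      using abs_cont_on_continuous[OF ac[of "x - 1" "x + 1"]]
      by (rule continuous_on_interior) (simp add: interior_atLeastAtMost_real)
  qed
  have "closed {x. 0 \<le> v x}"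
    by (intro closed_Collect_le continuous_intros cont)
  moreover have "AE x in lebesgue. x \<in> {x. 0 \<le> v x}"
  proof (rule AE_completion)
    show "AE x in lborel. x \<in> {x. 0 \<le> v x}"
      using v(1) by eventually_elim (use nonneg in \<open>metis mem_Collect_eq\<close>)
  qed
  ultimately have v_nonneg: "0 \<le> v x" for x
    using mem_closed_if_AE_lebesgue[of "{x. 0 \<le> v x}" x] by simp
  have "(\<lambda>x. indicator {- real n..real n} x *\<^sub>R g x) \<in> borel_measurable borel" for n
    using g[of "- real n" "real n"] by (simp add: set_integrable_def)
  moreover have "(\<lambda>n. indicator {- real n..real n} x *\<^sub>R g x) \<longlonglongrightarrow> g x" for x
  proof (rule tendsto_eventually)
    obtain N where "\<bar>x\<bar> \<le> real N" using real_arch_simple by blast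
    then show "eventually (\<lambda>n. indicator {- real n..real n} x *\<^sub>R g x = g x) sequentially"
      by (intro eventually_sequentiallyI[of N]) (auto simp: indicator_def)
  qed
  ultimately have "g \<in> borel_measurable borel" by (rule borel_measurable_LIMSEQ_metric)
  with v(1) ac v_nonneg borel_measurable_continuous_onI[OF cont] show ?thesis by (rule that)
qed

lemma gibbs_dens_props:
  assumes "0 < \<sigma>"
  shows "0 < gibbs_dens \<theta> \<sigma> m x" "gibbs_dens \<theta> \<sigma> m \<in> borel_measurable borel"
    "integrable lborel (gibbs_dens \<theta> \<sigma> m)" "(LBINT x. gibbs_dens \<theta> \<sigma> m x) = 1"
proof -
  have a: "0 < quartic_coeff \<sigma>" using assms by simp
  let ?Z = "quartic_moment 0 (quartic_coeff \<sigma>) (quadratic_coeff \<theta> \<sigma>) (tilt \<theta> \<sigma> m)"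
  have Z: "0 < ?Z" by (intro quartic_moment_even_pos a) simp
  show "0 < gibbs_dens \<theta> \<sigma> m x" unfolding gibbs_dens_eq using Z by simp
  show "gibbs_dens \<theta> \<sigma> m \<in> borel_measurable borel"
    unfolding gibbs_dens_eq[abs_def] by measurable
  have int: "integrable lborel (\<lambda>x. exp (tilt \<theta> \<sigma> m * x) * quartic_weight (quartic_coeff \<sigma>) (quadratic_coeff \<theta> \<sigma>) x)"
    using integrable_quartic_moment[OF a, of 0 "tilt \<theta> \<sigma> m" "quadratic_coeff \<theta> \<sigma>"] by simp
  show "integrable lborel (gibbs_dens \<theta> \<sigma> m)"
    unfolding gibbs_dens_eq[abs_def] by (rule integrable_divide[OF int])
  show "(LBINT x. gibbs_dens \<theta> \<sigma> m x) = 1"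
    unfolding gibbs_dens_eq[abs_def] using Z by (simp add: quartic_moment_def)
qed

lemma ln_gibbs_dens:
  assumes "0 < \<sigma>"
  shows "ln (gibbs_dens \<theta> \<sigma> m x) = tilt \<theta> \<sigma> m * x - quartic_coeff \<sigma> * x ^ 4 - quadratic_coeff \<theta> \<sigma> * x\<^sup>2
    - log_partition (quartic_coeff \<sigma>) (quadratic_coeff \<theta> \<sigma>) (tilt \<theta> \<sigma> m)"
proof -
  have Z: "0 < quartic_moment 0 (quartic_coeff \<sigma>) (quadratic_coeff \<theta> \<sigma>) (tilt \<theta> \<sigma> m)"
    using assms by (intro quartic_moment_even_pos) auto
  have w: "quartic_weight (quartic_coeff \<sigma>) (quadratic_coeff \<theta> \<sigma>) x \<noteq> 0"
    using quartic_weight_pos by (metis less_irrefl)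
  have "ln (gibbs_dens \<theta> \<sigma> m x) = ln (exp (tilt \<theta> \<sigma> m * x) * quartic_weight (quartic_coeff \<sigma>) (quadratic_coeff \<theta> \<sigma>) x)
    - log_partition (quartic_coeff \<sigma>) (quadratic_coeff \<theta> \<sigma>) (tilt \<theta> \<sigma> m)"
    unfolding gibbs_dens_eq log_partition_def using Z w by (subst ln_div) auto
  also have "ln (exp (tilt \<theta> \<sigma> m * x) * quartic_weight (quartic_coeff \<sigma>) (quadratic_coeff \<theta> \<sigma>) x)
    = tilt \<theta> \<sigma> m * x - quartic_coeff \<sigma> * x ^ 4 - quadratic_coeff \<theta> \<sigma> * x\<^sup>2"
    unfolding quartic_weight_def exp_add[symmetric] by simp
  finally show ?thesis .
qed

text \<open>
  Gibbs measures have a positive Lebesgue density, hence the same null sets as Lebesgue measure, and the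
  density of \<open>\<rho>\<close> can be replaced by its absolutely continuous representative \<open>v\<close>. The Fisher
  information then is the integral of \<open>g\<^sup>2 / v\<close>, where the quotient is 0 at the zeros of \<open>v\<close>.
\<close>
lemma finite_fisher_density:
  assumes \<rho>: "\<rho> \<in> P2" and \<sigma>: "0 < \<sigma>" and fin: "rel_fisher \<rho> (gibbs \<theta> \<sigma> m) \<noteq> \<infinity>"
  obtains v g where "\<And>a b. abs_cont_on a b v g" "\<And>x. 0 \<le> v x" "v \<in> borel_measurable borel"
    "\<rho> = density lborel (\<lambda>x. ennreal (v x * gibbs_dens \<theta> \<sigma> m x))"
    "integrable lborel (\<lambda>x. (g x)\<^sup>2 / v x * gibbs_dens \<theta> \<sigma> m x)"
    "(LBINT x. (g x)\<^sup>2 / v x * gibbs_dens \<theta> \<sigma> m x) = enn2real (rel_fisher \<rho> (gibbs \<theta> \<sigma> m))"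
proof -
  let ?\<mu> = "gibbs \<theta> \<sigma> m" and ?\<gamma> = "gibbs_dens \<theta> \<sigma> m"
  note \<gamma> = gibbs_dens_props[OF \<sigma>, of \<theta> m]
  note [measurable] = \<gamma>(2)
  define u where "u = (\<lambda>x. enn2real (RN_deriv ?\<mu> \<rho> x))"
  have cond: "absolutely_continuous ?\<mu> \<rho> \<and> (\<exists>g. has_weak_deriv u g)"
    using fin unfolding rel_fisher_def u_def by (auto simp: Let_def split: if_splits)
  then have ac: "absolutely_continuous ?\<mu> \<rho>" by simp
  define g where "g = weak_deriv u"
  have fisher: "rel_fisher \<rho> ?\<mu> = (\<integral>\<^sup>+x. ennreal ((g x / u x)\<^sup>2) \<partial>\<rho>)"
    using cond unfolding rel_fisher_def u_def g_def by (simp add: Let_def)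
  have "has_weak_deriv u g"
    unfolding g_def weak_deriv_def by (rule someI_ex[of "has_weak_deriv u"]) (use cond in blast)
  then obtain v where v: "AE x in lborel. u x = v x" "\<And>a b. abs_cont_on a b v g" "\<And>x. 0 \<le> v x"
    "v \<in> borel_measurable borel" and gm: "g \<in> borel_measurable borel"
    by (rule weak_deriv_representative[where u=u]) (simp add: u_def, rule that)
  note [measurable] = v(4) gm
  have rd: "real_distribution \<rho>" using \<rho> by (simp add: P2_def)
  then interpret real_distribution \<rho> .
  have sets: "sets \<rho> = sets ?\<mu>" by (simp add: gibbs_def)
  have "prob_space ?\<mu>"
  proof
    have "emeasure ?\<mu> (space ?\<mu>) = (\<integral>\<^sup>+x. ennreal (?\<gamma> x) \<partial>lborel)"
      by (simp add: gibbs_def emeasure_density)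
    also have "\<dots> = 1" using \<gamma>(1,3,4) by (subst nn_integral_eq_integral) (auto simp: less_imp_le)
    finally show "emeasure ?\<mu> (space ?\<mu>) = 1" .
  qed
  then interpret G: prob_space ?\<mu> .
  obtain D where D: "D \<in> borel_measurable ?\<mu>" "AE x in ?\<mu>. RN_deriv ?\<mu> \<rho> x = ennreal (D x)" "\<And>x. 0 \<le> D x"
    using G.real_RN_deriv[OF finite_measure_axioms ac sets] by blast
  have AE_\<mu>: "(AE x in ?\<mu>. P x) \<longleftrightarrow> (AE x in lborel. P x)" for P
    unfolding gibbs_def using \<gamma>(1) by (subst AE_density) auto
  have RN_v: "AE x in ?\<mu>. RN_deriv ?\<mu> \<rho> x = ennreal (v x)"
    using D(2) v(1)[folded AE_\<mu>]
  proof eventually_elim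
    case (elim x)
    then show ?case using D(3)[of x] by (simp add: u_def)
  qed
  have "\<rho> = density ?\<mu> (RN_deriv ?\<mu> \<rho>)" using G.density_RN_deriv[OF ac sets] by simp
  also have "\<dots> = density ?\<mu> (\<lambda>x. ennreal (v x))"
    using RN_v by (intro density_cong) (auto simp: gibbs_def)
  also have "\<dots> = density lborel (\<lambda>x. ennreal (?\<gamma> x) * ennreal (v x))"
    unfolding gibbs_def by (rule density_density_eq) measurable
  also have "\<dots> = density lborel (\<lambda>x. ennreal (v x * ?\<gamma> x))"
    using v(3) \<gamma>(1) by (intro density_cong) (auto simp: ennreal_mult' less_imp_le mult.commute)
  finally have dens: "\<rho> = density lborel (\<lambda>x. ennreal (v x * ?\<gamma> x))" .
  have AE_\<rho>: "AE x in \<rho>. u x = v x"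
    unfolding dens using v(1) by (subst AE_density) auto
  have "rel_fisher \<rho> ?\<mu> = (\<integral>\<^sup>+x. ennreal ((g x / v x)\<^sup>2) \<partial>\<rho>)"
    unfolding fisher by (rule nn_integral_cong_AE) (use AE_\<rho> in \<open>eventually_elim, simp\<close>)
  also have "\<dots> = (\<integral>\<^sup>+x. ennreal (v x * ?\<gamma> x) * ennreal ((g x / v x)\<^sup>2) \<partial>lborel)"
    unfolding dens by (rule nn_integral_density) measurable
  also have "\<dots> = (\<integral>\<^sup>+x. ennreal ((g x)\<^sup>2 / v x * ?\<gamma> x) \<partial>lborel)"
  proof (rule nn_integral_cong)
    fix x
    have "v x * ?\<gamma> x * (g x / v x)\<^sup>2 = (g x)\<^sup>2 / v x * ?\<gamma> x"
      by (cases "v x = 0") (simp_all add: power2_eq_square)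
    then show "ennreal (v x * ?\<gamma> x) * ennreal ((g x / v x)\<^sup>2) = ennreal ((g x)\<^sup>2 / v x * ?\<gamma> x)"
      by (simp flip: ennreal_mult'')
  qed
  finally have fisher': "rel_fisher \<rho> ?\<mu> = (\<integral>\<^sup>+x. ennreal ((g x)\<^sup>2 / v x * ?\<gamma> x) \<partial>lborel)" .
  have J_nonneg: "0 \<le> (g x)\<^sup>2 / v x * ?\<gamma> x" for x using v(3)[of x] \<gamma>(1)[of x] by simp
  have J: "integrable lborel (\<lambda>x. (g x)\<^sup>2 / v x * ?\<gamma> x)"
  proof (rule integrableI_nonneg)
    show "(\<integral>\<^sup>+x. ennreal ((g x)\<^sup>2 / v x * ?\<gamma> x) \<partial>lborel) < \<infinity>"
      using fin unfolding fisher' by (simp add: less_top)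
  qed (use J_nonneg in auto)
  have "rel_fisher \<rho> ?\<mu> = ennreal (LBINT x. (g x)\<^sup>2 / v x * ?\<gamma> x)"
    unfolding fisher' using J_nonneg by (intro nn_integral_eq_integral[OF J]) simp
  then have "(LBINT x. (g x)\<^sup>2 / v x * ?\<gamma> x) = enn2real (rel_fisher \<rho> ?\<mu>)"
    using J_nonneg by simp
  with v(2-4) dens J show ?thesis by (rule that)
qed

text \<open>
  The logarithmic Sobolev inequality applied to the density \<open>v\<close> of \<open>\<rho>\<close> with respect to the Gibbs measure.
  Expanding the entropy into separate integrals needs a finite fourth moment of \<open>\<rho>\<close>, which follows
  from the finite relative entropy because the Gibbs measure integrates \<open>exp (x\<^sup>4 / (8 \<sigma>\<^sup>2))\<close>.
\<close>
lemma tilted_entropy_le_fisher: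
  assumes \<rho>: "\<rho> \<in> P2" and \<theta>: "0 < \<theta>" and \<sigma>: "0 < \<sigma>" and m: "m = barycenter \<rho>"
    and fin: "rel_fisher \<rho> (gibbs \<theta> \<sigma> m) \<noteq> \<infinity>"
  obtains r where "\<rho> = density lborel (\<lambda>x. ennreal (r x))" "r \<in> borel_measurable borel" "\<And>x. 0 \<le> r x"
    "integrable lborel (\<lambda>x. r x * ln (r x))" "integrable lborel (\<lambda>x. r x * x ^ 4)"
    "tilted_entropy \<rho> r (quartic_coeff \<sigma>) (quadratic_coeff \<theta> \<sigma>) (tilt \<theta> \<sigma> m)
      \<le> \<sigma>\<^sup>2 / (4 * \<theta>) * exp (32 / (27 * \<sigma>\<^sup>2)) * enn2real (rel_fisher \<rho> (gibbs \<theta> \<sigma> m))"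
proof -
  let ?\<gamma> = "gibbs_dens \<theta> \<sigma> m" and ?h = "tilt \<theta> \<sigma> m"
  let ?a = "quartic_coeff \<sigma>" and ?b = "quadratic_coeff \<theta> \<sigma>"
  define Z where "Z = quartic_moment 0 ?a ?b ?h"
  define \<Omega> where "\<Omega> = (\<lambda>x. exp (?h * x) * quartic_weight ?a ?b x)"
  define C where "C = \<sigma>\<^sup>2 / (4 * \<theta>) * exp (32 / (27 * \<sigma>\<^sup>2))"
  have a: "0 < ?a" using \<sigma> by simp
  have Z: "0 < Z" unfolding Z_def by (intro quartic_moment_even_pos a) simp
  have \<gamma>_eq: "?\<gamma> x = \<Omega> x / Z" for x by (simp add: gibbs_dens_eq Z_def \<Omega>_def)
  note \<gamma> = gibbs_dens_props[OF \<sigma>, of \<theta> m]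
  obtain v g where v: "\<And>a b. abs_cont_on a b v g" "\<And>x. 0 \<le> v x" "v \<in> borel_measurable borel"
    and dens: "\<rho> = density lborel (\<lambda>x. ennreal (v x * ?\<gamma> x))"
    and J: "integrable lborel (\<lambda>x. (g x)\<^sup>2 / v x * ?\<gamma> x)"
      "(LBINT x. (g x)\<^sup>2 / v x * ?\<gamma> x) = enn2real (rel_fisher \<rho> (gibbs \<theta> \<sigma> m))"
    by (rule finite_fisher_density[OF \<rho> \<sigma> fin]) (rule that, assumption+)
  note [measurable] = v(3) \<gamma>(2)
  define r where "r = (\<lambda>x. v x * ?\<gamma> x)"
  have r: "\<rho> = density lborel (\<lambda>x. ennreal (r x))" "r \<in> borel_measurable borel" "0 \<le> r x" for x
    using dens v(2)[of x] \<gamma>(1)[of x] by (simp_all add: r_def)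
  note mom = density_moments_lborel[OF \<rho> r]
  have \<Omega>int: "integrable lborel \<Omega>" "(LBINT x. \<Omega> x) = Z"
    using integrable_quartic_moment[OF a, of 0 ?h ?b] by (simp_all add: \<Omega>_def Z_def quartic_moment_def)
  have v\<Omega>: "v x * \<Omega> x = Z * r x" for x using Z by (simp add: r_def \<gamma>_eq)
  have J\<Omega>: "(g x)\<^sup>2 / v x * \<Omega> x = Z * ((g x)\<^sup>2 / v x * ?\<gamma> x)" for x using Z by (simp add: \<gamma>_eq)
  have E\<Omega>: "v x * ln (v x) * \<Omega> x = Z * (v x * ln (v x) * ?\<gamma> x)" for x using Z by (simp add: \<gamma>_eq)
  have hyps: "integrable lborel (\<lambda>x. v x * \<Omega> x)" "(LBINT x. v x * \<Omega> x) = (LBINT x. \<Omega> x)"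
    "integrable lborel (\<lambda>x. (g x)\<^sup>2 / v x * \<Omega> x)"
    unfolding v\<Omega> J\<Omega> using mom(3,4) \<Omega>int integrable_mult_right[OF J(1), of Z] by simp_all
  have \<Omega>x: "exp (?h * x) * quartic_weight ?a ?b x = \<Omega> x" for x by (simp add: \<Omega>_def)
  note lsi = log_sobolev_tilted_double_well[OF \<theta> \<sigma> v(1,2), of ?h, unfolded \<Omega>x, OF hyps, folded C_def]
  have iE: "integrable lborel (\<lambda>x. v x * ln (v x) * ?\<gamma> x)"
    using lsi(1) Z unfolding E\<Omega> by simp
  have E_le: "(LBINT x. v x * ln (v x) * ?\<gamma> x) \<le> C * enn2real (rel_fisher \<rho> (gibbs \<theta> \<sigma> m))"
  proof -
    have "Z * (LBINT x. v x * ln (v x) * ?\<gamma> x) \<le> Z * (C * enn2real (rel_fisher \<rho> (gibbs \<theta> \<sigma> m)))"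
      using lsi(2) unfolding E\<Omega> J\<Omega> integral_mult_right_zero J(2) by (simp only: mult.left_commute)
    then show ?thesis using Z by simp
  qed
  have m4: "integrable lborel (\<lambda>x. r x * x ^ 4)"
  proof -
    have tail: "integrable lborel (\<lambda>x. exp (?a / 2 * x ^ 4) * ?\<gamma> x)"
    proof -
      have "exp (?a / 2 * x ^ 4) * ?\<gamma> x = x ^ 0 * exp (?h * x) * quartic_weight (?a / 2) ?b x / Z" for x
        by (simp add: \<gamma>_eq \<Omega>_def quartic_weight_def flip: exp_add)
      then show ?thesis using integrable_quartic_moment[of "?a / 2" 0 ?h ?b] a by simp
    qed
    have "integrable lborel (\<lambda>x. ?a / 2 * (r x * x ^ 4))"
    proof (rule Bochner_Integration.integrable_bound)
      show "integrable lborel (\<lambda>x. v x * ln (v x) * ?\<gamma> x - r x + exp (?a / 2 * x ^ 4) * ?\<gamma> x)"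
        using iE mom(3) tail by simp
      show "(\<lambda>x. ?a / 2 * (r x * x ^ 4)) \<in> borel_measurable lborel" using r(2) by measurable
      show "AE x in lborel. norm (?a / 2 * (r x * x ^ 4)) \<le> norm (v x * ln (v x) * ?\<gamma> x - r x + exp (?a / 2 * x ^ 4) * ?\<gamma> x)"
      proof (rule AE_I2)
        fix x
        have "v x * (?a / 2 * x ^ 4) * ?\<gamma> x \<le> (v x * ln (v x) - v x + exp (?a / 2 * x ^ 4)) * ?\<gamma> x"
          using \<gamma>(1)[of x] by (intro mult_right_mono Young_entropy v(2)) simp
        then have "?a / 2 * (r x * x ^ 4) \<le> v x * ln (v x) * ?\<gamma> x - r x + exp (?a / 2 * x ^ 4) * ?\<gamma> x"
          by (simp add: r_def algebra_simps)
        moreover have "0 \<le> ?a / 2 * (r x * x ^ 4)" using r(3)[of x] by simp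
        ultimately show "norm (?a / 2 * (r x * x ^ 4)) \<le> norm (v x * ln (v x) * ?\<gamma> x - r x + exp (?a / 2 * x ^ 4) * ?\<gamma> x)"
          by simp
      qed
    qed
    from integrable_mult_right[OF this, of "8 * \<sigma>\<^sup>2"] show ?thesis using \<sigma> by simp
  qed
  define L where "L = log_partition ?a ?b ?h"
  have rlnr: "r x * ln (r x) = v x * ln (v x) * ?\<gamma> x + ?h * (r x * x) - ?a * (r x * x ^ 4) - ?b * (r x * x\<^sup>2) - L * r x" for x
  proof (cases "v x = 0")
    case False
    then have "ln (r x) = ln (v x) + ln (?\<gamma> x)" using v(2)[of x] \<gamma>(1)[of x] unfolding r_def by (subst ln_mult) auto
    also note ln_gibbs_dens[OF \<sigma>]
    finally have "r x * ln (r x) = r x * (ln (v x) + (?h * x - ?a * x ^ 4 - ?b * x\<^sup>2 - L))" by (simp only: L_def)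
    also have "\<dots> = v x * ln (v x) * ?\<gamma> x + ?h * (r x * x) - ?a * (r x * x ^ 4) - ?b * (r x * x\<^sup>2) - L * r x"
      unfolding distrib_left right_diff_distrib by (simp add: r_def mult_ac)
    finally show ?thesis .
  qed (simp add: r_def)
  have ent: "integrable lborel (\<lambda>x. r x * ln (r x))"
    unfolding rlnr using iE mom m4 by simp
  have "(LBINT x. r x * ln (r x)) = (LBINT x. v x * ln (v x) * ?\<gamma> x) + ?h * barycenter \<rho>
    - ?a * (LBINT x. r x * x ^ 4) - ?b * (LBINT x. r x * x\<^sup>2) - L"
    unfolding rlnr using iE mom m4 by simp
  then have "tilted_entropy \<rho> r ?a ?b ?h = (LBINT x. v x * ln (v x) * ?\<gamma> x)"
    unfolding tilted_entropy_def[OF \<rho> r] L_def by simp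
  then show ?thesis using r ent m4 E_le by (intro that[of r]) (auto simp: C_def)
qed

text \<open>
  The Gibbs variational principle with a second tilt \<open>h'\<close> bounds the relative entropy below by a
  concave quadratic function of \<open>h' - h\<close>; the choice \<open>h' = h + d / V\<close> maximises it.
\<close>
lemma tilted_entropy_controls_mean:
  assumes \<rho>: "\<rho> \<in> P2" and r: "\<rho> = density lborel (\<lambda>x. ennreal (r x))" "r \<in> borel_measurable borel" "\<And>x. 0 \<le> r x"
    and a: "0 < a" and ent: "integrable lborel (\<lambda>x. r x * ln (r x))" and m4: "integrable lborel (\<lambda>x. r x * x ^ 4)"
  shows "(barycenter \<rho> - tilted_mean a b h)\<^sup>2 \<le> 2 * tilted_variance a b 0 * tilted_entropy \<rho> r a b h"
proof -
  define V where "V = tilted_variance a b 0"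
  define d where "d = barycenter \<rho> - tilted_mean a b h"
  have V: "0 < V" unfolding V_def by (rule tilted_variance_pos[OF a])
  define h' where "h' = h + d / V"
  have "0 \<le> tilted_entropy \<rho> r a b h'" by (rule gibbs_variational[OF \<rho> r a ent m4])
  moreover have "log_partition a b h' \<le> log_partition a b h + tilted_mean a b h * (h' - h) + V / 2 * (h' - h)\<^sup>2"
    unfolding V_def by (rule log_partition_quadratic_upper[OF a])
  moreover have "h' - h = d / V" by (simp add: h'_def)
  ultimately have "0 \<le> tilted_entropy \<rho> r a b h - d / V * barycenter \<rho> + tilted_mean a b h * (d / V) + V / 2 * (d / V)\<^sup>2"
    unfolding tilted_entropy_def[OF \<rho> r] by (simp add: h'_def algebra_simps)
  also have "\<dots> = tilted_entropy \<rho> r a b h - d\<^sup>2 / (2 * V)"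
    using V by (simp add: d_def field_simps power2_eq_square)
  finally show ?thesis using V by (simp add: d_def V_def field_simps)
qed

theorem proposition13:
  fixes \<theta> \<sigma> \<epsilon> :: real
  assumes "0 < \<theta>"
    and "0 < \<sigma>" and "\<sigma>\<^sup>2 < crit_var \<theta>"
    and "0 < \<epsilon>"
  shows "\<exists>\<alpha> \<eta> :: real. 0 \<le> \<alpha> \<and> \<alpha> < 1 \<and> 0 < \<eta> \<and>
    (\<forall>m\<ge>\<epsilon>. \<bar>mean_map \<theta> \<sigma> m - m_plus \<theta> \<sigma>\<bar> \<le> \<alpha> * \<bar>m - m_plus \<theta> \<sigma>\<bar>) \<and>
    (\<forall>\<rho>\<in>P2. \<epsilon> \<le> \<bar>barycenter \<rho>\<bar> \<longrightarrow>
       free_energy \<sigma> V_dw (W_quad \<theta>) \<rho> - (INF \<mu>\<in>P2. free_energy \<sigma> V_dw (W_quad \<theta>) \<mu>)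
         \<le> ereal (\<eta> * \<sigma> ^ 4) * enn2ereal (rel_fisher \<rho> (Gamma_map \<theta> \<sigma> \<rho>))) \<and>
    (\<forall>\<rho>\<in>A_eps \<epsilon>.
       free_energy \<sigma> V_dw (W_quad \<theta>) \<rho> - (INF \<mu>\<in>A_eps \<epsilon>. free_energy \<sigma> V_dw (W_quad \<theta>) \<mu>)
         \<le> ereal (\<eta> * \<sigma> ^ 4) * enn2ereal (rel_fisher \<rho> (Gamma_map \<theta> \<sigma> \<rho>)))"
proof -
  note \<theta> = assms(1) and \<sigma> = assms(2)
  let ?F = "free_energy \<sigma> V_dw (W_quad \<theta>)" and ?f = "mean_map \<theta> \<sigma>" and ?E = "mean_field_energy \<theta> \<sigma>"
  define p where "p = m_plus \<theta> \<sigma>"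
  have p: "0 < p" "?f p = p" using m_plus_fixed_point[OF assms(1-3)] by (simp_all add: p_def)
  define e where "e = min \<epsilon> (p / 2)"
  have e: "0 < e" "e < p" "e \<le> \<epsilon>" using p(1) assms(4) by (auto simp: e_def min_def)
  obtain \<alpha> where \<alpha>: "0 < \<alpha>" "\<alpha> < 1" "\<And>m. e \<le> m \<Longrightarrow> \<bar>?f m - p\<bar> \<le> \<alpha> * \<bar>m - p\<bar>"
    using mean_map_contraction[OF \<theta> \<sigma> p e(1,2)] by blast
  define V where "V = tilted_variance (quartic_coeff \<sigma>) (quadratic_coeff \<theta> \<sigma>) 0"
  have V: "0 < V" unfolding V_def using \<sigma> by (intro tilted_variance_pos) simp
  define C where "C = \<sigma>\<^sup>2 / (4 * \<theta>) * exp (32 / (27 * \<sigma>\<^sup>2))"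
  \<comment> \<open>\<open>C\<close> is the constant of the logarithmic Sobolev inequality, \<open>D\<close> bounds the excess energy by
    the relative entropy\<close>
  define D where "D = \<sigma>\<^sup>2 + \<theta> * (2 * V / (1 - \<alpha>)\<^sup>2)"
  define \<eta> where "\<eta> = D * C / \<sigma> ^ 4"
  have C: "0 < C" using \<theta> \<sigma> by (simp add: C_def)
  have D: "0 < D" using \<theta> \<sigma> V \<alpha>(2) unfolding D_def by (intro add_pos_pos mult_pos_pos divide_pos_pos) auto
  have \<eta>: "0 < \<eta>" "\<eta> * \<sigma> ^ 4 = D * C" using C D \<sigma> by (simp_all add: \<eta>_def)
  have lower: "ereal (?E p) \<le> ?F \<mu>" if "\<mu> \<in> P2" for \<mu>
    using mean_field_energy_minimum[OF \<theta> \<sigma> p, of "barycenter \<mu>"]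
      free_energy_ge_mean_field_energy[OF that \<sigma>, of \<theta>] by (meson ereal_less_eq(3) order_trans)
  have upper: "?F \<rho> - L \<le> ereal (\<eta> * \<sigma> ^ 4) * enn2ereal (rel_fisher \<rho> (Gamma_map \<theta> \<sigma> \<rho>))"
    if \<rho>: "\<rho> \<in> P2" "\<epsilon> \<le> \<bar>barycenter \<rho>\<bar>" and L: "ereal (?E p) \<le> L" for \<rho> L
  proof (cases "rel_fisher \<rho> (Gamma_map \<theta> \<sigma> \<rho>) = \<infinity>")
    case True
    have "ereal (\<eta> * \<sigma> ^ 4) * enn2ereal (rel_fisher \<rho> (Gamma_map \<theta> \<sigma> \<rho>)) = \<infinity>"
      unfolding True \<eta>(2) using C D by simp
    then show ?thesis by (simp only: ereal_less_eq)
  next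
    case False
    define m where "m = barycenter \<rho>"
    define I where "I = enn2real (rel_fisher \<rho> (gibbs \<theta> \<sigma> m))"
    have fin: "rel_fisher \<rho> (gibbs \<theta> \<sigma> m) \<noteq> \<infinity>" using False by (simp add: Gamma_map_def m_def)
    have fisher: "enn2ereal (rel_fisher \<rho> (Gamma_map \<theta> \<sigma> \<rho>)) = ereal I"
      using fin unfolding I_def Gamma_map_def m_def[symmetric]
      by (cases "rel_fisher \<rho> (gibbs \<theta> \<sigma> m)" rule: ennreal_cases) (auto simp: enn2ereal_ennreal)
    obtain r where r: "\<rho> = density lborel (\<lambda>x. ennreal (r x))" "r \<in> borel_measurable borel" "\<And>x. 0 \<le> r x"
      and ent: "integrable lborel (\<lambda>x. r x * ln (r x))" and m4: "integrable lborel (\<lambda>x. r x * x ^ 4)"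
      and lsi: "tilted_entropy \<rho> r (quartic_coeff \<sigma>) (quadratic_coeff \<theta> \<sigma>) (tilt \<theta> \<sigma> m) \<le> C * I"
      by (rule tilted_entropy_le_fisher[OF \<rho>(1) \<theta> \<sigma> m_def fin, folded C_def I_def]) (rule that, assumption+)
    define T where "T = tilted_entropy \<rho> r (quartic_coeff \<sigma>) (quadratic_coeff \<theta> \<sigma>) (tilt \<theta> \<sigma> m)"
    have a: "0 < quartic_coeff \<sigma>" using \<sigma> by simp
    have F: "?F \<rho> = ereal (\<sigma>\<^sup>2 * T + ?E m)"
      using free_energy_eq_tilted_entropy[OF \<rho>(1) r \<sigma> ent m4, of \<theta>] by (simp only: T_def m_def)
    have gap: "(m - ?f m)\<^sup>2 \<le> 2 * V * T"
      using tilted_entropy_controls_mean[OF \<rho>(1) r a ent m4] by (simp only: T_def V_def m_def mean_map_eq)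
    have "(\<bar>m\<bar> - p)\<^sup>2 \<le> 2 * V / (1 - \<alpha>)\<^sup>2 * T"
    proof -
      have "?f \<bar>m\<bar> = (if 0 \<le> m then ?f m else - ?f m)"
        using mean_map_odd_concave(4)[OF \<theta> \<sigma>, of m] by (auto simp: abs_if)
      then have odd: "\<bar>\<bar>m\<bar> - ?f \<bar>m\<bar>\<bar> = \<bar>m - ?f m\<bar>" by (auto simp: abs_if)
      have "\<bar>?f \<bar>m\<bar> - p\<bar> \<le> \<alpha> * \<bar>\<bar>m\<bar> - p\<bar>" using \<rho>(2) e(3) by (intro \<alpha>(3)) (simp add: m_def)
      moreover have "\<bar>\<bar>m\<bar> - p\<bar> \<le> \<bar>\<bar>m\<bar> - ?f \<bar>m\<bar>\<bar> + \<bar>?f \<bar>m\<bar> - p\<bar>" by linarith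
      ultimately have "(1 - \<alpha>) * \<bar>\<bar>m\<bar> - p\<bar> \<le> \<bar>m - ?f m\<bar>" unfolding odd by (simp add: algebra_simps)
      then have "((1 - \<alpha>) * \<bar>\<bar>m\<bar> - p\<bar>)\<^sup>2 \<le> \<bar>m - ?f m\<bar>\<^sup>2" using \<alpha>(2) by (intro power_mono) auto
      then have "(1 - \<alpha>)\<^sup>2 * (\<bar>m\<bar> - p)\<^sup>2 \<le> 2 * V * T" using gap by (simp add: power_mult_distrib)
      then show ?thesis using \<alpha>(2) by (simp add: field_simps)
    qed
    then have "\<theta> * (\<bar>m\<bar> - p)\<^sup>2 \<le> \<theta> * (2 * V / (1 - \<alpha>)\<^sup>2 * T)" using \<theta> by (intro mult_left_mono) auto
    then have "\<sigma>\<^sup>2 * T + ?E m - ?E p \<le> D * T"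
      using mean_field_energy_quadratic_upper[OF \<theta> \<sigma> p(2), of m] by (simp add: D_def algebra_simps)
    also have "\<dots> \<le> D * (C * I)" using lsi D unfolding T_def by (intro mult_left_mono) auto
    finally have bound: "\<sigma>\<^sup>2 * T + ?E m - ?E p \<le> D * C * I" by (simp add: mult.assoc)
    have "?F \<rho> - L \<le> ?F \<rho> - ereal (?E p)" by (rule ereal_minus_mono[OF order_refl L])
    also have "\<dots> \<le> ereal (\<eta> * \<sigma> ^ 4) * ereal I" unfolding F \<eta>(2) using bound by simp
    finally show ?thesis unfolding fisher .
  qed
  have "\<forall>\<rho>\<in>P2. \<epsilon> \<le> \<bar>barycenter \<rho>\<bar> \<longrightarrow> ?F \<rho> - (INF \<mu>\<in>P2. ?F \<mu>)
      \<le> ereal (\<eta> * \<sigma> ^ 4) * enn2ereal (rel_fisher \<rho> (Gamma_map \<theta> \<sigma> \<rho>))"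
    by (intro ballI impI upper INF_greatest lower)
  moreover have "\<forall>\<rho>\<in>A_eps \<epsilon>. ?F \<rho> - (INF \<mu>\<in>A_eps \<epsilon>. ?F \<mu>)
      \<le> ereal (\<eta> * \<sigma> ^ 4) * enn2ereal (rel_fisher \<rho> (Gamma_map \<theta> \<sigma> \<rho>))"
    by (intro ballI upper INF_greatest lower) (auto simp: A_eps_def)
  moreover have "\<forall>m\<ge>\<epsilon>. \<bar>?f m - m_plus \<theta> \<sigma>\<bar> \<le> \<alpha> * \<bar>m - m_plus \<theta> \<sigma>\<bar>"
    using \<alpha>(3) e(3) by (auto simp: p_def[symmetric])
  ultimately show ?thesis using \<alpha>(1,2) \<eta>(1) by (intro exI[of _ \<alpha>] exI[of _ \<eta>] conjI) auto
qed

end
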